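(* Let $f:[0,T]\times\mathbb{R}^d\to\mathbb{R}^d$ and $g^r:[0,T]\to\mathbb{R}^d$, $r=1,\ldots,m$, be continuously differentiable, and suppose there exist $L\in(0,\infty)$ and $q\in[2,\infty)$ such that for all $t\in[0,T]$ and $x,x_1,x_2\in\mathbb{R}^d$ $$\langle f(t,x_1)-f(t,x_2),x_1-x_2\rangle\le L|x_1-x_2|^2,\qquad \big|\tfrac{\partial f}{\partial t}(t,x)\big|\le L(1+|x|)^q,$$ $$\big|\tfrac{\partial f}{\partial x}(t,x_1)-\tfrac{\partial f}{\partial x}(t,x_2)\big|_{\mathcal{L}(\mathbb{R}^d)}\le L(1+|x_1|+|x_2|)^{q-2}|x_1-x_2|.$$ Let $X$ be the solution of the SODE with additive noise $dX(t)=f(t,X(t))\,dt+\sum_{r=1}^m g^r(t)\,dW^r(t)$, $t\in[0,T]$, $X(0)=X_0$, where $X_0\in L^p(\Omega,\mathcal{F}_0,\mathbf{P};\mathbb{R}^d)$ with $p=8q-6$ in (i) and $p=6q-4$ in (ii). Then: (i) the projected Euler-Maruyama method with $\alpha=\frac{1}{2(q-1)}$ and arbitrary upper step size bound $\overline{h}\in(0,1]$ is strongly convergent of order $\gamma=1$; (ii) the split-step backward Euler method with arbitrary upper step size bound $\overline{h}\in(0,L^{-1})$ is strongly convergent of order $\gamma=1$.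
   Context: Setting. Fix $d,m\in\mathbb{N}$, $T\in(0,\infty)$, and a filtered probability space $(\Omega,\mathcal{F},(\mathcal{F}_t)_{t\in[0,T]},\mathbf{P})$ satisfying the usual conditions, carrying independent real-valued standard $(\mathcal{F}_t)$-Brownian motions $W^1,\ldots,W^m$. $\langle\cdot,\cdot\rangle$ and $|\cdot|$ are the Euclidean inner product and norm on $\mathbb{R}^d$, $|\cdot|_{\mathcal{L}(\mathbb{R}^d)}$ is the induced matrix norm, $\|Y\|_{L^p(\Omega;\mathbb{R}^d)}=(\mathbb{E}|Y|^p)^{1/p}$, and $\frac{\partial f}{\partial x}(t,x)$ is the Jacobian of $x\mapsto f(t,x)$. The solution $X$ is the unique almost surely continuous $(\mathcal{F}_t)$-adapted process satisfying the integral form of the SODE almost surely for all $t\in[0,T]$. Step sizes. For an upper step size bound $\overline h$, a vector of step sizes is $h=(h_1,\ldots,h_N)\in(0,\overline{h}]^N$, $N\in\mathbb N$, with $\sum_{i=1}^N h_i=T$; grid points $t_n:=\sum_{i=1}^n h_i$, $n=0,\ldots,N$; $|h|:=\max_i h_i$. Write $I_{(r)}^{s,t}:=W^r(t)-W^r(s)$. Projected Euler-Maruyama method (parameter $\alpha$), in the additive noise case: $X_h(0)=X_0$ and for $1\le i\le N$: $\overline X_h(t_i)=\min(1,h_i^{-\alpha}|X_h(t_{i-1})|^{-1})X_h(t_{i-1})$ (equal to $0$ if $X_h(t_{i-1})=0$), $X_h(t_i)=\overline X_h(t_i)+h_if(t_{i-1},\overline X_h(t_i))+\sum_{r=1}^m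 g^r(t_{i-1})I_{(r)}^{t_{i-1},t_i}$. Split-step backward Euler method, in the additive noise case: $X_h(0)=X_0$ and for $1\le i\le N$: $\overline X_h(t_i)$ is the solution (unique for $h_i<L^{-1}$) of $\overline X_h(t_i)=X_h(t_{i-1})+h_if(t_i,\overline X_h(t_i))$, and $X_h(t_i)=\overline X_h(t_i)+\sum_{r=1}^m g^r(t_i)I_{(r)}^{t_{i-1},t_i}$. Strong convergence. A method with upper step size bound $\overline h$ is strongly convergent of order $\gamma>0$ if there exists a constant $C$ such that for every $N\in\mathbb{N}$ and every vector of step sizes $h\in(0,\overline h]^N$: $\max_{n\in\{0,\ldots,N\}}\|X_h(t_n)-X(t_n)\|_{L^2(\Omega;\mathbb{R}^d)}\le C|h|^\gamma$. *)

theory Defs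
  imports "HOL-Probability.Probability"
begin

section \<open>Filtered probability spaces and Brownian motion\<close>

locale usual_filtered_prob_space = prob_space M + complete_measure M
  for M :: "'w measure" and F :: "real \<Rightarrow> 'w measure" and T :: real +
  assumes subalgebra_F: "t \<in> {0..T} \<Longrightarrow> subalgebra M (F t)"
    and F_mono: "0 \<le> s \<Longrightarrow> s \<le> t \<Longrightarrow> t \<le> T \<Longrightarrow> sets (F s) \<subseteq> sets (F t)"
    and null_sets_F0: "null_sets M \<subseteq> sets (F 0)"
    and F_right_continuous: "0 \<le> t \<Longrightarrow> t < T \<Longrightarrow> sets (F t) = (\<Inter>s\<in>{t<..T}. sets (F s))"

definition adapted ::
    "(real \<Rightarrow> 'w measure) \<Rightarrow> real \<Rightarrow> (real \<Rightarrow> 'w \<Rightarrow> 'a::topological_space) \<Rightarrow> bool" where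
  "adapted F T Y \<longleftrightarrow> (\<forall>t\<in>{0..T}. Y t \<in> borel_measurable (F t))"

definition progressive ::
    "(real \<Rightarrow> 'w measure) \<Rightarrow> real \<Rightarrow> (real \<Rightarrow> 'w \<Rightarrow> 'a::topological_space) \<Rightarrow> bool" where
  "progressive F T Y \<longleftrightarrow>
     (\<forall>t\<in>{0..T}. case_prod Y \<in> borel_measurable (restrict_space borel {0..t} \<Otimes>\<^sub>M F t))"

definition ae_continuous ::
    "'w measure \<Rightarrow> real \<Rightarrow> (real \<Rightarrow> 'w \<Rightarrow> 'a::topological_space) \<Rightarrow> bool" where
  "ae_continuous M T Y \<longleftrightarrow> (AE \<omega> in M. continuous_on {0..T} (\<lambda>t. Y t \<omega>))"

definition brownian_motion ::
    "'w measure \<Rightarrow> (real \<Rightarrow> 'w measure) \<Rightarrow> real \<Rightarrow> (real \<Rightarrow> 'w \<Rightarrow> real) \<Rightarrow> bool" where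
  "brownian_motion M F T W \<longleftrightarrow>
     adapted F T W \<and> ae_continuous M T W \<and> (AE \<omega> in M. W 0 \<omega> = 0) \<and>
     (\<forall>s t. 0 \<le> s \<and> s < t \<and> t \<le> T \<longrightarrow>
        distributed M lborel (\<lambda>\<omega>. W t \<omega> - W s \<omega>) (normal_density 0 (sqrt (t - s))) \<and>
        prob_space.indep_set M (sets (F s))
          (sets (vimage_algebra (space M) (\<lambda>\<omega>. W t \<omega> - W s \<omega>) borel)))"

definition independent_processes ::
    "'w measure \<Rightarrow> real \<Rightarrow> ('m \<Rightarrow> real \<Rightarrow> 'w \<Rightarrow> real) \<Rightarrow> bool" where
  "independent_processes M T W \<longleftrightarrow>
     prob_space.indep_vars M (\<lambda>_. PiM {0..T} (\<lambda>_. borel)) (\<lambda>r \<omega>. \<lambda>t\<in>{0..T}. W r t \<omega>) UNIV"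

section \<open>Lebesgue spaces of random vectors\<close>

text \<open>The Bochner integral of a non-integrable function is \<open>0\<close>, so \<open>Lp_norm\<close> is meaningful only
  together with \<open>in_Lp\<close>.\<close>

definition in_Lp :: "'w measure \<Rightarrow> real \<Rightarrow> ('w \<Rightarrow> 'a::euclidean_space) \<Rightarrow> bool" where
  "in_Lp M p Y \<longleftrightarrow> Y \<in> borel_measurable M \<and> integrable M (\<lambda>\<omega>. norm (Y \<omega>) powr p)"

definition Lp_norm :: "'w measure \<Rightarrow> real \<Rightarrow> ('w \<Rightarrow> 'a::euclidean_space) \<Rightarrow> real" where
  "Lp_norm M p Y = (\<integral>\<omega>. norm (Y \<omega>) powr p \<partial>M) powr (1 / p)"

section \<open>Stochastic integral\<close>

text \<open>The data \<open>k, \<tau>, \<xi>\<close> represent the simple process that equals \<open>\<xi> j\<close> on \<open>{\<tau> j<..\<tau> (Suc j)}\<close> for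
  \<open>j < k\<close> and vanishes elsewhere.\<close>

definition simple_integrand ::
    "'w measure \<Rightarrow> (real \<Rightarrow> 'w measure) \<Rightarrow> real \<Rightarrow> nat \<Rightarrow> (nat \<Rightarrow> real) \<Rightarrow> (nat \<Rightarrow> 'w \<Rightarrow> 'a::euclidean_space) \<Rightarrow> bool"
  where
  "simple_integrand M F T k \<tau> \<xi> \<longleftrightarrow>
     0 \<le> \<tau> 0 \<and> (\<forall>j<k. \<tau> j \<le> \<tau> (Suc j)) \<and> \<tau> k \<le> T \<and>
     (\<forall>j<k. \<xi> j \<in> borel_measurable (F (\<tau> j)) \<and> bounded (\<xi> j ` space M))"

definition simple_process ::
    "nat \<Rightarrow> (nat \<Rightarrow> real) \<Rightarrow> (nat \<Rightarrow> 'w \<Rightarrow> 'a::euclidean_space) \<Rightarrow> real \<Rightarrow> 'w \<Rightarrow> 'a" where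
  "simple_process k \<tau> \<xi> s \<omega> = (\<Sum>j<k. indicator {\<tau> j<..\<tau> (Suc j)} s *\<^sub>R \<xi> j \<omega>)"

definition simple_integral ::
    "(real \<Rightarrow> 'w \<Rightarrow> real) \<Rightarrow> nat \<Rightarrow> (nat \<Rightarrow> real) \<Rightarrow> (nat \<Rightarrow> 'w \<Rightarrow> 'a::euclidean_space) \<Rightarrow> real \<Rightarrow> 'w \<Rightarrow> 'a"
  where
  "simple_integral W k \<tau> \<xi> t \<omega> =
     (\<Sum>j<k. (W (min (\<tau> (Suc j)) t) \<omega> - W (min (\<tau> j) t) \<omega>) *\<^sub>R \<xi> j \<omega>)"

text \<open>\<open>is_ito_integral M F T W G J\<close>: the process \<open>J\<close> is the continuous version, unique up to
  indistinguishability, of the Ito integral process of the square-integrable integrand \<open>G\<close> with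
  respect to the Brownian motion \<open>W\<close>.\<close>

definition is_ito_integral ::
    "'w measure \<Rightarrow> (real \<Rightarrow> 'w measure) \<Rightarrow> real \<Rightarrow> (real \<Rightarrow> 'w \<Rightarrow> real) \<Rightarrow>
     (real \<Rightarrow> 'w \<Rightarrow> 'a::euclidean_space) \<Rightarrow> (real \<Rightarrow> 'w \<Rightarrow> 'a) \<Rightarrow> bool" where
  "is_ito_integral M F T W G J \<longleftrightarrow>
     progressive F T G \<and>
     (\<integral>\<^sup>+\<omega>. (\<integral>\<^sup>+s\<in>{0..T}. ennreal ((norm (G s \<omega>))\<^sup>2) \<partial>lborel) \<partial>M) < \<infinity> \<and>
     adapted F T J \<and> ae_continuous M T J \<and>
     (\<exists>k \<tau> \<xi>.
        (\<forall>n. simple_integrand M F T (k n) (\<tau> n) (\<xi> n)) \<and>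
        (\<lambda>n. \<integral>\<^sup>+\<omega>. (\<integral>\<^sup>+s\<in>{0..T}.
            ennreal ((norm (simple_process (k n) (\<tau> n) (\<xi> n) s \<omega> - G s \<omega>))\<^sup>2) \<partial>lborel) \<partial>M)
          \<longlonglongrightarrow> 0 \<and>
        (\<forall>t\<in>{0..T}. (\<lambda>n. \<integral>\<^sup>+\<omega>.
            ennreal ((norm (simple_integral W (k n) (\<tau> n) (\<xi> n) t \<omega> - J t \<omega>))\<^sup>2) \<partial>M)
          \<longlonglongrightarrow> 0))"

section \<open>The stochastic differential equation\<close>

text \<open>Derivatives are taken within \<open>S\<close>; for \<open>S = {0..T}\<close> and \<open>S = {0..T} \<times> UNIV\<close> they are
  one-sided in time at \<open>0\<close> and \<open>T\<close>.\<close>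

definition C1_on :: "'a::real_normed_vector set \<Rightarrow> ('a \<Rightarrow> 'b::real_normed_vector) \<Rightarrow> bool" where
  "C1_on S \<phi> \<longleftrightarrow>
     (\<exists>D. (\<forall>z\<in>S. (\<phi> has_derivative blinfun_apply (D z)) (at z within S)) \<and> continuous_on S D)"

definition is_sode_solution ::
    "'w measure \<Rightarrow> (real \<Rightarrow> 'w measure) \<Rightarrow> real \<Rightarrow> ('m::finite \<Rightarrow> real \<Rightarrow> 'w \<Rightarrow> real) \<Rightarrow>
     (real \<Rightarrow> 'a::euclidean_space \<Rightarrow> 'a) \<Rightarrow> ('m \<Rightarrow> real \<Rightarrow> 'a) \<Rightarrow> ('w \<Rightarrow> 'a) \<Rightarrow> (real \<Rightarrow> 'w \<Rightarrow> 'a) \<Rightarrow> bool"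
  where
  "is_sode_solution M F T W f g X\<^sub>0 X \<longleftrightarrow>
     adapted F T X \<and> ae_continuous M T X \<and>
     (\<exists>J. (\<forall>r. is_ito_integral M F T (W r) (\<lambda>s _. g r s) (J r)) \<and>
          (AE \<omega> in M. \<forall>t\<in>{0..T}.
             X t \<omega> = X\<^sub>0 \<omega> + (LBINT s:{0..t}. f s (X s \<omega>)) + (\<Sum>r\<in>UNIV. J r t \<omega>)))"

section \<open>Time grids and numerical methods\<close>

text \<open>A vector of step sizes \<open>(h\<^sub>1, \<dots>, h\<^sub>N)\<close> is a function on \<open>nat\<close> of which only the values on
  \<open>{1..N}\<close> matter.\<close>

definition step_sizes :: "real \<Rightarrow> real \<Rightarrow> nat \<Rightarrow> (nat \<Rightarrow> real) \<Rightarrow> bool" where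
  "step_sizes T hbar N h \<longleftrightarrow>
     1 \<le> N \<and> (\<forall>i\<in>{1..N}. 0 < h i \<and> h i \<le> hbar) \<and> (\<Sum>i=1..N. h i) = T"

definition grid :: "(nat \<Rightarrow> real) \<Rightarrow> nat \<Rightarrow> real" where
  "grid h n = (\<Sum>i=1..n. h i)"

definition max_step :: "nat \<Rightarrow> (nat \<Rightarrow> real) \<Rightarrow> real" where
  "max_step N h = (MAX i\<in>{1..N}. h i)"

definition pem_projection :: "real \<Rightarrow> real \<Rightarrow> 'a::euclidean_space \<Rightarrow> 'a" where
  "pem_projection \<alpha> \<eta> x =
     (if x = 0 then 0 else min 1 (\<eta> powr (- \<alpha>) * inverse (norm x)) *\<^sub>R x)"

primrec projected_euler_maruyama ::
    "real \<Rightarrow> (real \<Rightarrow> 'a::euclidean_space \<Rightarrow> 'a) \<Rightarrow> ('m::finite \<Rightarrow> real \<Rightarrow> 'a) \<Rightarrow>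
     ('m \<Rightarrow> real \<Rightarrow> 'w \<Rightarrow> real) \<Rightarrow> ('w \<Rightarrow> 'a) \<Rightarrow> (nat \<Rightarrow> real) \<Rightarrow> nat \<Rightarrow> 'w \<Rightarrow> 'a" where
  "projected_euler_maruyama \<alpha> f g W X\<^sub>0 h 0 = X\<^sub>0"
| "projected_euler_maruyama \<alpha> f g W X\<^sub>0 h (Suc n) = (\<lambda>\<omega>.
     let y = pem_projection \<alpha> (h (Suc n)) (projected_euler_maruyama \<alpha> f g W X\<^sub>0 h n \<omega>)
     in y + h (Suc n) *\<^sub>R f (grid h n) y +
        (\<Sum>r\<in>UNIV. (W r (grid h (Suc n)) \<omega> - W r (grid h n) \<omega>) *\<^sub>R g r (grid h n)))"

text \<open>The implicit equation has a unique solution if \<open>f t\<close> is continuous and one-sided Lipschitz with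
  constant \<open>L\<close> and the step size is below \<open>1 / L\<close>; otherwise the value of \<open>THE\<close> is unspecified.\<close>

primrec split_step_backward_euler ::
    "(real \<Rightarrow> 'a::euclidean_space \<Rightarrow> 'a) \<Rightarrow> ('m::finite \<Rightarrow> real \<Rightarrow> 'a) \<Rightarrow>
     ('m \<Rightarrow> real \<Rightarrow> 'w \<Rightarrow> real) \<Rightarrow> ('w \<Rightarrow> 'a) \<Rightarrow> (nat \<Rightarrow> real) \<Rightarrow> nat \<Rightarrow> 'w \<Rightarrow> 'a" where
  "split_step_backward_euler f g W X\<^sub>0 h 0 = X\<^sub>0"
| "split_step_backward_euler f g W X\<^sub>0 h (Suc n) = (\<lambda>\<omega>.
     let y = (THE y. y = split_step_backward_euler f g W X\<^sub>0 h n \<omega>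
                         + h (Suc n) *\<^sub>R f (grid h (Suc n)) y)
     in y + (\<Sum>r\<in>UNIV. (W r (grid h (Suc n)) \<omega> - W r (grid h n) \<omega>) *\<^sub>R g r (grid h (Suc n))))"

text \<open>A method \<open>Xh\<close> maps step sizes \<open>h\<close> and an index \<open>n\<close> to the random vector approximating the
  solution at time \<open>grid h n\<close>.\<close>

definition strongly_convergent ::
    "'w measure \<Rightarrow> real \<Rightarrow> (real \<Rightarrow> 'w \<Rightarrow> 'a::euclidean_space) \<Rightarrow>
     ((nat \<Rightarrow> real) \<Rightarrow> nat \<Rightarrow> 'w \<Rightarrow> 'a) \<Rightarrow> real \<Rightarrow> real \<Rightarrow> bool" where
  "strongly_convergent M T X Xh hbar \<gamma> \<longleftrightarrow>
     (\<exists>C. \<forall>N h. step_sizes T hbar N h \<longrightarrow>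
        (\<forall>n\<in>{0..N}. in_Lp M 2 (\<lambda>\<omega>. Xh h n \<omega> - X (grid h n) \<omega>)) \<and>
        (MAX n\<in>{0..N}. Lp_norm M 2 (\<lambda>\<omega>. Xh h n \<omega> - X (grid h n) \<omega>)) \<le> C * max_step N h powr \<gamma>)"

end

theory Submission
  imports Defs
begin

text \<open>Write \<open>J\<close> for the sum of the stochastic integrals of the \<open>g\<^sup>r\<close>. As the noise is additive, \<open>X - J\<close>
  solves a random ordinary differential equation, and Gronwall's inequality along each path bounds the
  moments of \<open>X\<close> by those of \<open>X\<^sub>0\<close> and of the Gaussian process \<open>J\<close>. Both methods are of the form
  \<open>Y\<^sub>i = \<Phi>\<^sub>i (Y\<^sub>i\<^sub>-\<^sub>1) + noise\<close>, where a step of size \<open>h\<close> from time \<open>s\<close> satisfies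
  \<open>\<bar>\<Phi>\<^sub>i x - \<Phi>\<^sub>i y\<bar>\<^sup>2 \<le> (1 + C h) \<bar>x - y\<bar>\<^sup>2\<close> and \<open>\<Phi>\<^sub>i x = x + h f s x + O(h\<^sup>2)\<close> with a polynomial weight in
  \<open>\<bar>x\<bar>\<close>. By a first-order expansion of \<open>f r (X r)\<close> at \<open>(s, X s)\<close>, the local error of the exact solution is
  \<open>b + m\<close>, where \<open>b\<close> has size \<open>h\<^sup>2\<close> in \<open>L\<^sup>2\<close> and \<open>m\<close> has size \<open>h\<^sup>3\<^sup>/\<^sup>2\<close> but is orthogonal to the past: \<open>m\<close>
  consists of the Jacobian at \<open>(s, X s)\<close> applied to \<open>\<integral> (J r - J s) dr\<close> and of the error of replacing \<open>g\<^sup>r\<close> by a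
  constant in the stochastic integral. So in each step the mean square error is multiplied by at most
  \<open>1 + C h\<close> and increased by \<open>O(h\<^sup>3)\<close>, which sums up to the square of the maximal step size. No Ito formula is needed.\<close>

text \<open>The drift grows like a power of |x|, so moments of the numerical solution are hard to
  control. The argument avoids them: stability holds for any two starting points, and consistency is
  evaluated at the exact solution only. Integrability thus rests on X alone. The noise has moments
  of every order, so X inherits the order of \<open>X\<^sub>0\<close>. The two exponents record the
  most expensive terms. In the local error this is the square of the Taylor remainder
  (1+|x|+|y|)^(q-2) |D|^2, where the drift part D of an increment has size h |x|^q; it costs (2q-4)
  + 4q = 6q-4. For the projected method it is the projection error, of size h^2 at the price of
  |x|^(4q-3); squaring costs 8q-6. Orthogonality of m to the past lifts the order from 1/2 to 1:
  otherwise its cross term with the propagated error would turn h^3 into h^2 per step. The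
  stochastic integral is given only as an L^2 limit, so moments and conditional means of J are
  recovered from sums of Gaussian increments.\<close>

section \<open>Coefficients of the equation\<close>

text \<open>A crude Young inequality with constant 1: both bases are at most \<open>max a b\<close>,
  and \<open>1 \<le> a\<close> allows the total exponent to be raised to \<open>P\<close>. It lets
  all weights of the local error be charged to moments of one order.\<close>

lemma powr_young:
  fixes a b :: real
  assumes "1 \<le> a" "0 \<le> b" "0 \<le> \<alpha>" "0 \<le> \<beta>" "\<alpha> + \<beta> \<le> P"
  shows "a powr \<alpha> * b powr \<beta> \<le> a powr P + b powr P"
proof -
  define c where "c = max a b"
  have c1: "1 \<le> c" using assms by (auto simp: c_def)
  have "a powr \<alpha> * b powr \<beta> \<le> c powr \<alpha> * c powr \<beta>"
    using assms by (intro mult_mono powr_mono2) (auto simp: c_def)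
  also have "\<dots> = c powr (\<alpha> + \<beta>)" by (simp add: powr_add)
  also have "\<dots> \<le> c powr P" using assms c1 by (intro powr_mono) auto
  also have "\<dots> \<le> a powr P + b powr P" by (auto simp: c_def max_def)
  finally show ?thesis .
qed

lemma powr_add_le:
  fixes a b :: real
  assumes "0 \<le> a" "0 \<le> b" "0 \<le> p"
  shows "(a + b) powr p \<le> 2 powr p * (a powr p + b powr p)"
proof -
  have "(a + b) powr p \<le> (2 * max a b) powr p" using assms by (intro powr_mono2) auto
  also have "\<dots> = 2 powr p * (max a b) powr p" using assms by (simp add: powr_mult)
  also have "\<dots> \<le> 2 powr p * (a powr p + b powr p)" by (intro mult_left_mono) (auto simp: max_def)
  finally show ?thesis .
qed

text \<open>The conditions on the derivatives in integrated form, so that no later estimate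
  differentiates \<open>f\<close>. \<open>A\<close> stands for the Jacobian in space, seen as a
  family of linear maps. One constant \<open>K\<close> serves all bounds, and the weights
  \<open>q\<close>, \<open>q - 1\<close>, \<open>q - 2\<close> drop by one with each derivative in
  space.\<close>

locale drift =
  fixes f :: "real \<Rightarrow> 'a::euclidean_space \<Rightarrow> 'a" and A :: "real \<Rightarrow> 'a \<Rightarrow> 'a \<Rightarrow> 'a"
    and T L q K :: real
  assumes T_pos: "0 < T" and L_pos: "0 < L" and q_ge: "2 \<le> q" and K_ge: "1 \<le> K"
    and f_continuous: "continuous_on ({0..T} \<times> UNIV) (\<lambda>(t, x). f t x)"
    and f_one_sided: "t \<in> {0..T} \<Longrightarrow> (f t x - f t y) \<bullet> (x - y) \<le> L * (norm (x - y))\<^sup>2"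
    and f_growth: "t \<in> {0..T} \<Longrightarrow> norm (f t x) \<le> K * (1 + norm x) powr q"
    and f_lipschitz: "t \<in> {0..T} \<Longrightarrow>
          norm (f t x - f t y) \<le> K * (1 + norm x + norm y) powr (q - 1) * norm (x - y)"
    and f_time_lipschitz: "s \<in> {0..T} \<Longrightarrow> t \<in> {0..T} \<Longrightarrow>
          norm (f t x - f s x) \<le> K * (1 + norm x) powr q * \<bar>t - s\<bar>"
    and A_linear: "t \<in> {0..T} \<Longrightarrow> linear (A t x)"
    and A_growth: "t \<in> {0..T} \<Longrightarrow> norm (A t x v) \<le> K * (1 + norm x) powr (q - 1) * norm v"
    and A_continuous: "t \<in> {0..T} \<Longrightarrow> continuous_on UNIV (\<lambda>x. A t x v)"
    and f_taylor: "t \<in> {0..T} \<Longrightarrow> norm (f t y - f t x - A t x (y - x))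
          \<le> K * (1 + norm x + norm y) powr (q - 2) * (norm (y - x))\<^sup>2"

lemma C1_on_interval_bounds:
  fixes g :: "real \<Rightarrow> 'a::euclidean_space"
  assumes "C1_on {0..T} g"
  obtains B where "0 < B" "\<And>t. t \<in> {0..T} \<Longrightarrow> norm (g t) \<le> B"
    "\<And>s t. s \<in> {0..T} \<Longrightarrow> t \<in> {0..T} \<Longrightarrow> norm (g t - g s) \<le> B * \<bar>t - s\<bar>"
proof -
  obtain D where D: "\<And>z. z \<in> {0..T} \<Longrightarrow> (g has_derivative blinfun_apply (D z)) (at z within {0..T})"
    and Dc: "continuous_on {0..T} D"
    using assms unfolding C1_on_def by blast
  have "bounded (D ` {0..T})"
    by (intro compact_imp_bounded compact_continuous_image Dc) auto
  then obtain B1 where B1: "\<And>t. t \<in> {0..T} \<Longrightarrow> norm (D t) \<le> B1"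
    by (meson bounded_iff image_eqI)
  have "continuous_on {0..T} g"
    by (rule has_derivative_continuous_on) (rule D)
  then have "bounded (g ` {0..T})"
    by (intro compact_imp_bounded compact_continuous_image) auto
  then obtain B2 where B2: "\<And>t. t \<in> {0..T} \<Longrightarrow> norm (g t) \<le> B2"
    by (meson bounded_iff image_eqI)
  define B where "B = 1 + \<bar>B1\<bar> + \<bar>B2\<bar>"
  show ?thesis
  proof
    show "0 < B" by (simp add: B_def add_pos_nonneg)
    show "norm (g t) \<le> B" if "t \<in> {0..T}" for t using B2[OF that] by (simp add: B_def)
    show "norm (g t - g s) \<le> B * \<bar>t - s\<bar>" if "s \<in> {0..T}" "t \<in> {0..T}" for s t
    proof -
      have "norm (g t - g s) \<le> B * norm (t - s)"
      proof (rule differentiable_bound[OF _ D _ that(2,1)])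
        show "onorm (blinfun_apply (D x)) \<le> B" if "x \<in> {0..T}" for x
          using B1[OF that] by (simp add: norm_blinfun.rep_eq[symmetric] B_def)
      qed auto
      then show ?thesis by simp
    qed
  qed
qed

lemma onorm_matrix_le:
  fixes A :: "real^'n^'m"
  shows "norm (A *v x) \<le> onorm ((*v) A) * norm x"
  by (rule onorm) (rule matrix_vector_mul_bounded_linear)

text \<open>The strip \<open>{0..T} \<times> UNIV\<close> is not compact, so compactness is used
  only on the slice \<open>x = 0\<close>, where it bounds \<open>f\<close> and its derivative. The
  hypotheses on the derivatives then carry these bounds from 0 to all \<open>x\<close>, by the mean
  value inequality on segments.\<close>

lemma drift_jacobian:
  fixes f :: "real \<Rightarrow> real^'d \<Rightarrow> real^'d"
  assumes T: "0 < T" and C1: "C1_on ({0..T} \<times> UNIV) (\<lambda>(t, x). f t x)"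
    and L: "0 < L" and q: "2 \<le> q"
    and os: "\<And>t x\<^sub>1 x\<^sub>2. t \<in> {0..T} \<Longrightarrow>
           (f t x\<^sub>1 - f t x\<^sub>2) \<bullet> (x\<^sub>1 - x\<^sub>2) \<le> L * (norm (x\<^sub>1 - x\<^sub>2))\<^sup>2"
    and ft: "\<And>t x. t \<in> {0..T} \<Longrightarrow>
           norm (vector_derivative (\<lambda>s. f s x) (at t within {0..T})) \<le> L * (1 + norm x) powr q"
    and fx: "\<And>t x\<^sub>1 x\<^sub>2. t \<in> {0..T} \<Longrightarrow>
           onorm ((*v) (jacobian (f t) (at x\<^sub>1) - jacobian (f t) (at x\<^sub>2)))
             \<le> L * (1 + norm x\<^sub>1 + norm x\<^sub>2) powr (q - 2) * norm (x\<^sub>1 - x\<^sub>2)"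
  obtains K where "drift f (\<lambda>t x v. jacobian (f t) (at x) *v v) T L q K"
proof -
  let ?S = "{0..T} \<times> (UNIV :: (real^'d) set)"
  obtain D where D: "\<And>z. z \<in> ?S \<Longrightarrow>
      ((\<lambda>(t, x). f t x) has_derivative blinfun_apply (D z)) (at z within ?S)"
    and Dc: "continuous_on ?S D"
    using C1 unfolding C1_on_def by blast
  have fc: "continuous_on ?S (\<lambda>(t, x). f t x)"
    by (rule has_derivative_continuous_on) (rule D)
  have dx: "(f t has_derivative (\<lambda>v. D (t, x) (0, v))) (at x)" if t: "t \<in> {0..T}" for t x
  proof -
    have 1: "((\<lambda>y. (t, y)) has_derivative (\<lambda>v. (0, v))) (at x)"
      by (auto intro!: derivative_eq_intros)
    have 2: "((\<lambda>(t, x). f t x) has_derivative blinfun_apply (D (t, x))) (at (t, x) within range (Pair t))"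
      by (rule has_derivative_subset[OF D]) (use t in auto)
    show ?thesis using has_derivative_in_compose[OF 1 2] by simp
  qed
  have dt: "((\<lambda>s. f s x) has_vector_derivative D (t, x) (1, 0)) (at t within {0..T})"
    if t: "t \<in> {0..T}" for t x
  proof -
    have 1: "((\<lambda>s. (s, x)) has_derivative (\<lambda>v. (v, 0))) (at t within {0..T})"
      by (auto intro!: derivative_eq_intros)
    have 2: "((\<lambda>(t, x). f t x) has_derivative blinfun_apply (D (t, x)))
        (at (t, x) within (\<lambda>s. (s, x)) ` {0..T})"
      by (rule has_derivative_subset[OF D]) (use t in auto)
    have "((\<lambda>s. f s x) has_derivative (\<lambda>v. D (t, x) (v, 0))) (at t within {0..T})"
      using has_derivative_in_compose[OF 1 2] by simp
    moreover have "(\<lambda>v. D (t, x) (v, 0)) = (\<lambda>v. v *\<^sub>R D (t, x) (1, 0))"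
      unfolding blinfun.scaleR_right[symmetric] by simp
    ultimately show ?thesis by (simp only: has_vector_derivative_def)
  qed
  have jac: "(f t has_derivative (\<lambda>v. jacobian (f t) (at x) *v v)) (at x)"
    if "t \<in> {0..T}" for t x
    using dx[OF that] jacobian_works differentiable_def by blast
  have jacD: "jacobian (f t) (at x) *v v = D (t, x) (0, v)" if "t \<in> {0..T}" for t x v
    using has_derivative_unique[OF jac[OF that] dx[OF that]] by metis
  have "bounded (D ` ({0..T} \<times> {0}))" "bounded ((\<lambda>(t, x). f t x) ` ({0..T} \<times> {0}))"
    by (auto intro!: compact_imp_bounded compact_continuous_image compact_Times
        continuous_on_subset[OF Dc] continuous_on_subset[OF fc])
  then obtain B1 B2 where B1: "\<And>t. t \<in> {0..T} \<Longrightarrow> norm (D (t, 0)) \<le> B1"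
    and B2: "\<And>t. t \<in> {0..T} \<Longrightarrow> norm (f t 0) \<le> B2"
    unfolding bounded_iff by fastforce
  define K0 where "K0 = \<bar>B1\<bar> + \<bar>B2\<bar>"
  have K0: "0 \<le> K0" by (simp add: K0_def)
  have f0: "norm (f t 0) \<le> K0" if "t \<in> {0..T}" for t using B2[OF that] by (simp add: K0_def)
  have j0: "onorm ((*v) (jacobian (f t) (at 0))) \<le> K0" if t: "t \<in> {0..T}" for t
  proof (rule onorm_bound[OF K0])
    fix v
    have "norm (jacobian (f t) (at 0) *v v) \<le> norm (D (t, 0)) * norm (0::real, v)"
      unfolding jacD[OF t] by (rule norm_blinfun)
    also have "\<dots> \<le> K0 * norm v"
      using B1[OF t] by (intro mult_mono) (auto simp: K0_def norm_Pair)
    finally show "norm (jacobian (f t) (at 0) *v v) \<le> K0 * norm v" .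
  qed
  \<comment> \<open>The Lipschitz bound of the Jacobian has weight \<open>q - 2\<close>; comparing
    with the point 0 adds the factor \<open>norm x\<close>, hence one more power.\<close>
  have jb: "onorm ((*v) (jacobian (f t) (at x))) \<le> (K0 + L) * (1 + norm x) powr (q - 1)"
    if t: "t \<in> {0..T}" for t x
  proof -
    have "(\<lambda>v. jacobian (f t) (at x) *v v) = (\<lambda>v. (jacobian (f t) (at x) - jacobian (f t) (at 0)) *v v
        + jacobian (f t) (at 0) *v v)"
      by (simp add: matrix_vector_mult_diff_rdistrib)
    then have "onorm ((*v) (jacobian (f t) (at x)))
       \<le> onorm ((*v) (jacobian (f t) (at x) - jacobian (f t) (at 0))) + onorm ((*v) (jacobian (f t) (at 0)))"
      by (simp only:) (intro onorm_triangle matrix_vector_mul_bounded_linear)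
    also have "\<dots> \<le> L * (1 + norm x) powr (q - 2) * norm x + K0"
      using fx[OF t, of x 0] j0[OF t] by simp
    also have "\<dots> \<le> L * (1 + norm x) powr (q - 2) * (1 + norm x) + K0 * (1 + norm x) powr (q - 1)"
      using L K0 q by (intro add_mono mult_left_mono mult_left_le) (auto intro!: mult_left_mono
          simp: mult_le_cancel_left1 ge_one_powr_ge_zero)
    also have "\<dots> = (K0 + L) * (1 + norm x) powr (q - 1)"
      using powr_mult_base[of "1 + norm x" "q - 2"] by (simp add: algebra_simps)
    finally show ?thesis .
  qed
  have lip: "norm (f t x - f t y) \<le> (K0 + L) * (1 + norm x + norm y) powr (q - 1) * norm (x - y)"
    if t: "t \<in> {0..T}" for t x y
  proof (rule differentiable_bound[of "closed_segment x y" "f t"])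
    show "(f t has_derivative (\<lambda>v. jacobian (f t) (at z) *v v)) (at z within closed_segment x y)" for z
      by (rule has_derivative_at_withinI) (rule jac[OF t])
    fix z assume z: "z \<in> closed_segment x y"
    have "norm z \<le> norm x + norm y"
    proof -
      from z obtain u where u: "0 \<le> u" "u \<le> 1" and zu: "z = (1 - u) *\<^sub>R x + u *\<^sub>R y"
        by (auto simp: closed_segment_def)
      have "norm z \<le> (1 - u) * norm x + u * norm y"
        unfolding zu using u norm_triangle_ineq[of "(1-u) *\<^sub>R x" "u *\<^sub>R y"] by simp
      also have "\<dots> \<le> norm x + norm y"
        using u by (intro add_mono) (auto intro: mult_left_le_one_le)
      finally show ?thesis .
    qed
    then have "(1 + norm z) powr (q - 1) \<le> (1 + norm x + norm y) powr (q - 1)"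
      using q by (intro powr_mono2) auto
    then show "onorm ((*v) (jacobian (f t) (at z))) \<le> (K0 + L) * (1 + norm x + norm y) powr (q - 1)"
      using jb[OF t, of z] K0 L by (meson add_nonneg_nonneg less_imp_le mult_left_mono order_trans)
  qed auto
  \<comment> \<open>The summand 1 ensures \<open>1 \<le> K\<close>, \<open>2 * K0 + L\<close> is the
    growth constant of \<open>f\<close>, and \<open>L * 2 powr (q - 2)\<close> belongs to the Taylor
    bound, where the weight contains \<open>x\<close> and an intermediate point, together at most
    twice \<open>1 + norm x + norm y\<close>.\<close>
  define K where "K = 1 + 2 * K0 + L + L * 2 powr (q - 2)"
  have K: "1 \<le> K" "K0 + L \<le> K" "2 * K0 + L \<le> K" "L \<le> K" "L * 2 powr (q - 2) \<le> K"
    using K0 L by (auto simp: K_def)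
  have "drift f (\<lambda>t x v. jacobian (f t) (at x) *v v) T L q K"
  proof (rule drift.intro)
    show "0 < T" "0 < L" "2 \<le> q" "1 \<le> K" by fact+
    show "continuous_on ?S (\<lambda>(t, x). f t x)" by fact
    fix t x y v assume t: "t \<in> {0..T}"
    show "(f t x - f t y) \<bullet> (x - y) \<le> L * (norm (x - y))\<^sup>2" by (rule os[OF t])
    show "norm (f t x - f t y) \<le> K * (1 + norm x + norm y) powr (q - 1) * norm (x - y)"
      using lip[OF t, of x y] K(2)
      by (meson mult_right_mono norm_ge_zero order_trans powr_ge_zero)
    have "norm (f t x) \<le> norm (f t 0) + norm (f t x - f t 0)"
      using norm_triangle_sub[of "f t x" "f t 0"] by simp
    also have "\<dots> \<le> K0 * (1 + norm x) powr q + (K0 + L) * (1 + norm x) powr (q - 1) * (1 + norm x)"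
    proof (rule add_mono)
      show "norm (f t 0) \<le> K0 * (1 + norm x) powr q"
        using f0[OF t] K0 q mult_left_mono[OF ge_one_powr_ge_zero[of "1 + norm x" q] K0] by simp
      have "norm (f t x - f t 0) \<le> (K0 + L) * (1 + norm x) powr (q - 1) * norm x"
        using lip[OF t, of x 0] by simp
      also have "\<dots> \<le> (K0 + L) * (1 + norm x) powr (q - 1) * (1 + norm x)"
        using K0 L by (intro mult_left_mono) auto
      finally show "norm (f t x - f t 0) \<le> (K0 + L) * (1 + norm x) powr (q - 1) * (1 + norm x)" .
    qed
    also have "\<dots> = (2 * K0 + L) * (1 + norm x) powr q"
      using powr_mult_base[of "1 + norm x" "q - 1"] by (simp add: algebra_simps)
    also have "\<dots> \<le> K * (1 + norm x) powr q" using K by (intro mult_right_mono) auto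
    finally show "norm (f t x) \<le> K * (1 + norm x) powr q" .
    show "linear (\<lambda>v. jacobian (f t) (at x) *v v)" by simp
    have "norm (jacobian (f t) (at x) *v v) \<le> onorm ((*v) (jacobian (f t) (at x))) * norm v"
      by (rule onorm_matrix_le)
    also have "\<dots> \<le> K * (1 + norm x) powr (q - 1) * norm v"
      using jb[OF t, of x] K(2) by (meson mult_right_mono norm_ge_zero order_trans powr_ge_zero)
    finally show "norm (jacobian (f t) (at x) *v v) \<le> K * (1 + norm x) powr (q - 1) * norm v" .
    have "continuous_on UNIV (\<lambda>x. D (t, x))"
      by (rule continuous_on_compose2[OF Dc]) (use t in \<open>auto intro!: continuous_intros\<close>)
    then have "continuous_on UNIV (\<lambda>x. D (t, x) (0, v))"
      by (intro continuous_intros) auto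
    then show "continuous_on UNIV (\<lambda>x. jacobian (f t) (at x) *v v)" by (simp add: jacD[OF t])
    have "norm (f t y - f t x - jacobian (f t) (at x) *v (y - x))
        \<le> norm (y - x) * (L * (2 * (1 + norm x + norm y)) powr (q - 2) * norm (y - x))"
    proof (rule differentiable_bound_linearization[where S = "closed_segment x y"
          and f' = "\<lambda>z v. jacobian (f t) (at z) *v v"])
      show "x + u *\<^sub>R (y - x) \<in> closed_segment x y" if "u \<in> {0..1}" for u
        using that by (auto simp: closed_segment_def algebra_simps intro!: exI[of _ u])
      show "(f t has_derivative (\<lambda>v. jacobian (f t) (at z) *v v)) (at z within closed_segment x y)" for z
        by (rule has_derivative_at_withinI) (rule jac[OF t])
      show "x \<in> closed_segment x y" by simp
      fix z assume z: "z \<in> closed_segment x y"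
      then obtain u where u: "0 \<le> u" "u \<le> 1" and zu: "z = x + u *\<^sub>R (y - x)"
        by (auto simp: closed_segment_def algebra_simps)
      have zx: "norm (z - x) \<le> norm (y - x)" using u by (simp add: zu mult_left_le_one_le)
      have "norm z \<le> 1 + 2 * norm y + norm x"
      proof -
        have "z = (1 - u) *\<^sub>R x + u *\<^sub>R y" by (simp add: zu algebra_simps)
        then have "norm z \<le> (1 - u) * norm x + u * norm y"
          using u norm_triangle_ineq[of "(1-u) *\<^sub>R x" "u *\<^sub>R y"] by simp
        also have "\<dots> \<le> norm x + norm y"
          using u by (intro add_mono) (auto intro: mult_left_le_one_le)
        finally show ?thesis using norm_ge_zero[of y] by linarith
      qed
      then have p: "(1 + norm z + norm x) powr (q - 2) \<le> (2 * (1 + norm x + norm y)) powr (q - 2)"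
        using q by (intro powr_mono2) auto
      have "(\<lambda>v. jacobian (f t) (at z) *v v) - (\<lambda>v. jacobian (f t) (at x) *v v)
          = (*v) (jacobian (f t) (at z) - jacobian (f t) (at x))"
        by (auto simp: fun_eq_iff matrix_vector_mult_diff_rdistrib)
      then have "onorm ((\<lambda>v. jacobian (f t) (at z) *v v) - (\<lambda>v. jacobian (f t) (at x) *v v))
          \<le> L * (1 + norm z + norm x) powr (q - 2) * norm (z - x)"
        using fx[OF t, of z x] by simp
      also have "\<dots> \<le> L * (2 * (1 + norm x + norm y)) powr (q - 2) * norm (y - x)"
        using L p zx by (intro mult_mono) auto
      finally show "onorm ((\<lambda>v. jacobian (f t) (at z) *v v) - (\<lambda>v. jacobian (f t) (at x) *v v))
          \<le> L * (2 * (1 + norm x + norm y)) powr (q - 2) * norm (y - x)" .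
    qed
    also have "\<dots> = L * 2 powr (q - 2) * (1 + norm x + norm y) powr (q - 2) * (norm (y - x))\<^sup>2"
      by (subst powr_mult) (auto simp: power2_eq_square)
    also have "\<dots> \<le> K * (1 + norm x + norm y) powr (q - 2) * (norm (y - x))\<^sup>2"
      using K by (intro mult_right_mono) auto
    finally show "norm (f t y - f t x - jacobian (f t) (at x) *v (y - x))
        \<le> K * (1 + norm x + norm y) powr (q - 2) * (norm (y - x))\<^sup>2" .
    fix s assume s: "s \<in> {0..T}"
    have "norm (f t x - f s x) \<le> L * (1 + norm x) powr q * norm (t - s)"
    proof (rule differentiable_bound[of "{0..T}" "\<lambda>s. f s x"])
      show "((\<lambda>s. f s x) has_derivative (\<lambda>v. v *\<^sub>R D (r, x) (1, 0))) (at r within {0..T})"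
        if "r \<in> {0..T}" for r
        using dt[OF that] by (simp add: has_vector_derivative_def)
      fix r assume r: "r \<in> {0..T}"
      \<comment> \<open>As \<open>0 < T\<close>, derivatives within the interval are unique, so the
        hypothesis on \<open>vector_derivative\<close> speaks about this partial derivative, also at
        the end points.\<close>
      have "norm (D (r, x) (1, 0)) \<le> L * (1 + norm x) powr q"
        using ft[OF r, of x] vector_derivative_within_closed_interval[OF T r dt[OF r, of x]] by simp
      then show "onorm (\<lambda>v. v *\<^sub>R D (r, x) (1, 0)) \<le> L * (1 + norm x) powr q"
        by (intro onorm_le order_trans[OF eq_refl[OF norm_scaleR]])
          (simp add: mult.commute mult_left_mono)
    qed (use s t in auto)
    also have "\<dots> \<le> K * (1 + norm x) powr q * \<bar>t - s\<bar>"
      using K by (auto intro!: mult_right_mono)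
    finally show "norm (f t x - f s x) \<le> K * (1 + norm x) powr q * \<bar>t - s\<bar>" .
  qed
  then show ?thesis by (rule that)
qed

section \<open>Brownian increments\<close>

lemma partition_mono:
  fixes \<rho> :: "nat \<Rightarrow> real"
  assumes "\<And>j. j < k \<Longrightarrow> \<rho> j \<le> \<rho> (Suc j)" "i \<le> j" "j \<le> k"
  shows "\<rho> i \<le> \<rho> j"
  using assms(2,3)
proof (induction j rule: dec_induct)
  case (step n)
  then show ?case using assms(1)[of n] by simp
qed simp

text \<open>Converts the sums produced by the isometry into time integrals: \<open>\<phi> j\<close>
  is the variance rate on one cell and \<open>\<psi>\<close> a function of time dominating it
  there.\<close>

lemma sum_le_nn_integral_partition:
  fixes \<rho> \<phi> :: "nat \<Rightarrow> real"
  assumes mono: "\<And>j. j < k \<Longrightarrow> \<rho> j \<le> \<rho> (Suc j)" and [measurable]: "\<psi> \<in> borel_measurable borel"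
    and nn: "\<And>j. j < k \<Longrightarrow> 0 \<le> \<phi> j"
    and le: "\<And>j r. j < k \<Longrightarrow> r \<in> {\<rho> j<..\<rho> (Suc j)} \<Longrightarrow> ennreal (\<phi> j) \<le> \<psi> r"
  shows "ennreal (\<Sum>j<k. \<phi> j * (\<rho> (Suc j) - \<rho> j)) \<le> (\<integral>\<^sup>+r\<in>{\<rho> 0<..\<rho> k}. \<psi> r \<partial>lborel)"
  using mono nn le
proof (induction k)
  case (Suc k)
  have le: "\<rho> 0 \<le> \<rho> k" by (rule partition_mono[of k]) (use Suc.prems in auto)
  have le': "\<rho> k \<le> \<rho> (Suc k)" using Suc.prems by simp
  have "ennreal (\<Sum>j<Suc k. \<phi> j * (\<rho> (Suc j) - \<rho> j))
      = ennreal (\<Sum>j<k. \<phi> j * (\<rho> (Suc j) - \<rho> j)) + ennreal (\<phi> k * (\<rho> (Suc k) - \<rho> k))"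
    unfolding sum.lessThan_Suc
    by (rule ennreal_plus) (use Suc.prems le' in \<open>auto intro!: sum_nonneg mult_nonneg_nonneg\<close>)
  also have "\<dots> \<le> (\<integral>\<^sup>+r\<in>{\<rho> 0<..\<rho> k}. \<psi> r \<partial>lborel) + (\<integral>\<^sup>+r\<in>{\<rho> k<..\<rho> (Suc k)}. \<psi> r \<partial>lborel)"
  proof (rule add_mono)
    show "ennreal (\<Sum>j<k. \<phi> j * (\<rho> (Suc j) - \<rho> j)) \<le> (\<integral>\<^sup>+r\<in>{\<rho> 0<..\<rho> k}. \<psi> r \<partial>lborel)"
      by (rule Suc.IH) (use Suc.prems in auto)
    have "ennreal (\<phi> k * (\<rho> (Suc k) - \<rho> k)) = (\<integral>\<^sup>+r\<in>{\<rho> k<..\<rho> (Suc k)}. ennreal (\<phi> k) \<partial>lborel)"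
      using Suc.prems le' by (simp add: nn_integral_cmult_indicator ennreal_mult)
    also have "\<dots> \<le> (\<integral>\<^sup>+r\<in>{\<rho> k<..\<rho> (Suc k)}. \<psi> r \<partial>lborel)"
      by (rule nn_integral_mono) (use Suc.prems(3)[of k] in \<open>auto simp: indicator_def\<close>)
    finally show "ennreal (\<phi> k * (\<rho> (Suc k) - \<rho> k)) \<le> (\<integral>\<^sup>+r\<in>{\<rho> k<..\<rho> (Suc k)}. \<psi> r \<partial>lborel)" .
  qed
  also have "\<dots> = (\<integral>\<^sup>+r. \<psi> r * indicator {\<rho> 0<..\<rho> k} r + \<psi> r * indicator {\<rho> k<..\<rho> (Suc k)} r \<partial>lborel)"
    by (rule nn_integral_add[symmetric]) auto
  also have "\<dots> = (\<integral>\<^sup>+r\<in>{\<rho> 0<..\<rho> (Suc k)}. \<psi> r \<partial>lborel)"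
    by (rule nn_integral_cong) (use le le' in \<open>auto simp: indicator_def\<close>)
  finally show ?case .
qed simp

text \<open>From \<open>y / n \<le> exp (y / n)\<close> follows
  \<open>y ^ n \<le> n ^ n * exp y\<close>. Bounds on exponential moments thereby give absolute
  moments of every real order.\<close>

lemma abs_powr_le_exp:
  fixes r :: real
  assumes "0 \<le> r"
  obtains C where "0 < C" "\<And>x. \<bar>x\<bar> powr r \<le> C * (exp x + exp (- x))"
proof -
  obtain n0 where "r \<le> real n0" using real_arch_simple by blast
  then obtain n :: nat where n: "1 \<le> n" "r \<le> n" using that[of "max 1 n0"] by simp
  have *: "y powr r \<le> real n ^ n * exp y" if y: "0 \<le> y" for y :: real
  proof (cases "1 \<le> y")
    case True
    have "y powr r \<le> y powr n" using True n by (intro powr_mono) auto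
    also have "\<dots> = y ^ n" using True by (simp add: powr_realpow)
    also have "\<dots> = real n ^ n * (y / n) ^ n" using n by (simp add: power_divide)
    also have "y / n \<le> exp (y / n)" using exp_ge_add_one_self[of "y / n"] by linarith
    then have "real n ^ n * (y / n) ^ n \<le> real n ^ n * exp (y / n) ^ n"
      using y by (intro mult_left_mono power_mono) auto
    also have "\<dots> = real n ^ n * exp y" using n by (simp add: exp_of_nat_mult[symmetric])
    finally show ?thesis .
  next
    case False
    have "y powr r \<le> 1" using False y assms powr_le1 by simp
    also have "1 \<le> real n ^ n * exp y"
      using mult_mono[of 1 "real n ^ n" 1 "exp y"] n y by simp
    finally show ?thesis .
  qed
  show ?thesis
  proof (rule that)
    show "0 < real n ^ n" using n by simp
    fix x :: real
    have "\<bar>x\<bar> powr r \<le> real n ^ n * exp \<bar>x\<bar>" using *[of "\<bar>x\<bar>"] by simp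
    also have "\<dots> \<le> real n ^ n * (exp x + exp (- x))"
      by (intro mult_left_mono) (auto simp: abs_if)
    finally show "\<bar>x\<bar> powr r \<le> real n ^ n * (exp x + exp (- x))" .
  qed
qed

lemma norm_powr_le_sum_Basis:
  fixes x :: "'a::euclidean_space"
  assumes "0 \<le> r"
  shows "norm x powr r \<le> real DIM('a) powr r * (\<Sum>e\<in>Basis. \<bar>x \<bullet> e\<bar> powr r)"
proof -
  define m where "m = Max ((\<lambda>e. \<bar>x \<bullet> e\<bar>) ` Basis)"
  have "m \<in> (\<lambda>e. \<bar>x \<bullet> e\<bar>) ` Basis" unfolding m_def by (rule Max_in) auto
  then obtain e0 where e0: "e0 \<in> Basis" "m = \<bar>x \<bullet> e0\<bar>" by auto
  have m: "\<bar>x \<bullet> e\<bar> \<le> m" if "e \<in> Basis" for e using that by (simp add: m_def)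
  have "norm x \<le> (\<Sum>e\<in>Basis. \<bar>x \<bullet> e\<bar>)" by (rule norm_le_l1)
  also have "\<dots> \<le> (\<Sum>e\<in>(Basis :: 'a set). m)" by (rule sum_mono) (rule m)
  finally have "norm x \<le> real DIM('a) * m" by simp
  then have "norm x powr r \<le> (real DIM('a) * m) powr r" using assms by (intro powr_mono2) auto
  also have "\<dots> = real DIM('a) powr r * \<bar>x \<bullet> e0\<bar> powr r" using e0 by (simp add: powr_mult)
  also have "\<dots> \<le> real DIM('a) powr r * (\<Sum>e\<in>Basis. \<bar>x \<bullet> e\<bar> powr r)"
    using e0 by (intro mult_left_mono member_le_sum) auto
  finally show ?thesis .
qed

lemma nn_integral_tendsto_0_AE_subseq:
  fixes u :: "nat \<Rightarrow> 'w \<Rightarrow> real"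
  assumes [measurable]: "\<And>n. u n \<in> borel_measurable M" and nn: "\<And>n x. 0 \<le> u n x"
    and lim: "(\<lambda>n. \<integral>\<^sup>+x. ennreal (u n x) \<partial>M) \<longlonglongrightarrow> 0"
  obtains r :: "nat \<Rightarrow> nat" where "strict_mono r" "AE x in M. (\<lambda>n. u (r n) x) \<longlonglongrightarrow> 0"
proof -
  have "\<forall>\<^sub>F n in sequentially. (\<integral>\<^sup>+x. ennreal (u n x) \<partial>M) < 1"
    using lim by (rule order_tendstoD) simp
  then obtain N where N: "\<And>n. n \<ge> N \<Longrightarrow> (\<integral>\<^sup>+x. ennreal (u n x) \<partial>M) < 1"
    by (auto simp: eventually_sequentially)
  \<comment> \<open>The first integrals may be infinite, so the sequence is shifted before
    integrability is claimed.\<close>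
  define v where "v n = u (n + N)" for n
  have [measurable]: "v n \<in> borel_measurable M" for n by (simp add: v_def)
  have fin: "(\<integral>\<^sup>+x. ennreal (v n x) \<partial>M) < 1" for n using N[of "n + N"] by (simp add: v_def)
  have int: "integrable M (v n)" for n
  proof (rule integrableI_bounded)
    have "(\<integral>\<^sup>+x. ennreal (norm (v n x)) \<partial>M) < 1" using fin[of n] nn by (simp add: v_def)
    also have "(1::ennreal) < \<infinity>" by simp
    finally show "(\<integral>\<^sup>+x. ennreal (norm (v n x)) \<partial>M) < \<infinity>" .
  qed simp
  have "(\<lambda>n. \<integral>\<^sup>+x. ennreal (v n x) \<partial>M) \<longlonglongrightarrow> 0"
    unfolding v_def by (rule LIMSEQ_ignore_initial_segment[OF lim])
  then have "(\<lambda>n. ennreal (\<integral>x. norm (v n x) \<partial>M)) \<longlonglongrightarrow> ennreal 0"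
    using nn_integral_eq_integral[OF int] nn by (simp add: v_def)
  then have "(\<lambda>n. \<integral>x. norm (v n x) \<partial>M) \<longlonglongrightarrow> 0"
    by (subst (asm) tendsto_ennreal_iff) auto
  from tendsto_L1_AE_subseq[OF int this] obtain r where
    r: "strict_mono r" "AE x in M. (\<lambda>n. v (r n) x) \<longlonglongrightarrow> 0" by blast
  show ?thesis
  proof (rule that)
    show "strict_mono (\<lambda>n. r n + N)" using r(1) by (simp add: strict_mono_def)
    show "AE x in M. (\<lambda>n. u (r n + N) x) \<longlonglongrightarrow> 0" using r(2) by (simp add: v_def)
  qed
qed

text \<open>Completing the square: the density times \<open>exp (a * x)\<close> is a multiple of the
  normal density with mean \<open>a * \<sigma>\<^sup>2\<close>.\<close>

lemma normal_mgf:
  assumes \<sigma>: "0 < \<sigma>"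
  shows "(\<integral>\<^sup>+x. ennreal (normal_density 0 \<sigma> x) * ennreal (exp (a * x)) \<partial>lborel) = ennreal (exp (a\<^sup>2 * \<sigma>\<^sup>2 / 2))"
proof -
  have eq: "normal_density 0 \<sigma> x * exp (a * x) = exp (a\<^sup>2 * \<sigma>\<^sup>2 / 2) * normal_density (a * \<sigma>\<^sup>2) \<sigma> x" for x
  proof -
    have "- x\<^sup>2 / (2 * \<sigma>\<^sup>2) + a * x = a\<^sup>2 * \<sigma>\<^sup>2 / 2 + - (x - a * \<sigma>\<^sup>2)\<^sup>2 / (2 * \<sigma>\<^sup>2)"
      using \<sigma> by (simp add: field_simps power2_eq_square)
    then have "exp (- x\<^sup>2 / (2 * \<sigma>\<^sup>2)) * exp (a * x)
        = exp (a\<^sup>2 * \<sigma>\<^sup>2 / 2) * exp (- (x - a * \<sigma>\<^sup>2)\<^sup>2 / (2 * \<sigma>\<^sup>2))"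
      unfolding exp_add[symmetric] by simp
    then show ?thesis by (simp add: normal_density_def)
  qed
  have "(\<integral>\<^sup>+x. ennreal (normal_density 0 \<sigma> x) * ennreal (exp (a * x)) \<partial>lborel)
      = (\<integral>\<^sup>+x. ennreal (exp (a\<^sup>2 * \<sigma>\<^sup>2 / 2)) * ennreal (normal_density (a * \<sigma>\<^sup>2) \<sigma> x) \<partial>lborel)"
    by (rule nn_integral_cong) (simp add: ennreal_mult[symmetric] eq)
  also have "\<dots> = ennreal (exp (a\<^sup>2 * \<sigma>\<^sup>2 / 2)) * (\<integral>\<^sup>+x. ennreal (normal_density (a * \<sigma>\<^sup>2) \<sigma> x) \<partial>lborel)"
    by (rule nn_integral_cmult) simp
  also have "(\<integral>\<^sup>+x. ennreal (normal_density (a * \<sigma>\<^sup>2) \<sigma> x) \<partial>lborel) = 1"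
    using nn_integral_eq_integral[OF integrable_normal_density[OF \<sigma>]] integral_normal_density[OF \<sigma>] by simp
  finally show ?thesis by simp
qed

context usual_filtered_prob_space
begin

lemma space_F: "t \<in> {0..T} \<Longrightarrow> space (F t) = space M"
  using subalgebra_F unfolding subalgebra_def by blast

lemma measurable_F_M: "t \<in> {0..T} \<Longrightarrow> U \<in> measurable (F t) N \<Longrightarrow> U \<in> measurable M N"
  using subalgebra_F measurable_from_subalg by blast

lemma measurable_F_mono:
  "0 \<le> s \<Longrightarrow> s \<le> t \<Longrightarrow> t \<le> T \<Longrightarrow> U \<in> measurable (F s) N \<Longrightarrow> U \<in> measurable (F t) N"
  using F_mono[of s t] space_F[of s] space_F[of t] by (auto simp: measurable_def)

lemma sets_F_M: "t \<in> {0..T} \<Longrightarrow> A \<in> sets (F t) \<Longrightarrow> A \<in> sets M"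
  using subalgebra_F unfolding subalgebra_def by blast

lemma bm_adapted: "brownian_motion M F T W \<Longrightarrow> t \<in> {0..T} \<Longrightarrow> W t \<in> borel_measurable (F t)"
  by (simp add: brownian_motion_def adapted_def)

lemma bm_measurable: "brownian_motion M F T W \<Longrightarrow> t \<in> {0..T} \<Longrightarrow> W t \<in> borel_measurable M"
  using bm_adapted measurable_F_M by blast

lemma bm_indep_var:
  assumes bm: "brownian_motion M F T W" and st: "0 \<le> s" "s < t" "t \<le> T"
    and U: "U \<in> borel_measurable (F s)"
  shows "indep_var borel U borel (\<lambda>w. W t w - W s w)"
proof -
  have sT: "s \<in> {0..T}" "t \<in> {0..T}" using st by auto
  have ind: "indep_set (sets (F s)) (sets (vimage_algebra (space M) (\<lambda>w. W t w - W s w) borel))"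
    using bm st by (auto simp: brownian_motion_def)
  have 1: "sigma_sets (space M) {U -` A \<inter> space M |A. A \<in> sets borel} \<subseteq> sets (F s)"
    using measurable_sets[OF U] space_F[OF sT(1)]
    by (subst space_F[OF sT(1), symmetric], intro sets.sigma_sets_subset) auto
  have 2: "sigma_sets (space M) {(\<lambda>w. W t w - W s w) -` A \<inter> space M |A. A \<in> sets borel}
      \<subseteq> sets (vimage_algebra (space M) (\<lambda>w. W t w - W s w) borel)"
    by (simp add: sets_vimage_algebra)
  have [measurable]: "W t \<in> borel_measurable M" "W s \<in> borel_measurable M" "U \<in> borel_measurable M"
    using bm_measurable[OF bm] measurable_F_M[OF sT(1) U] sT by auto
  show ?thesis
    unfolding indep_var_eq
  proof (intro conjI)
    show "indep_set (sigma_sets (space M) {U -` A \<inter> space M |A. A \<in> sets borel})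
      (sigma_sets (space M) {(\<lambda>w. W t w - W s w) -` A \<inter> space M |A. A \<in> sets borel})"
      using ind unfolding indep_set_def
      by (rule indep_sets_mono_sets) (use 1 2 in \<open>auto split: bool.splits\<close>)
  qed auto
qed

lemma bm_increment_moments:
  assumes bm: "brownian_motion M F T W" and st: "0 \<le> s" "s < t" "t \<le> T"
  shows "integrable M (\<lambda>w. W t w - W s w)" "expectation (\<lambda>w. W t w - W s w) = 0"
    and "integrable M (\<lambda>w. (W t w - W s w)\<^sup>2)" "expectation (\<lambda>w. (W t w - W s w)\<^sup>2) = t - s"
    and "integrable M (\<lambda>w. exp (a * (W t w - W s w)))"
      "expectation (\<lambda>w. exp (a * (W t w - W s w))) = exp (a\<^sup>2 * (t - s) / 2)"
proof -
  have D: "distributed M lborel (\<lambda>w. W t w - W s w) (normal_density 0 (sqrt (t - s)))"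
    using bm st by (auto simp: brownian_motion_def)
  have \<sigma>: "0 < sqrt (t - s)" using st by simp
  have \<sigma>2: "(sqrt (t - s))\<^sup>2 = t - s" using st by simp
  have [measurable]: "W t \<in> borel_measurable M" "W s \<in> borel_measurable M"
    using bm_measurable[OF bm] st by auto
  show "integrable M (\<lambda>w. W t w - W s w)"
    using integrable_normal_moment_nz_1[OF \<sigma>, of 0] distributed_integrable[OF D, of "\<lambda>x. x"] by simp
  show e0: "expectation (\<lambda>w. W t w - W s w) = 0"
    by (rule normal_distributed_expectation[OF \<sigma> D])
  show "integrable M (\<lambda>w. (W t w - W s w)\<^sup>2)"
    using integrable_normal_moment[OF \<sigma>, of 0 2] distributed_integrable[OF D, of "\<lambda>x. x\<^sup>2"] by simp
  show "expectation (\<lambda>w. (W t w - W s w)\<^sup>2) = t - s"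
    using normal_distributed_variance[OF \<sigma> D] \<sigma>2 unfolding e0 by simp
  have n: "(\<integral>\<^sup>+w. ennreal (exp (a * (W t w - W s w))) \<partial>M) = ennreal (exp (a\<^sup>2 * (t - s) / 2))"
    using distributed_nn_integral[OF D, of "\<lambda>x. ennreal (exp (a * x))"] normal_mgf[OF \<sigma>, of a] \<sigma>2 by simp
  show int: "integrable M (\<lambda>w. exp (a * (W t w - W s w)))"
    by (rule integrableI_bounded) (auto simp: n)
  show "expectation (\<lambda>w. exp (a * (W t w - W s w))) = exp (a\<^sup>2 * (t - s) / 2)"
    using n nn_integral_eq_integral[OF int] by simp
qed

lemma bm_increment_mult:
  fixes U :: "'w \<Rightarrow> real"
  assumes bm: "brownian_motion M F T W" and st: "0 \<le> s" "s \<le> t" "t \<le> T"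
    and U: "U \<in> borel_measurable (F s)" "integrable M U"
  shows "integrable M (\<lambda>w. U w * (W t w - W s w))" "expectation (\<lambda>w. U w * (W t w - W s w)) = 0"
    and "integrable M (\<lambda>w. U w * (W t w - W s w)\<^sup>2)"
      "expectation (\<lambda>w. U w * (W t w - W s w)\<^sup>2) = expectation U * (t - s)"
    and "integrable M (\<lambda>w. U w * exp (a * (W t w - W s w)))"
      "expectation (\<lambda>w. U w * exp (a * (W t w - W s w))) = expectation U * exp (a\<^sup>2 * (t - s) / 2)"
proof -
  \<comment> \<open>The definition of Brownian motion speaks about \<open>s < t\<close> only; for
    \<open>s = t\<close> the increment vanishes identically.\<close>
  consider "s = t" | "s < t" using st by linarith
  then have "integrable M (\<lambda>w. U w * (W t w - W s w)) \<and> expectation (\<lambda>w. U w * (W t w - W s w)) = 0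
    \<and> integrable M (\<lambda>w. U w * (W t w - W s w)\<^sup>2)
    \<and> expectation (\<lambda>w. U w * (W t w - W s w)\<^sup>2) = expectation U * (t - s)
    \<and> integrable M (\<lambda>w. U w * exp (a * (W t w - W s w)))
    \<and> expectation (\<lambda>w. U w * exp (a * (W t w - W s w))) = expectation U * exp (a\<^sup>2 * (t - s) / 2)"
  proof cases
    case 1
    then show ?thesis using U by simp
  next
    case 2
    note m = bm_increment_moments[OF bm st(1) 2 st(3)]
    note i = bm_indep_var[OF bm st(1) 2 st(3) U(1)]
    have i2: "indep_var borel U borel (\<lambda>w. (W t w - W s w)\<^sup>2)"
      using indep_var_compose[OF i, of "\<lambda>x. x" borel "\<lambda>x. x\<^sup>2" borel] by (simp add: comp_def)
    have i3: "indep_var borel U borel (\<lambda>w. exp (a * (W t w - W s w)))"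
      using indep_var_compose[OF i, of "\<lambda>x. x" borel "\<lambda>x. exp (a * x)" borel] by (simp add: comp_def)
    show ?thesis
      using indep_var_integrable[OF i U(2) m(1)] indep_var_lebesgue_integral[OF i U(2) m(1)]
        indep_var_integrable[OF i2 U(2) m(3)] indep_var_lebesgue_integral[OF i2 U(2) m(3)]
        indep_var_integrable[OF i3 U(2) m(5)] indep_var_lebesgue_integral[OF i3 U(2) m(5)]
      by (simp add: m)
  qed
  then show "integrable M (\<lambda>w. U w * (W t w - W s w))" "expectation (\<lambda>w. U w * (W t w - W s w)) = 0"
    and "integrable M (\<lambda>w. U w * (W t w - W s w)\<^sup>2)"
      "expectation (\<lambda>w. U w * (W t w - W s w)\<^sup>2) = expectation U * (t - s)"
    and "integrable M (\<lambda>w. U w * exp (a * (W t w - W s w)))"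
      "expectation (\<lambda>w. U w * exp (a * (W t w - W s w))) = expectation U * exp (a\<^sup>2 * (t - s) / 2)"
    by blast+
qed

text \<open>Measurability belongs to the induction claim: the last increment is split off because it
  is independent of everything measurable at its left end point. The value is the moment generating
  function at 1 of a centred Gaussian whose variance is the sum.\<close>

lemma bm_sum_exp:
  fixes a :: "nat \<Rightarrow> real"
  assumes bm: "brownian_motion M F T W"
    and \<rho>: "0 \<le> \<rho> 0" "\<And>j. j < k \<Longrightarrow> \<rho> j \<le> \<rho> (Suc j)" "\<rho> k \<le> T"
  shows "integrable M (\<lambda>w. exp (\<Sum>j<k. a j * (W (\<rho> (Suc j)) w - W (\<rho> j) w))) \<and>
    expectation (\<lambda>w. exp (\<Sum>j<k. a j * (W (\<rho> (Suc j)) w - W (\<rho> j) w)))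
      = exp ((\<Sum>j<k. (a j)\<^sup>2 * (\<rho> (Suc j) - \<rho> j)) / 2)
    \<and> (\<lambda>w. exp (\<Sum>j<k. a j * (W (\<rho> (Suc j)) w - W (\<rho> j) w))) \<in> borel_measurable (F (\<rho> k))"
  using \<rho>(2,3)
proof (induction k)
  case 0
  then show ?case by (simp add: prob_space)
next
  case (Suc k)
  have "0 \<le> \<rho> k"
    using partition_mono[of k \<rho> 0 k] Suc.prems \<rho>(1) by fastforce
  moreover have "\<rho> k \<le> \<rho> (Suc k)" using Suc.prems by simp
  ultimately have st: "0 \<le> \<rho> k" "\<rho> k \<le> \<rho> (Suc k)" "\<rho> (Suc k) \<le> T" using Suc.prems by auto
  have IH: "integrable M (\<lambda>w. exp (\<Sum>j<k. a j * (W (\<rho> (Suc j)) w - W (\<rho> j) w)))"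
    "expectation (\<lambda>w. exp (\<Sum>j<k. a j * (W (\<rho> (Suc j)) w - W (\<rho> j) w)))
      = exp ((\<Sum>j<k. (a j)\<^sup>2 * (\<rho> (Suc j) - \<rho> j)) / 2)"
    "(\<lambda>w. exp (\<Sum>j<k. a j * (W (\<rho> (Suc j)) w - W (\<rho> j) w))) \<in> borel_measurable (F (\<rho> k))"
    using Suc.IH Suc.prems st by auto
  have [measurable]: "W (\<rho> k) \<in> borel_measurable (F (\<rho> (Suc k)))"
      "W (\<rho> (Suc k)) \<in> borel_measurable (F (\<rho> (Suc k)))"
    using measurable_F_mono[OF st bm_adapted[OF bm]] bm_adapted[OF bm] st by auto
  have [measurable]: "(\<lambda>w. exp (\<Sum>j<k. a j * (W (\<rho> (Suc j)) w - W (\<rho> j) w))) \<in> borel_measurable (F (\<rho> (Suc k)))"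
    by (rule measurable_F_mono[OF st IH(3)])
  show ?case
    using bm_increment_mult(5,6)[OF bm st IH(3,1), of "a k"] IH(2)
    by (simp add: exp_add[symmetric] add_divide_distrib distrib_right) 
      (simp add: exp_add)
qed

text \<open>The Ito isometry for simple integrands, by splitting off the last increment. In the
  expanded square the mixed term contains the increment linearly and has mean zero, while the
  quadratic term contributes the length of the cell.\<close>

lemma bm_isometry:
  fixes \<zeta> :: "nat \<Rightarrow> 'w \<Rightarrow> 'a::euclidean_space"
  assumes bm: "brownian_motion M F T W"
    and \<rho>: "0 \<le> \<rho> 0" "\<And>j. j < k \<Longrightarrow> \<rho> j \<le> \<rho> (Suc j)" "\<rho> k \<le> T"
    and \<zeta>: "\<And>j. j < k \<Longrightarrow> \<zeta> j \<in> borel_measurable (F (\<rho> j))" "\<And>j. j < k \<Longrightarrow> bounded (\<zeta> j ` space M)"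
  shows "integrable M (\<lambda>w. (norm (\<Sum>j<k. (W (\<rho> (Suc j)) w - W (\<rho> j) w) *\<^sub>R \<zeta> j w))\<^sup>2) \<and>
    expectation (\<lambda>w. (norm (\<Sum>j<k. (W (\<rho> (Suc j)) w - W (\<rho> j) w) *\<^sub>R \<zeta> j w))\<^sup>2)
      = (\<Sum>j<k. expectation (\<lambda>w. (norm (\<zeta> j w))\<^sup>2) * (\<rho> (Suc j) - \<rho> j))
    \<and> (\<lambda>w. \<Sum>j<k. (W (\<rho> (Suc j)) w - W (\<rho> j) w) *\<^sub>R \<zeta> j w) \<in> borel_measurable (F (\<rho> k))"
  using \<rho>(2,3) \<zeta>
proof (induction k)
  case 0
  then show ?case by simp
next
  case (Suc k)
  have "0 \<le> \<rho> k"
    using partition_mono[of k \<rho> 0 k] Suc.prems \<rho>(1) by fastforce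
  moreover have "\<rho> k \<le> \<rho> (Suc k)" using Suc.prems by simp
  ultimately have st: "0 \<le> \<rho> k" "\<rho> k \<le> \<rho> (Suc k)" "\<rho> (Suc k) \<le> T" using Suc.prems by auto
  define S where "S w = (\<Sum>j<k. (W (\<rho> (Suc j)) w - W (\<rho> j) w) *\<^sub>R \<zeta> j w)" for w
  have IH: "integrable M (\<lambda>w. (norm (S w))\<^sup>2)"
    "expectation (\<lambda>w. (norm (S w))\<^sup>2) = (\<Sum>j<k. expectation (\<lambda>w. (norm (\<zeta> j w))\<^sup>2) * (\<rho> (Suc j) - \<rho> j))"
    and SF: "S \<in> borel_measurable (F (\<rho> k))"
    unfolding S_def using Suc.IH Suc.prems st by auto
  have kT: "\<rho> k \<in> {0..T}" using st by auto
  have [measurable]: "W (\<rho> k) \<in> borel_measurable (F (\<rho> (Suc k)))"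
      "W (\<rho> (Suc k)) \<in> borel_measurable (F (\<rho> (Suc k)))"
    using measurable_F_mono[OF st bm_adapted[OF bm]] bm_adapted[OF bm] st by auto
  have zF: "\<zeta> k \<in> borel_measurable (F (\<rho> k))" using Suc.prems by simp
  have [measurable]: "S \<in> borel_measurable (F (\<rho> (Suc k)))" "\<zeta> k \<in> borel_measurable (F (\<rho> (Suc k)))"
    by (rule measurable_F_mono[OF st SF]) (rule measurable_F_mono[OF st zF])
  have [measurable]: "S \<in> borel_measurable M" "\<zeta> k \<in> borel_measurable M"
    using measurable_F_M[OF kT] SF zF by auto
  obtain B where B: "\<And>w. w \<in> space M \<Longrightarrow> norm (\<zeta> k w) \<le> B"
    using Suc.prems(4)[of k] by (auto simp: bounded_iff)
  have B0: "0 \<le> B" using B not_empty norm_ge_zero order_trans by blast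
  have zint: "integrable M (\<lambda>w. (norm (\<zeta> k w))\<^sup>2)"
    by (rule integrable_const_bound[of _ "B\<^sup>2"]) (auto intro!: AE_I2 power_mono B)
  have cint: "integrable M (\<lambda>w. S w \<bullet> \<zeta> k w)"
  proof (rule Bochner_Integration.integrable_bound)
    show "integrable M (\<lambda>w. (norm (S w))\<^sup>2 + (norm (\<zeta> k w))\<^sup>2)"
      using IH(1) zint by auto
    show "AE w in M. norm (S w \<bullet> \<zeta> k w) \<le> norm ((norm (S w))\<^sup>2 + (norm (\<zeta> k w))\<^sup>2)"
    proof (rule AE_I2)
      fix w
      have "\<bar>S w \<bullet> \<zeta> k w\<bar> \<le> norm (S w) * norm (\<zeta> k w)" by (rule Cauchy_Schwarz_ineq2)
      also have "2 * (norm (S w) * norm (\<zeta> k w)) \<le> (norm (S w))\<^sup>2 + (norm (\<zeta> k w))\<^sup>2"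
        using sum_squares_bound[of "norm (S w)" "norm (\<zeta> k w)"] by simp
      then have "norm (S w) * norm (\<zeta> k w) \<le> (norm (S w))\<^sup>2 + (norm (\<zeta> k w))\<^sup>2"
        by (smt (verit) mult_nonneg_nonneg norm_ge_zero)
      finally show "norm (S w \<bullet> \<zeta> k w) \<le> norm ((norm (S w))\<^sup>2 + (norm (\<zeta> k w))\<^sup>2)" by simp
    qed
  qed auto
  have eq: "(norm (\<Sum>j<Suc k. (W (\<rho> (Suc j)) w - W (\<rho> j) w) *\<^sub>R \<zeta> j w))\<^sup>2
    = (norm (S w))\<^sup>2 + 2 * ((S w \<bullet> \<zeta> k w) * (W (\<rho> (Suc k)) w - W (\<rho> k) w))
      + (norm (\<zeta> k w))\<^sup>2 * (W (\<rho> (Suc k)) w - W (\<rho> k) w)\<^sup>2" for w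
    unfolding sum.lessThan_Suc S_def[symmetric] power2_norm_eq_inner
    by (simp add: inner_add_left inner_add_right inner_commute power2_eq_square algebra_simps)
  have cF: "(\<lambda>w. S w \<bullet> \<zeta> k w) \<in> borel_measurable (F (\<rho> k))"
    "(\<lambda>w. (norm (\<zeta> k w))\<^sup>2) \<in> borel_measurable (F (\<rho> k))"
    using SF zF by auto
  note c = bm_increment_mult(1,2)[OF bm st cF(1) cint] bm_increment_mult(3,4)[OF bm st cF(2) zint]
  show ?case
    unfolding eq using c IH
    by (auto simp: S_def[symmetric])
qed

end

section \<open>Ito integrals of deterministic functions\<close>

lemma simple_process_eq:
  assumes "\<And>j. j < k \<Longrightarrow> \<tau> j \<le> \<tau> (Suc j)" "j < k" "r \<in> {\<tau> j<..\<tau> (Suc j)}"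
  shows "simple_process k \<tau> \<xi> r w = \<xi> j w"
proof -
  have "indicator {\<tau> i<..\<tau> (Suc i)} r *\<^sub>R \<xi> i w = (if i = j then \<xi> j w else 0)" if i: "i < k" for i
  proof (cases i j rule: linorder_cases)
    case less
    then have "\<tau> (Suc i) \<le> \<tau> j" using partition_mono[of k \<tau> "Suc i" j] assms by auto
    then show ?thesis using assms less by auto
  next
    case greater
    then have "\<tau> (Suc j) \<le> \<tau> i" using partition_mono[of k \<tau> "Suc j" i] assms i by auto
    then show ?thesis using assms greater by auto
  qed (use assms in auto)
  then have "simple_process k \<tau> \<xi> r w = (\<Sum>i<k. if i = j then \<xi> j w else 0)"
    unfolding simple_process_def by (intro sum.cong) auto
  then show ?thesis using assms by simp
qed

context usual_filtered_prob_space
begin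

text \<open>Puts a cell from 0 to \<open>\<tau> 0\<close> in front and a cell from
  \<open>\<tau> k\<close> to \<open>T\<close> behind, both with value 0. Afterwards every partition
  covers \<open>{0..T}\<close> and sums over it telescope.\<close>

lemma simple_integrand_extend:
  assumes "simple_integrand M F T k \<tau> \<xi>"
  obtains k' \<tau>' \<xi>' where "simple_integrand M F T k' \<tau>' \<xi>'" "\<tau>' 0 = 0" "\<tau>' k' = T"
    "\<And>s w. simple_process k' \<tau>' \<xi>' s w = simple_process k \<tau> \<xi> s w"
    "\<And>t w. simple_integral W k' \<tau>' \<xi>' t w = simple_integral W k \<tau> \<xi> t w"
proof -
  define \<tau>' where "\<tau>' = case_nat 0 (\<lambda>j. if j \<le> k then \<tau> j else T)"
  define \<xi>' where "\<xi>' = case_nat (\<lambda>_. 0) (\<lambda>j. if j < k then \<xi> j else (\<lambda>_. 0))"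
  have "\<And>j. j < k \<Longrightarrow> \<tau> j \<le> \<tau> (Suc j)" "0 \<le> \<tau> 0" "\<tau> k \<le> T"
    and m: "\<And>j. j < k \<Longrightarrow> \<xi> j \<in> borel_measurable (F (\<tau> j))" "\<And>j. j < k \<Longrightarrow> bounded (\<xi> j ` space M)"
    using assms by (auto simp: simple_integrand_def)
  show ?thesis
  proof (rule that)
    show "simple_integrand M F T (Suc (Suc k)) \<tau>' \<xi>'"
      unfolding simple_integrand_def
    proof (intro conjI allI impI)
      fix j assume "j < Suc (Suc k)"
      then show "\<tau>' j \<le> \<tau>' (Suc j)" "\<xi>' j \<in> borel_measurable (F (\<tau>' j))" "bounded (\<xi>' j ` space M)"
        using assms by (auto simp: \<tau>'_def \<xi>'_def simple_integrand_def image_constant_conv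
            le_Suc_eq less_Suc_eq split: nat.splits)
    qed (use assms in \<open>auto simp: \<tau>'_def simple_integrand_def\<close>)
    show "\<tau>' 0 = 0" "\<tau>' (Suc (Suc k)) = T" by (auto simp: \<tau>'_def)
    show "simple_process (Suc (Suc k)) \<tau>' \<xi>' s w = simple_process k \<tau> \<xi> s w" for s w
      unfolding simple_process_def
      by (subst sum.lessThan_Suc_shift) (auto simp: \<xi>'_def \<tau>'_def intro!: sum.cong)
    show "simple_integral W (Suc (Suc k)) \<tau>' \<xi>' s w = simple_integral W k \<tau> \<xi> s w" for s w
      unfolding simple_integral_def
      by (subst sum.lessThan_Suc_shift) (auto simp: \<xi>'_def \<tau>'_def intro!: sum.cong)
  qed
qed

text \<open>Clamping the partition to \<open>{s..t}\<close> makes all cells outside degenerate, so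
  that the increment over \<open>{s..t}\<close> is again a sum over a monotone partition, now
  running from \<open>s\<close> to \<open>t\<close> when the original one covers this
  interval.\<close>

lemma simple_integral_diff:
  assumes "0 \<le> s" "s \<le> t"
  shows "simple_integral W k \<tau> \<xi> t w - simple_integral W k \<tau> \<xi> s w =
    (\<Sum>j<k. (W (max s (min t (\<tau> (Suc j)))) w - W (max s (min t (\<tau> j))) w) *\<^sub>R \<xi> j w)"
proof -
  have *: "W (min u t) w - W (min u s) w = W (max s (min t u)) w - W s w" for u
    using assms by (auto simp: min_def max_def)
  have "W (min a t) w - W (min b t) w - (W (min a s) w - W (min b s) w)
      = W (max s (min t a)) w - W (max s (min t b)) w" for a b
    using *[of a] *[of b] by simp
  then show ?thesis
    unfolding simple_integral_def sum_subtractf[symmetric] scaleR_diff_left[symmetric] by simp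
qed

text \<open>The mean square distance to a constant \<open>v\<close> is the variance plus the squared
  bias, and each summand is at most the whole. The first bound controls the averaged integrand, the
  second the error made by averaging.\<close>

lemma nn_integral_norm_expectation_le:
  fixes \<xi> :: "'w \<Rightarrow> 'a::euclidean_space"
  assumes "\<xi> \<in> borel_measurable M" "bounded (\<xi> ` space M)"
  shows "ennreal ((norm (expectation \<xi> - v))\<^sup>2) \<le> (\<integral>\<^sup>+w. ennreal ((norm (\<xi> w - v))\<^sup>2) \<partial>M)"
    and "ennreal (expectation (\<lambda>w. (norm (\<xi> w - expectation \<xi>))\<^sup>2)) \<le> (\<integral>\<^sup>+w. ennreal ((norm (\<xi> w - v))\<^sup>2) \<partial>M)"
proof -
  note [measurable] = assms(1)
  obtain B where B: "\<And>w. w \<in> space M \<Longrightarrow> norm (\<xi> w) \<le> B"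
    using assms(2) by (auto simp: bounded_iff)
  have i1: "integrable M \<xi>" by (rule integrable_const_bound[of _ B]) (auto intro!: AE_I2 B)
  have i2: "integrable M (\<lambda>w. (norm (\<xi> w - u))\<^sup>2)" for u
  proof (rule integrable_const_bound[of _ "(B + norm u)\<^sup>2"])
    show "AE w in M. norm ((norm (\<xi> w - u))\<^sup>2) \<le> (B + norm u)\<^sup>2"
      by (rule AE_I2) (auto intro!: power_mono order_trans[OF norm_triangle_ineq4] B)
  qed simp
  let ?c = "expectation \<xi>"
  have eq: "expectation (\<lambda>w. (norm (\<xi> w - v))\<^sup>2)
      = expectation (\<lambda>w. (norm (\<xi> w - ?c))\<^sup>2) + (norm (?c - v))\<^sup>2"
  proof -
    have i3: "integrable M (\<lambda>w. (\<xi> w - ?c) \<bullet> (?c - v))" using i1 by auto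
    have "expectation (\<lambda>w. (\<xi> w - ?c) \<bullet> (?c - v)) = 0"
      using i1 by (simp add: prob_space)
    moreover have "(norm (\<xi> w - v))\<^sup>2 = (norm (\<xi> w - ?c))\<^sup>2 + (2 * ((\<xi> w - ?c) \<bullet> (?c - v)) + (norm (?c - v))\<^sup>2)" for w
      unfolding power2_norm_eq_inner by (simp add: inner_diff_left inner_diff_right inner_commute algebra_simps)
    ultimately show ?thesis
      using i2[of ?c] i3 by (simp add: prob_space)
  qed
  have n: "(\<integral>\<^sup>+w. ennreal ((norm (\<xi> w - v))\<^sup>2) \<partial>M) = ennreal (expectation (\<lambda>w. (norm (\<xi> w - v))\<^sup>2))"
    by (rule nn_integral_eq_integral[OF i2]) auto
  show "ennreal ((norm (?c - v))\<^sup>2) \<le> (\<integral>\<^sup>+w. ennreal ((norm (\<xi> w - v))\<^sup>2) \<partial>M)"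
    "ennreal (expectation (\<lambda>w. (norm (\<xi> w - ?c))\<^sup>2)) \<le> (\<integral>\<^sup>+w. ennreal ((norm (\<xi> w - v))\<^sup>2) \<partial>M)"
    unfolding n eq by (auto intro!: ennreal_leI)
qed

lemma ennreal_norm_add_sq_le:
  "ennreal ((norm (a + b))\<^sup>2) \<le> 2 * ennreal ((norm a)\<^sup>2) + 2 * ennreal ((norm b)\<^sup>2)"
proof -
  have "(norm (a + b))\<^sup>2 \<le> (norm a + norm b)\<^sup>2" by (intro power_mono norm_triangle_ineq) auto
  also have "\<dots> \<le> 2 * (norm a)\<^sup>2 + 2 * (norm b)\<^sup>2"
    using sum_squares_bound[of "norm a" "norm b"] by (simp add: power2_sum)
  finally have "ennreal ((norm (a + b))\<^sup>2) \<le> ennreal (2 * (norm a)\<^sup>2 + 2 * (norm b)\<^sup>2)"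
    by (rule ennreal_leI)
  then show ?thesis by (simp add: ennreal_mult)
qed

text \<open>Replacing each random value of an approximating simple process by its expectation does not
  increase its distance to a deterministic integrand, so the integral is an \<open>L\<^sup>2\<close>-limit of
  Gaussian sums.\<close>

lemma ito_deterministic_approximation:
  fixes G :: "real \<Rightarrow> 'a::euclidean_space"
  assumes bm: "brownian_motion M F T W" and ito: "is_ito_integral M F T W (\<lambda>s _. G s) J"
    and G: "continuous_on {0..T} G"
  obtains k :: "nat \<Rightarrow> nat" and \<tau> :: "nat \<Rightarrow> nat \<Rightarrow> real" and c :: "nat \<Rightarrow> nat \<Rightarrow> 'a"
    and \<psi> :: "nat \<Rightarrow> real \<Rightarrow> ennreal"
  where "\<And>n. \<tau> n 0 = 0" "\<And>n. \<tau> n (k n) = T" "\<And>n j. j < k n \<Longrightarrow> \<tau> n j \<le> \<tau> n (Suc j)"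
    "\<And>n. \<psi> n \<in> borel_measurable borel"
    "\<And>n j r. j < k n \<Longrightarrow> r \<in> {\<tau> n j<..\<tau> n (Suc j)} \<Longrightarrow> ennreal ((norm (c n j - G r))\<^sup>2) \<le> \<psi> n r"
    "(\<lambda>n. \<integral>\<^sup>+r\<in>{0..T}. \<psi> n r \<partial>lborel) \<longlonglongrightarrow> 0"
    "\<And>t. t \<in> {0..T} \<Longrightarrow>
       (\<lambda>n. \<integral>\<^sup>+w. ennreal ((norm (simple_integral W (k n) (\<tau> n) (\<lambda>j _. c n j) t w - J t w))\<^sup>2) \<partial>M) \<longlonglongrightarrow> 0"
proof -
  obtain k0 \<tau>0 \<xi>0 where s0: "\<And>n. simple_integrand M F T (k0 n) (\<tau>0 n) (\<xi>0 n)"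
    and l0: "(\<lambda>n. \<integral>\<^sup>+w. (\<integral>\<^sup>+s\<in>{0..T}.
            ennreal ((norm (simple_process (k0 n) (\<tau>0 n) (\<xi>0 n) s w - G s))\<^sup>2) \<partial>lborel) \<partial>M) \<longlonglongrightarrow> 0"
    and i0: "\<And>t. t\<in>{0..T} \<Longrightarrow> (\<lambda>n. \<integral>\<^sup>+w.
            ennreal ((norm (simple_integral W (k0 n) (\<tau>0 n) (\<xi>0 n) t w - J t w))\<^sup>2) \<partial>M) \<longlonglongrightarrow> 0"
    and Jad: "adapted F T J"
    using ito unfolding is_ito_integral_def by blast
  have "\<forall>n. \<exists>k' \<tau>' \<xi>'. simple_integrand M F T k' \<tau>' \<xi>' \<and> \<tau>' 0 = 0 \<and> \<tau>' k' = T \<and>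
    (\<forall>s w. simple_process k' \<tau>' \<xi>' s w = simple_process (k0 n) (\<tau>0 n) (\<xi>0 n) s w) \<and>
    (\<forall>t w. simple_integral W k' \<tau>' \<xi>' t w = simple_integral W (k0 n) (\<tau>0 n) (\<xi>0 n) t w)"
    using simple_integrand_extend[OF s0] by metis
  then obtain k \<tau> \<xi> where s: "\<And>n. simple_integrand M F T (k n) (\<tau> n) (\<xi> n)" 
    and \<tau>0: "\<And>n. \<tau> n 0 = 0" and \<tau>T: "\<And>n. \<tau> n (k n) = T"
    and p: "\<And>n s w. simple_process (k n) (\<tau> n) (\<xi> n) s w = simple_process (k0 n) (\<tau>0 n) (\<xi>0 n) s w"
    and i: "\<And>n t w. simple_integral W (k n) (\<tau> n) (\<xi> n) t w = simple_integral W (k0 n) (\<tau>0 n) (\<xi>0 n) t w"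
    by metis
  note l = l0[folded p] and i0 = i0[folded i]
  have mono: "\<And>n j. j < k n \<Longrightarrow> \<tau> n j \<le> \<tau> n (Suc j)"
    and \<xi>F: "\<And>n j. j < k n \<Longrightarrow> \<xi> n j \<in> borel_measurable (F (\<tau> n j))"
    and \<xi>b: "\<And>n j. j < k n \<Longrightarrow> bounded (\<xi> n j ` space M)"
    using s by (auto simp: simple_integrand_def)
  have \<tau>r: "\<tau> n j \<in> {0..T}" if "j \<le> k n" for n j
    using partition_mono[of "k n" "\<tau> n" 0 j] partition_mono[of "k n" "\<tau> n" j "k n"] mono that \<tau>0 \<tau>T by auto
  have \<xi>M [measurable]: "\<xi> n j \<in> borel_measurable M" if "j < k n" for n j
    using measurable_F_M[OF \<tau>r \<xi>F] that by simp
  define c where "c n j = expectation (\<xi> n j)" for n j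
  \<comment> \<open>Extension by zero, since \<open>G\<close> is assumed continuous on
    \<open>{0..T}\<close> only and a Borel function on the line is wanted for Fubini.\<close>
  define G' where "G' s = indicator {0..T} s *\<^sub>R G s" for s
  have [measurable]: "G' \<in> borel_measurable borel"
    unfolding G'_def using borel_measurable_continuous_on_indicator[OF _ G] by simp
  \<comment> \<open>The mean square distance to the integrand at time \<open>r\<close>. Its time
    integral is the quantity that tends to 0 by the definition of the integral, and on each cell it
    dominates both terms of the bias-variance splitting.\<close>
  define \<psi> where "\<psi> n r = (\<integral>\<^sup>+w. ennreal ((norm (simple_process (k n) (\<tau> n) (\<xi> n) r w - G' r))\<^sup>2) \<partial>M)" for n r
  have sm [measurable]: "(\<lambda>(r, w). simple_process (k n) (\<tau> n) (\<xi> n) r w) \<in> borel_measurable (lborel \<Otimes>\<^sub>M M)" for n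
    unfolding simple_process_def split_beta'
  proof (rule borel_measurable_sum)
    fix j assume "j \<in> {..<k n}"
    then have [measurable]: "\<xi> n j \<in> borel_measurable M" using \<xi>M by simp
    show "(\<lambda>x. indicator {\<tau> n j<..\<tau> n (Suc j)} (fst x) *\<^sub>R \<xi> n j (snd x)) \<in> borel_measurable (lborel \<Otimes>\<^sub>M M)"
      by measurable
  qed
  have \<psi>m: "\<psi> n \<in> borel_measurable borel" for n
  proof -
    have "\<psi> n \<in> borel_measurable lborel" unfolding \<psi>_def by measurable
    then show ?thesis by simp
  qed
  interpret P: pair_sigma_finite lborel M ..
  have \<psi>l: "(\<integral>\<^sup>+r\<in>{0..T}. \<psi> n r \<partial>lborel) = (\<integral>\<^sup>+w. (\<integral>\<^sup>+s\<in>{0..T}.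
            ennreal ((norm (simple_process (k n) (\<tau> n) (\<xi> n) s w - G s))\<^sup>2) \<partial>lborel) \<partial>M)" for n
  proof -
    have "(\<integral>\<^sup>+r\<in>{0..T}. \<psi> n r \<partial>lborel) = (\<integral>\<^sup>+r. (\<integral>\<^sup>+w. ennreal ((norm (simple_process (k n) (\<tau> n) (\<xi> n) r w - G' r))\<^sup>2) * indicator {0..T} r \<partial>M) \<partial>lborel)"
      unfolding \<psi>_def by (intro nn_integral_cong nn_integral_multc[symmetric]) measurable
    also have "\<dots> = (\<integral>\<^sup>+w. (\<integral>\<^sup>+r. ennreal ((norm (simple_process (k n) (\<tau> n) (\<xi> n) r w - G' r))\<^sup>2) * indicator {0..T} r \<partial>lborel) \<partial>M)"
      by (rule P.Fubini'[symmetric]) measurable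
    also have "\<dots> = (\<integral>\<^sup>+w. (\<integral>\<^sup>+s\<in>{0..T}.
            ennreal ((norm (simple_process (k n) (\<tau> n) (\<xi> n) s w - G s))\<^sup>2) \<partial>lborel) \<partial>M)"
      by (intro nn_integral_cong) (auto simp: G'_def indicator_def)
    finally show ?thesis .
  qed
  have psi_ge: "ennreal ((norm (c n j - G r))\<^sup>2) \<le> \<psi> n r"
      "ennreal (expectation (\<lambda>w. (norm (\<xi> n j w - c n j))\<^sup>2)) \<le> \<psi> n r"
    if j: "j < k n" and r: "r \<in> {\<tau> n j<..\<tau> n (Suc j)}" for n j r
  proof -
    have "r \<in> {0..T}" using r \<tau>r[of j n] \<tau>r[of "Suc j" n] j by auto
    then have "\<psi> n r = (\<integral>\<^sup>+w. ennreal ((norm (\<xi> n j w - G r))\<^sup>2) \<partial>M)"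
      unfolding \<psi>_def using simple_process_eq[of "k n" "\<tau> n" j r "\<xi> n", OF mono j r] by (simp add: G'_def)
    then show "ennreal ((norm (c n j - G r))\<^sup>2) \<le> \<psi> n r"
      "ennreal (expectation (\<lambda>w. (norm (\<xi> n j w - c n j))\<^sup>2)) \<le> \<psi> n r"
      unfolding c_def using nn_integral_norm_expectation_le[OF \<xi>M[OF j] \<xi>b[OF j], of "G r"] by simp_all
  qed
  have \<psi>0: "(\<lambda>n. \<integral>\<^sup>+r\<in>{0..T}. \<psi> n r \<partial>lborel) \<longlonglongrightarrow> 0" unfolding \<psi>l by (rule l)
  show ?thesis
  proof (rule that[of \<tau> k \<psi> c, OF \<tau>0 \<tau>T mono \<psi>m psi_ge(1) \<psi>0])
    fix t assume t: "t \<in> {0..T}"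
    have [measurable]: "J t \<in> borel_measurable M" 
      using Jad t measurable_F_M unfolding adapted_def by blast
    have Wm [measurable]: "W (min (\<tau> n j) t) \<in> borel_measurable M" if "j \<le> k n" for n j
      using bm_measurable[OF bm, of "min (\<tau> n j) t"] \<tau>r[of j n] that t by auto
    have [measurable]: "simple_integral W (k n) (\<tau> n) (\<xi> n) t \<in> borel_measurable M"
      "simple_integral W (k n) (\<tau> n) (\<lambda>j _. c n j) t \<in> borel_measurable M" for n
      unfolding simple_integral_def by (auto intro!: borel_measurable_sum borel_measurable_scaleR borel_measurable_diff Wm \<xi>M)
    have iso: "(\<integral>\<^sup>+w. ennreal ((norm (simple_integral W (k n) (\<tau> n) (\<lambda>j _. c n j) t w
         - simple_integral W (k n) (\<tau> n) (\<xi> n) t w))\<^sup>2) \<partial>M) \<le> (\<integral>\<^sup>+r\<in>{0..T}. \<psi> n r \<partial>lborel)" for n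
    proof -
      define \<rho> where "\<rho> j = min (\<tau> n j) t" for j
      \<comment> \<open>For \<open>\<tau> n j > t\<close> the clamped increment is 0, but
        \<open>\<xi> n j\<close> need not be measurable at the clamped time \<open>t\<close>;
        setting the coefficient to 0 there restores adaptedness without changing the sum.\<close>
      define \<zeta> where "\<zeta> j w = (if \<tau> n j \<le> t then c n j - \<xi> n j w else 0)" for j w
      have \<rho>0: "\<rho> 0 = 0" and \<rho>k: "\<rho> (k n) \<le> T" using \<tau>0 \<tau>T t by (auto simp: \<rho>_def)
      have \<rho>m: "\<rho> j \<le> \<rho> (Suc j)" if "j < k n" for j using mono[OF that] by (auto simp: \<rho>_def)
      have zF: "\<zeta> j \<in> borel_measurable (F (\<rho> j))" if "j < k n" for j
      proof (cases "\<tau> n j \<le> t")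
        case True
        then have "\<zeta> j = (\<lambda>w. c n j - \<xi> n j w)" "\<rho> j = \<tau> n j" by (auto simp: \<zeta>_def \<rho>_def)
        then show ?thesis using \<xi>F[OF that] by simp
      next
        case False
        then have "\<zeta> j = (\<lambda>w. 0)" by (auto simp: \<zeta>_def)
        then show ?thesis by simp
      qed
      have zb: "bounded (\<zeta> j ` space M)" if j: "j < k n" for j
      proof -
        obtain B where "\<And>w. w \<in> space M \<Longrightarrow> norm (\<xi> n j w) \<le> B"
          using \<xi>b[OF j] by (auto simp: bounded_iff)
        then have "norm (\<zeta> j w) \<le> norm (c n j) + \<bar>B\<bar>" if "w \<in> space M" for w
          using that norm_triangle_ineq4[of "c n j" "\<xi> n j w"] unfolding \<zeta>_def by fastforce
        then show ?thesis by (auto simp: bounded_iff)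
      qed
      have eq: "simple_integral W (k n) (\<tau> n) (\<lambda>j _. c n j) t w - simple_integral W (k n) (\<tau> n) (\<xi> n) t w
          = (\<Sum>j<k n. (W (\<rho> (Suc j)) w - W (\<rho> j) w) *\<^sub>R \<zeta> j w)" for w
        unfolding simple_integral_def sum_subtractf[symmetric]
      proof (rule sum.cong)
        fix j assume "j \<in> {..<k n}"
        then have "\<tau> n j \<le> \<tau> n (Suc j)" using mono by simp
        then show "(W (min (\<tau> n (Suc j)) t) w - W (min (\<tau> n j) t) w) *\<^sub>R c n j
            - (W (min (\<tau> n (Suc j)) t) w - W (min (\<tau> n j) t) w) *\<^sub>R \<xi> n j w
            = (W (\<rho> (Suc j)) w - W (\<rho> j) w) *\<^sub>R \<zeta> j w"
          by (auto simp: \<rho>_def \<zeta>_def scaleR_diff_right min_absorb2)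
      qed simp
      note iso = bm_isometry[OF bm eq_refl[OF \<rho>0[symmetric]] \<rho>m \<rho>k zF zb]
      have "(\<integral>\<^sup>+w. ennreal ((norm (simple_integral W (k n) (\<tau> n) (\<lambda>j _. c n j) t w
         - simple_integral W (k n) (\<tau> n) (\<xi> n) t w))\<^sup>2) \<partial>M)
         = ennreal (\<Sum>j<k n. expectation (\<lambda>w. (norm (\<zeta> j w))\<^sup>2) * (\<rho> (Suc j) - \<rho> j))"
        unfolding eq using iso by (subst nn_integral_eq_integral) auto
      also have "\<dots> \<le> (\<integral>\<^sup>+r\<in>{\<rho> 0<..\<rho> (k n)}. \<psi> n r \<partial>lborel)"
      proof (rule sum_le_nn_integral_partition[of "k n" \<rho> "\<psi> n", OF \<rho>m \<psi>m])
        fix j r assume j: "j < k n" and r: "r \<in> {\<rho> j<..\<rho> (Suc j)}"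
        then have r': "r \<in> {\<tau> n j<..\<tau> n (Suc j)}" "\<tau> n j \<le> t" by (auto simp: \<rho>_def min_def split: if_splits)
        then show "ennreal (expectation (\<lambda>w. (norm (\<zeta> j w))\<^sup>2)) \<le> \<psi> n r"
          using psi_ge(2)[OF j r'(1)] by (simp add: \<zeta>_def norm_minus_commute)
      qed auto
      also have "\<dots> \<le> (\<integral>\<^sup>+r\<in>{0..T}. \<psi> n r \<partial>lborel)"
        using \<rho>0 \<rho>k by (intro nn_set_integral_set_mono) auto
      finally show ?thesis .
    qed
    let ?I = "\<lambda>n w. simple_integral W (k n) (\<tau> n) (\<xi> n) t w"
    let ?C = "\<lambda>n w. simple_integral W (k n) (\<tau> n) (\<lambda>j _. c n j) t w"
    let ?R = "\<lambda>n. 2 * (\<integral>\<^sup>+r\<in>{0..T}. \<psi> n r \<partial>lborel) + 2 * (\<integral>\<^sup>+w. ennreal ((norm (?I n w - J t w))\<^sup>2) \<partial>M)"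
    have le: "(\<integral>\<^sup>+w. ennreal ((norm (?C n w - J t w))\<^sup>2) \<partial>M) \<le> ?R n" for n
    proof -
      have "(\<integral>\<^sup>+w. ennreal ((norm (?C n w - J t w))\<^sup>2) \<partial>M)
         \<le> (\<integral>\<^sup>+w. 2 * ennreal ((norm (?C n w - ?I n w))\<^sup>2) + 2 * ennreal ((norm (?I n w - J t w))\<^sup>2) \<partial>M)"
      proof (rule nn_integral_mono)
        fix w
        show "ennreal ((norm (?C n w - J t w))\<^sup>2)
          \<le> 2 * ennreal ((norm (?C n w - ?I n w))\<^sup>2) + 2 * ennreal ((norm (?I n w - J t w))\<^sup>2)"
          using ennreal_norm_add_sq_le[of "?C n w - ?I n w" "?I n w - J t w"] by simp
      qed
      also have "\<dots> = 2 * (\<integral>\<^sup>+w. ennreal ((norm (?C n w - ?I n w))\<^sup>2) \<partial>M)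
          + 2 * (\<integral>\<^sup>+w. ennreal ((norm (?I n w - J t w))\<^sup>2) \<partial>M)"
        by (simp add: nn_integral_add nn_integral_cmult)
      also have "\<dots> \<le> ?R n" by (intro add_mono mult_left_mono iso) auto
      finally show ?thesis .
    qed
    have "?R \<longlonglongrightarrow> 2 * 0 + 2 * 0"
      by (intro tendsto_add ennreal_tendsto_cmult \<psi>0 i0[OF t]) auto
    then have R0: "?R \<longlonglongrightarrow> 0" by simp
    show "(\<lambda>n. \<integral>\<^sup>+w. ennreal ((norm (?C n w - J t w))\<^sup>2) \<partial>M) \<longlonglongrightarrow> 0"
      by (rule tendsto_sandwich[OF _ _ tendsto_const R0]) (auto intro!: always_eventually le)
  qed
qed

end

section \<open>Exponential moments and conditional means of Ito increments\<close>

lemma ennreal_le_at_right_limit: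
  fixes u :: "real \<Rightarrow> real"
  assumes "isCont u 0" and le: "\<And>\<delta>. 0 < \<delta> \<Longrightarrow> x \<le> ennreal (u \<delta>)"
  shows "x \<le> ennreal (u 0)"
proof -
  have "(u \<longlongrightarrow> u 0) (at 0)" using assms(1) by (simp only: isCont_def)
  then have "(u \<longlongrightarrow> u 0) (at_right 0)" by (rule tendsto_within_subset) simp
  then have lim: "((\<lambda>\<delta>. ennreal (u \<delta>)) \<longlongrightarrow> ennreal (u 0)) (at_right 0)"
    by (rule tendsto_ennrealI)
  have ev: "\<forall>\<^sub>F \<delta> in at_right 0. x \<le> ennreal (u \<delta>)"
    by (rule eventually_at_rightI[of 0 1]) (simp_all add: le)
  show ?thesis by (rule tendsto_lowerbound[OF lim ev]) simp
qed

context usual_filtered_prob_space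
begin

lemma ito_adapted: "is_ito_integral M F T W G J \<Longrightarrow> t \<in> {0..T} \<Longrightarrow> J t \<in> borel_measurable (F t)"
  by (simp add: is_ito_integral_def adapted_def)

text \<open>Subtracting a constant \<open>v\<close> from the integrand serves two purposes:
  \<open>v = 0\<close> gives the size of the integral, and a value of \<open>G\<close> in the
  interval gives the error of freezing the integrand. The factor 2 in front of
  \<open>B\<^sup>2\<close> comes from passing from \<open>c\<close> to \<open>G\<close> and from
  \<open>G\<close> to \<open>v\<close>.\<close>

lemma ito_increment_approximation:
  fixes G :: "real \<Rightarrow> 'a::euclidean_space"
  assumes bm: "brownian_motion M F T W" and ito: "is_ito_integral M F T W (\<lambda>s _. G s) J"
    and G: "continuous_on {0..T} G" and st: "0 \<le> s" "s \<le> t" "t \<le> T"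
    and v: "\<And>r. r \<in> {s..t} \<Longrightarrow> norm (G r - v) \<le> B"
  obtains k :: "nat \<Rightarrow> nat" and \<rho> :: "nat \<Rightarrow> nat \<Rightarrow> real" and c :: "nat \<Rightarrow> nat \<Rightarrow> 'a" and \<epsilon> :: "nat \<Rightarrow> ennreal"
  where "\<And>n. \<rho> n 0 = s" "\<And>n. \<rho> n (k n) = t" "\<And>n j. j < k n \<Longrightarrow> \<rho> n j \<le> \<rho> n (Suc j)"
    "\<And>n. ennreal (\<Sum>j<k n. (norm (c n j))\<^sup>2 * (\<rho> n (Suc j) - \<rho> n j)) \<le> ennreal (2 * B\<^sup>2 * (t - s)) + \<epsilon> n"
    "\<epsilon> \<longlonglongrightarrow> 0"
    "(\<lambda>n. \<integral>\<^sup>+w. ennreal ((norm ((\<Sum>j<k n. (W (\<rho> n (Suc j)) w - W (\<rho> n j) w) *\<^sub>R c n j)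
        - (J t w - J s w - (W t w - W s w) *\<^sub>R v)))\<^sup>2) \<partial>M) \<longlonglongrightarrow> 0"
proof -
  obtain k :: "nat \<Rightarrow> nat" and \<tau> :: "nat \<Rightarrow> nat \<Rightarrow> real" and c :: "nat \<Rightarrow> nat \<Rightarrow> 'a"
    and \<psi> :: "nat \<Rightarrow> real \<Rightarrow> ennreal"
  where \<tau>: "\<And>n. \<tau> n 0 = 0" "\<And>n. \<tau> n (k n) = T" "\<And>n j. j < k n \<Longrightarrow> \<tau> n j \<le> \<tau> n (Suc j)"
    and \<psi>m [measurable]: "\<And>n. \<psi> n \<in> borel_measurable borel"
    and \<psi>: "\<And>n j r. j < k n \<Longrightarrow> r \<in> {\<tau> n j<..\<tau> n (Suc j)} \<Longrightarrow> ennreal ((norm (c n j - G r))\<^sup>2) \<le> \<psi> n r"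
    and \<psi>0: "(\<lambda>n. \<integral>\<^sup>+r\<in>{0..T}. \<psi> n r \<partial>lborel) \<longlonglongrightarrow> 0"
    and I: "\<And>t. t \<in> {0..T} \<Longrightarrow>
       (\<lambda>n. \<integral>\<^sup>+w. ennreal ((norm (simple_integral W (k n) (\<tau> n) (\<lambda>j _. c n j) t w - J t w))\<^sup>2) \<partial>M) \<longlonglongrightarrow> 0"
    by (rule ito_deterministic_approximation[OF bm ito G]) (rule that; assumption)
  define \<rho> where "\<rho> n j = max s (min t (\<tau> n j))" for n j
  have \<rho>0: "\<rho> n 0 = s" and \<rho>k: "\<rho> n (k n) = t" for n using \<tau> st by (auto simp: \<rho>_def)
  have \<rho>m: "\<rho> n j \<le> \<rho> n (Suc j)" if "j < k n" for n j using \<tau>(3)[OF that] by (auto simp: \<rho>_def)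
  have B0: "0 \<le> B" using order_trans[OF norm_ge_zero v[of s]] st by simp
  define \<epsilon> where "\<epsilon> n = 2 * (\<integral>\<^sup>+r\<in>{0..T}. \<psi> n r \<partial>lborel)" for n
  have \<epsilon>0: "\<epsilon> \<longlonglongrightarrow> 0"
    using ennreal_tendsto_cmult[OF _ \<psi>0, of 2] by (simp add: \<epsilon>_def[abs_def])
  have bound: "ennreal (\<Sum>j<k n. (norm (c n j - v))\<^sup>2 * (\<rho> n (Suc j) - \<rho> n j)) \<le> ennreal (2 * B\<^sup>2 * (t - s)) + \<epsilon> n" for n
  proof -
    have "ennreal (\<Sum>j<k n. (norm (c n j - v))\<^sup>2 * (\<rho> n (Suc j) - \<rho> n j))
      \<le> (\<integral>\<^sup>+r\<in>{\<rho> n 0<..\<rho> n (k n)}. (ennreal (2 * B\<^sup>2) + 2 * \<psi> n r) \<partial>lborel)"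
    proof (rule sum_le_nn_integral_partition[of "k n" "\<rho> n", OF \<rho>m])
      fix j r assume j: "j < k n" and r: "r \<in> {\<rho> n j<..\<rho> n (Suc j)}"
      then have r': "r \<in> {\<tau> n j<..\<tau> n (Suc j)}" "r \<in> {s..t}"
        using st by (auto simp: \<rho>_def min_def max_def split: if_splits)
      have "ennreal ((norm (c n j - v))\<^sup>2) \<le> 2 * ennreal ((norm (c n j - G r))\<^sup>2) + 2 * ennreal ((norm (G r - v))\<^sup>2)"
        using ennreal_norm_add_sq_le[of "c n j - G r" "G r - v"] by simp
      also have "\<dots> \<le> 2 * \<psi> n r + 2 * ennreal (B\<^sup>2)"
        by (intro add_mono mult_left_mono \<psi>[OF j r'(1)] ennreal_leI power_mono v r') auto
      finally show "ennreal ((norm (c n j - v))\<^sup>2) \<le> ennreal (2 * B\<^sup>2) + 2 * \<psi> n r"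
        by (simp add: ennreal_mult add.commute)
    qed auto
    also have "\<dots> = (\<integral>\<^sup>+r. ennreal (2 * B\<^sup>2) * indicator {s<..t} r + 2 * (\<psi> n r * indicator {s<..t} r) \<partial>lborel)"
      unfolding \<rho>0 \<rho>k by (simp add: distrib_right mult.assoc)
    also have "\<dots> = ennreal (2 * B\<^sup>2) * ennreal (t - s) + 2 * (\<integral>\<^sup>+r\<in>{s<..t}. \<psi> n r \<partial>lborel)"
      using st by (simp add: nn_integral_add nn_integral_cmult nn_integral_cmult_indicator)
    also have "\<dots> \<le> ennreal (2 * B\<^sup>2) * ennreal (t - s) + \<epsilon> n"
      unfolding \<epsilon>_def using st by (intro add_mono mult_left_mono nn_set_integral_set_mono) auto
    also have "ennreal (2 * B\<^sup>2) * ennreal (t - s) = ennreal (2 * B\<^sup>2 * (t - s))"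
      using st by (simp add: ennreal_mult)
    finally show ?thesis .
  qed
  have sT: "s \<in> {0..T}" "t \<in> {0..T}" using st by auto
  have [measurable]: "J s \<in> borel_measurable M" "J t \<in> borel_measurable M"
    using measurable_F_M ito_adapted[OF ito] sT by auto
  have \<tau>r: "\<tau> n j \<in> {0..T}" if "j \<le> k n" for n j
    using partition_mono[of "k n" "\<tau> n" 0 j] partition_mono[of "k n" "\<tau> n" j "k n"] \<tau> that by auto
  have Im [measurable]: "simple_integral W (k n) (\<tau> n) (\<lambda>j _. c n j) u \<in> borel_measurable M" if "u \<in> {0..T}" for n u
  proof -
    have "W (min (\<tau> n j) u) \<in> borel_measurable M" if "j \<le> k n" for j
      using bm_measurable[OF bm, of "min (\<tau> n j) u"] \<tau>r[of j n] that \<open>u \<in> {0..T}\<close> by auto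
    then show ?thesis unfolding simple_integral_def by (auto intro!: borel_measurable_sum borel_measurable_scaleR borel_measurable_diff)
  qed
  let ?I = "\<lambda>n u w. simple_integral W (k n) (\<tau> n) (\<lambda>j _. c n j) u w"
  have eq: "(\<Sum>j<k n. (W (\<rho> n (Suc j)) w - W (\<rho> n j) w) *\<^sub>R (c n j - v)) - (J t w - J s w - (W t w - W s w) *\<^sub>R v)
     = (?I n t w - J t w) + - (?I n s w - J s w)" for n w
  proof -
    have "(\<Sum>j<k n. (W (\<rho> n (Suc j)) w - W (\<rho> n j) w) *\<^sub>R v) = (\<Sum>j<k n. W (\<rho> n (Suc j)) w - W (\<rho> n j) w) *\<^sub>R v"
      by (simp add: scaleR_sum_left)
    also have "(\<Sum>j<k n. W (\<rho> n (Suc j)) w - W (\<rho> n j) w) = W t w - W s w"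
      using sum_lessThan_telescope[of "\<lambda>j. W (\<rho> n j) w" "k n"] by (simp add: \<rho>0 \<rho>k)
    finally have 1: "(\<Sum>j<k n. (W (\<rho> n (Suc j)) w - W (\<rho> n j) w) *\<^sub>R v) = (W t w - W s w) *\<^sub>R v" .
    have 2: "(\<Sum>j<k n. (W (\<rho> n (Suc j)) w - W (\<rho> n j) w) *\<^sub>R c n j) = ?I n t w - ?I n s w"
      using simple_integral_diff[OF st(1,2), of W "k n" "\<tau> n" "\<lambda>j _. c n j" w] by (simp add: \<rho>_def)
    have "(\<Sum>j<k n. (W (\<rho> n (Suc j)) w - W (\<rho> n j) w) *\<^sub>R (c n j - v)) = ?I n t w - ?I n s w - (W t w - W s w) *\<^sub>R v"
      unfolding 1[symmetric] 2[symmetric] sum_subtractf[symmetric] scaleR_diff_right ..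
    then show ?thesis by simp
  qed
  let ?R = "\<lambda>n. 2 * (\<integral>\<^sup>+w. ennreal ((norm (?I n t w - J t w))\<^sup>2) \<partial>M)
      + 2 * (\<integral>\<^sup>+w. ennreal ((norm (?I n s w - J s w))\<^sup>2) \<partial>M)"
  have le: "(\<integral>\<^sup>+w. ennreal ((norm ((\<Sum>j<k n. (W (\<rho> n (Suc j)) w - W (\<rho> n j) w) *\<^sub>R (c n j - v))
        - (J t w - J s w - (W t w - W s w) *\<^sub>R v)))\<^sup>2) \<partial>M) \<le> ?R n" for n
  proof -
    have "(\<integral>\<^sup>+w. ennreal ((norm ((\<Sum>j<k n. (W (\<rho> n (Suc j)) w - W (\<rho> n j) w) *\<^sub>R (c n j - v))
        - (J t w - J s w - (W t w - W s w) *\<^sub>R v)))\<^sup>2) \<partial>M)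
      \<le> (\<integral>\<^sup>+w. 2 * ennreal ((norm (?I n t w - J t w))\<^sup>2) + 2 * ennreal ((norm (?I n s w - J s w))\<^sup>2) \<partial>M)"
      unfolding eq
    proof (rule nn_integral_mono)
      fix w
      show "ennreal ((norm ((?I n t w - J t w) + - (?I n s w - J s w)))\<^sup>2)
        \<le> 2 * ennreal ((norm (?I n t w - J t w))\<^sup>2) + 2 * ennreal ((norm (?I n s w - J s w))\<^sup>2)"
        using ennreal_norm_add_sq_le[of "?I n t w - J t w" "- (?I n s w - J s w)"]
        by (simp only: norm_minus_cancel)
    qed
    also have "\<dots> = ?R n"
      using Im[OF sT(1)] Im[OF sT(2)] by (simp add: nn_integral_add nn_integral_cmult)
    finally show ?thesis .
  qed
  have "?R \<longlonglongrightarrow> 2 * 0 + 2 * 0"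
    by (intro tendsto_add ennreal_tendsto_cmult I sT) auto
  then have R0: "?R \<longlonglongrightarrow> 0" by simp
  show ?thesis
  proof (rule that[of \<rho> k "\<lambda>n j. c n j - v" \<epsilon>, OF \<rho>0 \<rho>k \<rho>m bound \<epsilon>0])
    show "(\<lambda>n. \<integral>\<^sup>+w. ennreal ((norm ((\<Sum>j<k n. (W (\<rho> n (Suc j)) w - W (\<rho> n j) w) *\<^sub>R (c n j - v))
        - (J t w - J s w - (W t w - W s w) *\<^sub>R v)))\<^sup>2) \<partial>M) \<longlonglongrightarrow> 0"
      by (rule tendsto_sandwich[OF _ _ tendsto_const R0]) (auto intro!: always_eventually le)
  qed
qed

text \<open>The approximating sums are Gaussian with explicit exponential moments, and Fatou's lemma
  along an almost surely convergent subsequence carries the bound to the limit. The factor 1/2 of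
  the Gaussian formula cancels the 2 in \<open>2 * B\<^sup>2 * (t - s)\<close>.\<close>

lemma ito_increment_exp_moment:
  fixes G :: "real \<Rightarrow> 'a::euclidean_space"
  assumes bm: "brownian_motion M F T W" and ito: "is_ito_integral M F T W (\<lambda>s _. G s) J"
    and G: "continuous_on {0..T} G" and st: "0 \<le> s" "s \<le> t" "t \<le> T"
    and v: "\<And>r. r \<in> {s..t} \<Longrightarrow> norm (G r - v) \<le> B"
  shows "(\<integral>\<^sup>+w. ennreal (exp ((J t w - J s w - (W t w - W s w) *\<^sub>R v) \<bullet> e)) \<partial>M)
     \<le> ennreal (exp ((norm e)\<^sup>2 * B\<^sup>2 * (t - s)))"
proof -
  obtain k :: "nat \<Rightarrow> nat" and \<rho> :: "nat \<Rightarrow> nat \<Rightarrow> real" and c :: "nat \<Rightarrow> nat \<Rightarrow> 'a" and \<epsilon> :: "nat \<Rightarrow> ennreal" where \<rho>: "\<And>n. \<rho> n 0 = s" "\<And>n. \<rho> n (k n) = t" "\<And>n j. j < k n \<Longrightarrow> \<rho> n j \<le> \<rho> n (Suc j)"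
    and bound: "\<And>n. ennreal (\<Sum>j<k n. (norm (c n j))\<^sup>2 * (\<rho> n (Suc j) - \<rho> n j)) \<le> ennreal (2 * B\<^sup>2 * (t - s)) + \<epsilon> n"
    and \<epsilon>0: "\<epsilon> \<longlonglongrightarrow> 0"
    and L2: "(\<lambda>n. \<integral>\<^sup>+w. ennreal ((norm ((\<Sum>j<k n. (W (\<rho> n (Suc j)) w - W (\<rho> n j) w) *\<^sub>R c n j)
        - (J t w - J s w - (W t w - W s w) *\<^sub>R v)))\<^sup>2) \<partial>M) \<longlonglongrightarrow> 0"
    by (rule ito_increment_approximation[OF bm ito G st, where v = v and B = B], erule v) (rule that; assumption)
   define D where "D w = J t w - J s w - (W t w - W s w) *\<^sub>R v" for w
  define S where "S n w = (\<Sum>j<k n. (W (\<rho> n (Suc j)) w - W (\<rho> n j) w) *\<^sub>R c n j)" for n w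
  have sT: "s \<in> {0..T}" "t \<in> {0..T}" using st by auto
  have \<rho>r: "\<rho> n j \<in> {0..T}" if "j \<le> k n" for n j
    using partition_mono[of "k n" "\<rho> n" 0 j] partition_mono[of "k n" "\<rho> n" j "k n"] \<rho> that st by auto
  have [measurable]: "J s \<in> borel_measurable M" "J t \<in> borel_measurable M" "W s \<in> borel_measurable M" "W t \<in> borel_measurable M"
    using measurable_F_M ito_adapted[OF ito] bm_measurable[OF bm] sT by auto
  have [measurable]: "D \<in> borel_measurable M" unfolding D_def by measurable
  have [measurable]: "S n \<in> borel_measurable M" for n
    unfolding S_def by (auto intro!: borel_measurable_sum borel_measurable_scaleR borel_measurable_diff bm_measurable[OF bm] \<rho>r)
  have L2': "(\<lambda>n. \<integral>\<^sup>+w. ennreal ((norm (S n w - D w))\<^sup>2) \<partial>M) \<longlonglongrightarrow> 0"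
    using L2 by (simp add: S_def D_def)
  have nm: "(\<lambda>w. (norm (S n w - D w))\<^sup>2) \<in> borel_measurable M" for n by measurable
  have nn: "0 \<le> (norm (S n w - D w))\<^sup>2" for n w by simp
  obtain r :: "nat \<Rightarrow> nat" where r: "strict_mono r" "AE w in M. (\<lambda>n. (norm (S (r n) w - D w))\<^sup>2) \<longlonglongrightarrow> 0"
    by (rule nn_integral_tendsto_0_AE_subseq[OF nm nn L2']) (rule that; assumption)
  have conv: "AE w in M. (\<lambda>n. ennreal (exp (S (r n) w \<bullet> e))) \<longlonglongrightarrow> ennreal (exp (D w \<bullet> e))"
    using r(2)
  proof eventually_elim
    case (elim w)
    have "(\<lambda>n. sqrt ((norm (S (r n) w - D w))\<^sup>2)) \<longlonglongrightarrow> sqrt 0"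
      by (rule tendsto_real_sqrt[OF elim])
    then have "(\<lambda>n. norm (S (r n) w - D w)) \<longlonglongrightarrow> 0"
      by (simp only: real_sqrt_abs abs_norm_cancel real_sqrt_zero)
    then have "(\<lambda>n. S (r n) w - D w) \<longlonglongrightarrow> 0" by (rule tendsto_norm_zero_cancel)
    then have "(\<lambda>n. S (r n) w) \<longlonglongrightarrow> D w" by (rule LIM_zero_cancel)
    then show ?case by (rule tendsto_ennrealI[OF tendsto_exp[OF tendsto_inner[OF _ tendsto_const]]])
  qed
  define b where "b n = (norm e)\<^sup>2 * (\<Sum>j<k n. (norm (c n j))\<^sup>2 * (\<rho> n (Suc j) - \<rho> n j)) / 2" for n
  have mgf: "(\<integral>\<^sup>+w. ennreal (exp (S n w \<bullet> e)) \<partial>M) \<le> ennreal (exp (b n))" for n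
  proof -
    have "0 \<le> \<rho> n 0" "\<rho> n (k n) \<le> T" using \<rho> st by auto
    note E = bm_sum_exp[where \<rho> = "\<rho> n" and k = "k n" and a = "\<lambda>j. c n j \<bullet> e",
      OF bm this(1) \<rho>(3) this(2), simplified]
    have eq: "S n w \<bullet> e = (\<Sum>j<k n. (c n j \<bullet> e) * (W (\<rho> n (Suc j)) w - W (\<rho> n j) w))" for w
      by (simp add: S_def inner_sum_left mult.commute)
    have "(\<integral>\<^sup>+w. ennreal (exp (S n w \<bullet> e)) \<partial>M) = ennreal (exp ((\<Sum>j<k n. (c n j \<bullet> e)\<^sup>2 * (\<rho> n (Suc j) - \<rho> n j)) / 2))"
      unfolding eq using E by (subst nn_integral_eq_integral) auto
    also have "\<dots> \<le> ennreal (exp (b n))"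
    proof -
      have "(c n j \<bullet> e)\<^sup>2 * (\<rho> n (Suc j) - \<rho> n j) \<le> (norm e)\<^sup>2 * ((norm (c n j))\<^sup>2 * (\<rho> n (Suc j) - \<rho> n j))" if "j < k n" for j
      proof -
        have *: "(c n j \<bullet> e)\<^sup>2 \<le> (norm e)\<^sup>2 * (norm (c n j))\<^sup>2"
          using Cauchy_Schwarz_ineq[of "c n j" e] by (simp add: power2_norm_eq_inner mult.commute)
        show ?thesis
          using mult_right_mono[OF *, of "\<rho> n (Suc j) - \<rho> n j"] \<rho>(3)[OF that] by (simp add: mult.assoc)
      qed
      then have "(\<Sum>j<k n. (c n j \<bullet> e)\<^sup>2 * (\<rho> n (Suc j) - \<rho> n j))
          \<le> (\<Sum>j<k n. (norm e)\<^sup>2 * ((norm (c n j))\<^sup>2 * (\<rho> n (Suc j) - \<rho> n j)))"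
        by (intro sum_mono) auto
      then show ?thesis by (intro ennreal_leI) (simp add: b_def sum_distrib_left)
    qed
    finally show ?thesis .
  qed
  have key: "(\<integral>\<^sup>+w. ennreal (exp (D w \<bullet> e)) \<partial>M) \<le> ennreal (exp ((norm e)\<^sup>2 * (2 * B\<^sup>2 * (t - s) + \<delta>) / 2))" if \<delta>: "0 < \<delta>" for \<delta>
  proof -
    have "\<forall>\<^sub>F n in sequentially. \<epsilon> n < ennreal \<delta>"
      using \<epsilon>0 by (rule order_tendstoD) (use \<delta> in simp)
    then have "\<forall>\<^sub>F n in sequentially. \<epsilon> (r n) < ennreal \<delta>"
      using r(1) by (rule eventually_subseq[rotated])
    then have ev: "\<forall>\<^sub>F n in sequentially. (\<integral>\<^sup>+w. ennreal (exp (S (r n) w \<bullet> e)) \<partial>M)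
       \<le> ennreal (exp ((norm e)\<^sup>2 * (2 * B\<^sup>2 * (t - s) + \<delta>) / 2))"
    proof eventually_elim
      case (elim n)
      let ?s = "\<Sum>j<k (r n). (norm (c (r n) j))\<^sup>2 * (\<rho> (r n) (Suc j) - \<rho> (r n) j)"
      have "ennreal ?s \<le> ennreal (2 * B\<^sup>2 * (t - s)) + ennreal \<delta>"
        by (rule order_trans[OF bound add_left_mono[OF less_imp_le[OF elim]]])
      also have "\<dots> = ennreal (2 * B\<^sup>2 * (t - s) + \<delta>)" using \<delta> st by simp
      finally have "?s \<le> 2 * B\<^sup>2 * (t - s) + \<delta>" using \<delta> st by (subst (asm) ennreal_le_iff) auto
      then have "b (r n) \<le> (norm e)\<^sup>2 * (2 * B\<^sup>2 * (t - s) + \<delta>) / 2"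
        unfolding b_def by (intro divide_right_mono mult_left_mono) auto
      then show ?case by (intro order_trans[OF mgf] ennreal_leI) simp
    qed
    \<comment> \<open>Fatou's lemma. The slack \<open>\<delta>\<close> absorbs the vanishing error
      of the variances and is removed afterwards by letting it tend to 0.\<close>
    have "(\<integral>\<^sup>+w. ennreal (exp (D w \<bullet> e)) \<partial>M) = (\<integral>\<^sup>+w. liminf (\<lambda>n. ennreal (exp (S (r n) w \<bullet> e))) \<partial>M)"
      by (rule nn_integral_cong_AE, use conv in eventually_elim)
        (rule lim_imp_Liminf[symmetric, OF trivial_limit_sequentially])
    also have "\<dots> \<le> liminf (\<lambda>n. \<integral>\<^sup>+w. ennreal (exp (S (r n) w \<bullet> e)) \<partial>M)"
      by (rule nn_integral_liminf) measurable
    also have "\<dots> \<le> limsup (\<lambda>n. \<integral>\<^sup>+w. ennreal (exp (S (r n) w \<bullet> e)) \<partial>M)"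
      by (rule Liminf_le_Limsup) simp
    also have "\<dots> \<le> ennreal (exp ((norm e)\<^sup>2 * (2 * B\<^sup>2 * (t - s) + \<delta>) / 2))"
      using ev by (rule Limsup_bounded)
    finally show ?thesis .
  qed
  have "isCont (\<lambda>\<delta>. exp ((norm e)\<^sup>2 * (2 * B\<^sup>2 * (t - s) + \<delta>) / 2)) 0"
    by (intro continuous_intros) simp
  from ennreal_le_at_right_limit[OF this key]
  have "(\<integral>\<^sup>+w. ennreal (exp (D w \<bullet> e)) \<partial>M) \<le> ennreal (exp ((norm e)\<^sup>2 * (2 * B\<^sup>2 * (t - s) + 0) / 2))" .
  then show ?thesis by (simp add: D_def mult.assoc)
qed

text \<open>The order of the quantifiers matters: \<open>C\<close> depends on \<open>r\<close> and
  the dimension only, so that later estimates are uniform in the interval and in the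
  integrand.\<close>

lemma ito_increment_moment:
  fixes r :: real
  assumes r: "0 \<le> r"
  obtains C where "0 < C"
    "\<And>W G J s t v B. brownian_motion M F T W \<Longrightarrow> is_ito_integral M F T W (\<lambda>s _. G s :: 'a::euclidean_space) J \<Longrightarrow>
      continuous_on {0..T} G \<Longrightarrow> 0 \<le> s \<Longrightarrow> s < t \<Longrightarrow> t \<le> T \<Longrightarrow> 0 < B \<Longrightarrow>
      \<forall>u\<in>{s..t}. norm (G u - v) \<le> B \<Longrightarrow>
      (\<integral>\<^sup>+w. ennreal (norm (J t w - J s w - (W t w - W s w) *\<^sub>R v) powr r) \<partial>M)
        \<le> ennreal (C * (B * sqrt (t - s)) powr r)"
proof -
  obtain c where c: "0 < c" "\<And>x. \<bar>x\<bar> powr r \<le> c * (exp x + exp (- x))"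
    using abs_powr_le_exp[OF r] by blast
  define C where "C = real DIM('a) powr r * (real DIM('a) * (c * (2 * exp 1)))"
  show ?thesis
  proof (rule that)
    show "0 < C" using c by (simp add: C_def)
    fix W and G :: "real \<Rightarrow> 'a" and J s t v and B :: real
    assume bm: "brownian_motion M F T W" and ito: "is_ito_integral M F T W (\<lambda>s _. G s) J"
      and G: "continuous_on {0..T} G" and st: "0 \<le> s" "s < t" "t \<le> T" and B: "0 < B"
      and v: "\<forall>u\<in>{s..t}. norm (G u - v) \<le> B"
    define D where "D w = J t w - J s w - (W t w - W s w) *\<^sub>R v" for w
    \<comment> \<open>The natural scale of the increment: divided by \<open>l\<close>, its
      exponential moments in unit directions are at most \<open>exp 1\<close>.\<close>
    define l where "l = B * sqrt (t - s)"
    have l: "0 < l" using B st by (simp add: l_def)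
    have sT: "s \<in> {0..T}" "t \<in> {0..T}" using st by auto
    have [measurable]: "J s \<in> borel_measurable M" "J t \<in> borel_measurable M" "W s \<in> borel_measurable M" "W t \<in> borel_measurable M"
      using measurable_F_M ito_adapted[OF ito] bm_measurable[OF bm] sT by auto
    have [measurable]: "D \<in> borel_measurable M" unfolding D_def by measurable
    have e: "(\<integral>\<^sup>+w. ennreal (exp ((D w \<bullet> u) / l)) \<partial>M) \<le> ennreal (exp 1)" if u: "norm u = 1" for u
    proof -
      have "l\<^sup>2 = B\<^sup>2 * (t - s)" using st by (simp add: l_def power_mult_distrib)
      then have "(norm (u /\<^sub>R l))\<^sup>2 * B\<^sup>2 * (t - s) = 1"
        using l u st B by (simp add: power_divide divide_simps)
      moreover have "(\<integral>\<^sup>+w. ennreal (exp ((J t w - J s w - (W t w - W s w) *\<^sub>R v) \<bullet> (u /\<^sub>R l))) \<partial>M)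
          \<le> ennreal (exp ((norm (u /\<^sub>R l))\<^sup>2 * B\<^sup>2 * (t - s)))"
        by (rule ito_increment_exp_moment[OF bm ito G st(1) less_imp_le[OF st(2)] st(3)]) (rule bspec[OF v])
      ultimately show ?thesis
        by (simp add: D_def[symmetric] divide_inverse mult.commute)
    qed
    have "(norm (D w) / l) powr r \<le> real DIM('a) powr r * (\<Sum>u\<in>(Basis::'a set). c * (exp ((D w \<bullet> u) / l) + exp ((D w \<bullet> - u) / l)))" for w
    proof -
      have "(norm (D w) / l) powr r = norm (D w /\<^sub>R l) powr r" using l by (simp add: divide_inverse mult.commute)
      also have "\<dots> \<le> real DIM('a) powr r * (\<Sum>u\<in>(Basis::'a set). \<bar>(D w /\<^sub>R l) \<bullet> u\<bar> powr r)"
        by (rule norm_powr_le_sum_Basis[OF r])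
      also have "\<dots> \<le> real DIM('a) powr r * (\<Sum>u\<in>(Basis::'a set). c * (exp ((D w \<bullet> u) / l) + exp ((D w \<bullet> - u) / l)))"
        using c(1) by (intro mult_left_mono sum_mono order_trans[OF c(2)]) (auto simp: divide_inverse mult.commute)
      finally show ?thesis .
    qed
    then have "(\<integral>\<^sup>+w. ennreal ((norm (D w) / l) powr r) \<partial>M)
      \<le> (\<integral>\<^sup>+w. ennreal (real DIM('a) powr r) * (\<Sum>u\<in>(Basis::'a set). ennreal c * (ennreal (exp ((D w \<bullet> u) / l)) + ennreal (exp ((D w \<bullet> - u) / l)))) \<partial>M)"
      using c(1) by (intro nn_integral_mono) (simp add: ennreal_mult[symmetric] ennreal_plus[symmetric] sum_ennreal sum_nonneg
          del: ennreal_plus)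
    also have "\<dots> = ennreal (real DIM('a) powr r) * (\<Sum>u\<in>(Basis::'a set). ennreal c *
        ((\<integral>\<^sup>+w. ennreal (exp ((D w \<bullet> u) / l)) \<partial>M) + (\<integral>\<^sup>+w. ennreal (exp ((D w \<bullet> - u) / l)) \<partial>M)))"
      by (simp add: nn_integral_cmult nn_integral_sum nn_integral_add)
    also have "\<dots> \<le> ennreal (real DIM('a) powr r) * (\<Sum>u\<in>(Basis::'a set). ennreal c * (ennreal (exp 1) + ennreal (exp 1)))"
      by (intro mult_left_mono sum_mono add_mono e) auto
    also have "\<dots> = ennreal C"
      using c(1) by (simp add: C_def ennreal_mult[symmetric] ennreal_plus[symmetric] ennreal_of_nat_eq_real_of_nat
          del: ennreal_plus)
    finally have n: "(\<integral>\<^sup>+w. ennreal ((norm (D w) / l) powr r) \<partial>M) \<le> ennreal C" .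
    have "(\<integral>\<^sup>+w. ennreal (norm (D w) powr r) \<partial>M) = (\<integral>\<^sup>+w. ennreal (l powr r) * ennreal ((norm (D w) / l) powr r) \<partial>M)"
      using l by (intro nn_integral_cong) (simp add: ennreal_mult[symmetric] powr_divide)
    also have "\<dots> = ennreal (l powr r) * (\<integral>\<^sup>+w. ennreal ((norm (D w) / l) powr r) \<partial>M)"
      by (rule nn_integral_cmult) measurable
    also have "\<dots> \<le> ennreal (l powr r) * ennreal C" by (intro mult_left_mono n) auto
    also have "\<dots> = ennreal (C * l powr r)" using \<open>0 < C\<close> by (simp add: ennreal_mult mult.commute)
    finally show "(\<integral>\<^sup>+w. ennreal (norm (J t w - J s w - (W t w - W s w) *\<^sub>R v) powr r) \<partial>M)
        \<le> ennreal (C * (B * sqrt (t - s)) powr r)"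
      by (simp add: D_def l_def)
  qed
qed

end

lemma self_le_one_plus_square: "(x::real) \<le> 1 + x\<^sup>2"
proof -
  have "2 * x \<le> 1 + x\<^sup>2" using sum_squares_bound[of 1 x] by simp
  then show ?thesis using zero_le_power2[of x] by linarith
qed

context usual_filtered_prob_space
begin

lemma integrable_norm_sq:
  fixes Y :: "'w \<Rightarrow> 'a::euclidean_space"
  assumes [measurable]: "Y \<in> borel_measurable M"
    and "(\<integral>\<^sup>+w. ennreal ((norm (Y w))\<^sup>2) \<partial>M) \<le> ennreal C"
  shows "integrable M (\<lambda>w. (norm (Y w))\<^sup>2)"
  by (rule integrableI_bounded) (use assms(2) in \<open>auto simp: le_less_trans\<close>)

lemma integrable_norm_sq_imp_integrable:
  fixes Y :: "'w \<Rightarrow> 'a::euclidean_space"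
  assumes [measurable]: "Y \<in> borel_measurable M" and "integrable M (\<lambda>w. (norm (Y w))\<^sup>2)"
  shows "integrable M Y"
proof (rule Bochner_Integration.integrable_bound)
  show "integrable M (\<lambda>w. 1 + (norm (Y w))\<^sup>2)" using assms(2) by simp
  show "AE w in M. norm (Y w) \<le> norm (1 + (norm (Y w))\<^sup>2)"
  proof (rule AE_I2)
    fix w
    show "norm (Y w) \<le> norm (1 + (norm (Y w))\<^sup>2)" using self_le_one_plus_square[of "norm (Y w)"] by simp
  qed
qed simp

lemma ito_increment_integrable:
  fixes G :: "real \<Rightarrow> 'a::euclidean_space"
  assumes bm: "brownian_motion M F T W" and ito: "is_ito_integral M F T W (\<lambda>s _. G s) J"
    and G: "continuous_on {0..T} G" and st: "0 \<le> s" "s \<le> t" "t \<le> T"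
  shows "integrable M (\<lambda>w. J t w - J s w)"
proof (cases "s = t")
  case False
  then have "s < t" using st by simp
  have "bounded (G ` {0..T})" by (intro compact_imp_bounded compact_continuous_image G) auto
  then obtain B where "0 < B" and B: "\<And>r. r \<in> {0..T} \<Longrightarrow> norm (G r) \<le> B"
    by (metis bounded_pos image_eqI)
  have v: "\<forall>r\<in>{s..t}. norm (G r - 0) \<le> B" using B st by simp
  obtain C where C: "0 < C"
    "\<And>W G J s t v B. brownian_motion M F T W \<Longrightarrow> is_ito_integral M F T W (\<lambda>s _. G s :: 'a) J \<Longrightarrow>
      continuous_on {0..T} G \<Longrightarrow> 0 \<le> s \<Longrightarrow> s < t \<Longrightarrow> t \<le> T \<Longrightarrow> 0 < B \<Longrightarrow>
      \<forall>u\<in>{s..t}. norm (G u - v) \<le> B \<Longrightarrow>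
      (\<integral>\<^sup>+w. ennreal (norm (J t w - J s w - (W t w - W s w) *\<^sub>R v) powr 2) \<partial>M)
        \<le> ennreal (C * (B * sqrt (t - s)) powr 2)"
    by (rule ito_increment_moment[OF zero_le_numeral[of "num.Bit0 num.One"]]) (rule that; assumption)
  have n: "(\<integral>\<^sup>+w. ennreal ((norm (J t w - J s w))\<^sup>2) \<partial>M) \<le> ennreal (C * (B * sqrt (t - s)) powr 2)"
    using C(2)[OF bm ito G st(1) \<open>s < t\<close> st(3) \<open>0 < B\<close> v] by simp
  have "s \<in> {0..T}" "t \<in> {0..T}" using st by auto
  then have m: "(\<lambda>w. J t w - J s w) \<in> borel_measurable M"
    using measurable_F_M ito_adapted[OF ito] by (intro borel_measurable_diff) blast+
  show ?thesis
    by (rule integrable_norm_sq_imp_integrable[OF m integrable_norm_sq[OF m n]])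
qed simp

text \<open>The martingale property. All cells of the approximating sums begin at or after
  \<open>s\<close>, so the indicator of \<open>A\<close> is measurable at each left end point and
  every summand has mean zero; this passes to the L^1 limit.\<close>

lemma ito_increment_mean:
  fixes G :: "real \<Rightarrow> 'a::euclidean_space"
  assumes bm: "brownian_motion M F T W" and ito: "is_ito_integral M F T W (\<lambda>s _. G s) J"
    and G: "continuous_on {0..T} G" and st: "0 \<le> s" "s \<le> t" "t \<le> T"
    and A: "A \<in> sets (F s)"
  shows "(\<integral>w. indicator A w *\<^sub>R (J t w - J s w) \<partial>M) = 0"
proof -
  have "bounded (G ` {0..T})" by (intro compact_imp_bounded compact_continuous_image G) auto
  then obtain B where B: "\<And>r. r \<in> {0..T} \<Longrightarrow> norm (G r) \<le> B" by (meson bounded_iff image_eqI)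
  define v where "v = (0::'a)"
  have v: "\<And>r. r \<in> {s..t} \<Longrightarrow> norm (G r - v) \<le> B" using B st by (simp add: v_def)
  obtain k :: "nat \<Rightarrow> nat" and \<rho> :: "nat \<Rightarrow> nat \<Rightarrow> real" and c :: "nat \<Rightarrow> nat \<Rightarrow> 'a" and \<epsilon> :: "nat \<Rightarrow> ennreal"
    where \<rho>: "\<And>n. \<rho> n 0 = s" "\<And>n. \<rho> n (k n) = t" "\<And>n j. j < k n \<Longrightarrow> \<rho> n j \<le> \<rho> n (Suc j)"
    and "\<And>n. ennreal (\<Sum>j<k n. (norm (c n j))\<^sup>2 * (\<rho> n (Suc j) - \<rho> n j)) \<le> ennreal (2 * B\<^sup>2 * (t - s)) + \<epsilon> n"
    and "\<epsilon> \<longlonglongrightarrow> 0"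
    and L2: "(\<lambda>n. \<integral>\<^sup>+w. ennreal ((norm ((\<Sum>j<k n. (W (\<rho> n (Suc j)) w - W (\<rho> n j) w) *\<^sub>R c n j)
        - (J t w - J s w - (W t w - W s w) *\<^sub>R v)))\<^sup>2) \<partial>M) \<longlonglongrightarrow> 0"
    by (rule ito_increment_approximation[OF bm ito G st, where v = v and B = B], erule v) (rule that; assumption)
  define D where "D w = J t w - J s w" for w
  define S where "S n w = (\<Sum>j<k n. (W (\<rho> n (Suc j)) w - W (\<rho> n j) w) *\<^sub>R c n j)" for n w
  have sT: "s \<in> {0..T}" "t \<in> {0..T}" using st by auto
  have AM [measurable]: "A \<in> sets M" by (rule sets_F_M[OF sT(1) A])
  have \<rho>r: "s \<le> \<rho> n j \<and> \<rho> n j \<in> {0..T}" if "j \<le> k n" for n j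
    using partition_mono[of "k n" "\<rho> n" 0 j] partition_mono[of "k n" "\<rho> n" j "k n"] \<rho> that st by auto
  have L2': "(\<lambda>n. \<integral>\<^sup>+w. ennreal ((norm (S n w - D w))\<^sup>2) \<partial>M) \<longlonglongrightarrow> 0"
    using L2 by (simp add: S_def D_def v_def)
  have [measurable]: "D \<in> borel_measurable M" and Dint: "integrable M D"
    using ito_increment_integrable[OF bm ito G st] by (auto simp: D_def[abs_def])
  have Sint: "integrable M (\<lambda>w. indicator A w *\<^sub>R S n w)" and S0: "(\<integral>w. indicator A w *\<^sub>R S n w \<partial>M) = 0"
    and [measurable]: "S n \<in> borel_measurable M" for n
  proof -
    have *: "integrable M (\<lambda>w. (indicator A w * (W (\<rho> n (Suc j)) w - W (\<rho> n j) w)) *\<^sub>R c n j)"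
       "(\<integral>w. (indicator A w * (W (\<rho> n (Suc j)) w - W (\<rho> n j) w)) *\<^sub>R c n j \<partial>M) = 0" if j: "j < k n" for j
    proof -
      have r: "s \<le> \<rho> n j" "0 \<le> \<rho> n j" "\<rho> n j \<le> \<rho> n (Suc j)" "\<rho> n (Suc j) \<le> T"
        using \<rho>(3)[OF j] \<rho>r[of j n] \<rho>r[of "Suc j" n] j by auto
      have "A \<in> sets (F (\<rho> n j))" using F_mono[of s "\<rho> n j"] r st A by auto
      then have "indicator A \<in> borel_measurable (F (\<rho> n j))" by simp
      from bm_increment_mult(1,2)[OF bm r(2-4) this] 
      show "integrable M (\<lambda>w. (indicator A w * (W (\<rho> n (Suc j)) w - W (\<rho> n j) w)) *\<^sub>R c n j)"
       "(\<integral>w. (indicator A w * (W (\<rho> n (Suc j)) w - W (\<rho> n j) w)) *\<^sub>R c n j \<partial>M) = 0"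
        by (auto simp: emeasure_eq_measure)
    qed
    have eq: "indicator A w *\<^sub>R S n w = (\<Sum>j<k n. (indicator A w * (W (\<rho> n (Suc j)) w - W (\<rho> n j) w)) *\<^sub>R c n j)" for w
      by (simp add: S_def scaleR_sum_right)
    show "integrable M (\<lambda>w. indicator A w *\<^sub>R S n w)" unfolding eq using * by auto
    show "(\<integral>w. indicator A w *\<^sub>R S n w \<partial>M) = 0" unfolding eq using * by (subst Bochner_Integration.integral_sum) auto
    show "S n \<in> borel_measurable M"
      unfolding S_def using \<rho>r by (auto intro!: borel_measurable_sum borel_measurable_scaleR borel_measurable_diff bm_measurable[OF bm])
  qed
  have key: "norm (\<integral>w. indicator A w *\<^sub>R D w \<partial>M) \<le> 2 * \<delta>" if \<delta>: "0 < \<delta>" for \<delta>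
  proof -
    have "\<forall>\<^sub>F n in sequentially. (\<integral>\<^sup>+w. ennreal ((norm (S n w - D w))\<^sup>2) \<partial>M) < ennreal (\<delta>\<^sup>2)"
      using L2' by (rule order_tendstoD) (use \<delta> in simp)
    then obtain n where n: "(\<integral>\<^sup>+w. ennreal ((norm (S n w - D w))\<^sup>2) \<partial>M) < ennreal (\<delta>\<^sup>2)"
      by (auto simp: eventually_sequentially)
    have i2: "integrable M (\<lambda>w. (norm (S n w - D w))\<^sup>2)"
      by (rule integrableI_bounded) (use n in \<open>auto intro: less_trans\<close>)
    have E: "expectation (\<lambda>w. (norm (S n w - D w))\<^sup>2) \<le> \<delta>\<^sup>2"
      using n nn_integral_eq_integral[OF i2] by (simp add: ennreal_less_iff)
    have i3: "integrable M (\<lambda>w. indicator A w *\<^sub>R D w)"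
      using Dint by (intro integrable_mult_indicator) auto
    have i4: "integrable M (\<lambda>w. indicator A w *\<^sub>R D w - indicator A w *\<^sub>R S n w)" using i3 Sint by auto
    have "norm (\<integral>w. indicator A w *\<^sub>R D w \<partial>M) = norm (\<integral>w. indicator A w *\<^sub>R D w - indicator A w *\<^sub>R S n w \<partial>M)"
      using i3 Sint S0 by simp
    also have "\<dots> \<le> (\<integral>w. norm (indicator A w *\<^sub>R D w - indicator A w *\<^sub>R S n w) \<partial>M)"
      by (rule integral_norm_bound)
    \<comment> \<open>The elementary bound \<open>x \<le> \<delta> + x\<^sup>2 / \<delta>\<close>
      does the work of the Cauchy-Schwarz inequality in the passage from L^2 to L^1.\<close>
    also have "\<dots> \<le> (\<integral>w. \<delta> + (norm (S n w - D w))\<^sup>2 / \<delta> \<partial>M)"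
    proof (rule integral_mono)
      show "integrable M (\<lambda>w. norm (indicator A w *\<^sub>R D w - indicator A w *\<^sub>R S n w))" using i4 by simp
      show "integrable M (\<lambda>w. \<delta> + (norm (S n w - D w))\<^sup>2 / \<delta>)" using i2 by simp
      fix w
      have "norm (indicator A w *\<^sub>R D w - indicator A w *\<^sub>R S n w) \<le> norm (S n w - D w)"
        by (auto simp: indicator_def norm_minus_commute)
      also have "\<dots> \<le> \<delta> + (norm (S n w - D w))\<^sup>2 / \<delta>"
      proof -
        have "norm (S n w - D w) * \<delta> \<le> \<delta>\<^sup>2 + (norm (S n w - D w))\<^sup>2"
          using sum_squares_bound[of \<delta> "norm (S n w - D w)"]
            mult_nonneg_nonneg[OF less_imp_le[OF \<delta>] norm_ge_zero[of "S n w - D w"]]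
          by (simp add: mult.commute)
        then show ?thesis using \<delta> by (simp add: field_simps power2_eq_square)
      qed
      finally show "norm (indicator A w *\<^sub>R D w - indicator A w *\<^sub>R S n w) \<le> \<delta> + (norm (S n w - D w))\<^sup>2 / \<delta>" .
    qed
    also have "\<dots> = \<delta> + expectation (\<lambda>w. (norm (S n w - D w))\<^sup>2) / \<delta>"
      using i2 by (simp add: prob_space)
    also have "\<dots> \<le> \<delta> + \<delta>\<^sup>2 / \<delta>" using E \<delta> by (intro add_left_mono divide_right_mono) auto
    also have "\<dots> = 2 * \<delta>" using \<delta> by (simp add: power2_eq_square)
    finally show ?thesis .
  qed
  have "norm (\<integral>w. indicator A w *\<^sub>R D w \<partial>M) \<le> 0"
  proof (rule field_le_epsilon)
    fix e :: real assume "0 < e"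
    then show "norm (\<integral>w. indicator A w *\<^sub>R D w \<partial>M) \<le> 0 + e" using key[of "e/2"] by simp
  qed
  then show ?thesis by (simp add: D_def)
qed

end

section \<open>Pathwise estimates\<close>

text \<open>Evaluating the process at the time rounded down to a multiple of
  \<open>1 / Suc n\<close> gives countably many pieces, each measurable in the pair, and continuity
  of the paths gives the limit. Joint measurability is what Fubini requires later.\<close>

lemma borel_measurable_continuous_process:
  fixes Y :: "real \<Rightarrow> 'w \<Rightarrow> 'a::metric_space"
  assumes m: "\<And>t. Y t \<in> borel_measurable M"
    and c: "\<And>w. w \<in> space M \<Longrightarrow> continuous_on UNIV (\<lambda>t. Y t w)"
  shows "(\<lambda>(t, w). Y t w) \<in> borel_measurable (borel \<Otimes>\<^sub>M M)"
proof -
  define Z where "Z n x = Y (of_int \<lfloor>real (Suc n) * fst x\<rfloor> / real (Suc n)) (snd x)" for n and x :: "real \<times> 'w"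
  have Zm: "Z n \<in> borel_measurable (borel \<Otimes>\<^sub>M M)" for n
  proof -
    have 1: "(\<lambda>x. Y (of_int i / real (Suc n)) (snd x)) \<in> borel_measurable (borel \<Otimes>\<^sub>M M)" for i :: int
      using m by (rule measurable_compose[OF measurable_snd])
    have 2: "(\<lambda>x. \<lfloor>real (Suc n) * fst x\<rfloor>) \<in> measurable (borel \<Otimes>\<^sub>M M) (count_space UNIV)"
      by measurable
    show ?thesis unfolding Z_def by (rule measurable_compose_countable[OF 1 2])
  qed
  have floor_lim: "(\<lambda>n. of_int \<lfloor>real (Suc n) * t\<rfloor> / real (Suc n)) \<longlonglongrightarrow> t" for t :: real
  proof (rule tendsto_sandwich)
    show "(\<lambda>n. t - 1 / real (Suc n)) \<longlonglongrightarrow> t"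
      using tendsto_diff[OF tendsto_const[of t] LIMSEQ_inverse_real_of_nat] by (simp add: divide_inverse)
    show "(\<lambda>n. t) \<longlonglongrightarrow> t" by simp
    show "\<forall>\<^sub>F n in sequentially. of_int \<lfloor>real (Suc n) * t\<rfloor> / real (Suc n) \<le> t"
      by (intro always_eventually allI) (simp add: divide_le_eq mult.commute del: of_nat_Suc)
    show "\<forall>\<^sub>F n in sequentially. t - 1 / real (Suc n) \<le> of_int \<lfloor>real (Suc n) * t\<rfloor> / real (Suc n)"
    proof (intro always_eventually allI)
      fix n
      have "real (Suc n) * t - 1 \<le> of_int \<lfloor>real (Suc n) * t\<rfloor>" by linarith
      then have "(real (Suc n) * t - 1) / real (Suc n) \<le> of_int \<lfloor>real (Suc n) * t\<rfloor> / real (Suc n)"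
        by (rule divide_right_mono) simp
      then show "t - 1 / real (Suc n) \<le> of_int \<lfloor>real (Suc n) * t\<rfloor> / real (Suc n)"
        by (simp add: diff_divide_distrib del: of_nat_Suc)
    qed
  qed
  show ?thesis
  proof (rule borel_measurable_LIMSEQ_metric[OF Zm])
    fix x :: "real \<times> 'w" assume x: "x \<in> space (borel \<Otimes>\<^sub>M M)"
    obtain t w where x_eq: "x = (t, w)" by (cases x)
    then have "w \<in> space M" using x by (simp add: space_pair_measure)
    then have "isCont (\<lambda>t. Y t w) t" using c by (simp add: continuous_on_eq_continuous_at)
    then show "(\<lambda>n. Z n x) \<longlonglongrightarrow> (case x of (t, w) \<Rightarrow> Y t w)"
      unfolding Z_def x_eq using isCont_tendsto_compose[OF _ floor_lim] by simp
  qed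
qed

lemma nn_integral_eq_integral_Icc:
  fixes h :: "real \<Rightarrow> real"
  assumes "continuous_on {s..t} h" "\<And>r. r \<in> {s..t} \<Longrightarrow> 0 \<le> h r"
  shows "(\<integral>\<^sup>+r\<in>{s..t}. ennreal (h r) \<partial>lborel) = ennreal (integral {s..t} h)"
proof -
  have i: "set_integrable lborel {s..t} h" by (rule borel_integrable_atLeastAtMost'[OF assms(1)])
  have "(\<integral>\<^sup>+r\<in>{s..t}. ennreal (h r) \<partial>lborel) = (\<integral>\<^sup>+r. ennreal (indicator {s..t} r * h r) \<partial>lborel)"
    by (rule nn_integral_cong) (auto simp: indicator_def)
  also have "\<dots> = ennreal (LINT r|lborel. indicator {s..t} r * h r)"
    using i assms(2) unfolding set_integrable_def
    by (intro nn_integral_eq_integral) (auto intro!: AE_I2 simp: indicator_def)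
  also have "\<dots> = ennreal (integral {s..t} h)"
    using set_borel_integral_eq_integral(2)[OF i] by (simp add: set_lebesgue_integral_def)
  finally show ?thesis .
qed

text \<open>Convexity yields the tangent inequality on the open half-line; the point
  \<open>x = 0\<close> is checked directly. Integrating it with tangent point at the mean value
  proves Jensen's inequality below.\<close>

lemma powr_tangent:
  fixes a x \<rho> :: real
  assumes "0 < a" "0 \<le> x" "1 \<le> \<rho>"
  shows "a powr \<rho> + \<rho> * a powr (\<rho> - 1) * (x - a) \<le> x powr \<rho>"
proof (cases "x = 0")
  case True
  have "a powr \<rho> = a powr (\<rho> - 1) * a" using assms powr_mult_base[of a "\<rho> - 1"] by (simp add: mult.commute)
  moreover have "(1 - \<rho>) * (a powr (\<rho> - 1) * a) \<le> 0" using assms by (intro mult_nonpos_nonneg) auto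
  ultimately show ?thesis using True by (simp add: algebra_simps)
next
  case False
  have "x powr \<rho> - a powr \<rho> \<ge> (\<rho> * a powr (\<rho> - 1)) * (x - a)"
  proof (rule convex_on_imp_above_tangent)
    show "convex_on {0<..} (\<lambda>x. x powr \<rho>)" by (rule powr_convex) fact
    show "connected {0::real<..}" by simp
    show "a \<in> interior {0<..}" using assms by (simp add: interior_open)
    show "x \<in> {0<..}" using assms False by simp
    show "((\<lambda>x. x powr \<rho>) has_field_derivative \<rho> * a powr (\<rho> - 1)) (at a within {0<..})"
      using assms by (auto intro!: derivative_eq_intros)
  qed
  then show ?thesis by simp
qed

text \<open>Jensen's inequality for the average over \<open>{s..t}\<close>: in the integrated
  tangent inequality at the mean value \<open>a\<close>, the linear term vanishes.\<close>

lemma integral_powr_le: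
  fixes k :: "real \<Rightarrow> real"
  assumes st: "s < t" and k: "continuous_on {s..t} k" "\<And>r. r \<in> {s..t} \<Longrightarrow> 0 \<le> k r" and \<rho>: "1 \<le> \<rho>"
  shows "integral {s..t} k powr \<rho> \<le> (t - s) powr (\<rho> - 1) * integral {s..t} (\<lambda>r. k r powr \<rho>)"
proof -
  define a where "a = integral {s..t} k / (t - s)"
  have kp: "continuous_on {s..t} (\<lambda>r. k r powr \<rho>)"
    by (rule continuous_on_powr') (use k \<rho> in \<open>auto intro: continuous_on_const\<close>)
  have ki: "k integrable_on {s..t}" by (rule integrable_continuous_real[OF k(1)])
  have kpi: "(\<lambda>r. k r powr \<rho>) integrable_on {s..t}" by (rule integrable_continuous_real[OF kp])
  have a0: "0 \<le> a" unfolding a_def using st k(2) by (intro divide_nonneg_pos integral_nonneg ki) auto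
  have P0: "0 \<le> integral {s..t} (\<lambda>r. k r powr \<rho>)" by (intro integral_nonneg kpi) auto
  show ?thesis
  proof (cases "a = 0")
    case True
    then have "integral {s..t} k = 0" using st by (simp add: a_def)
    then show ?thesis using P0 by simp
  next
    case False
    then have a: "0 < a" using a0 by simp
    have int: "integral {s..t} k = (t - s) * a" using st by (simp add: a_def)
    have "((\<lambda>r. a powr \<rho> + \<rho> * a powr (\<rho> - 1) * (k r - a)) has_integral
        (t - s) *\<^sub>R (a powr \<rho>) + \<rho> * a powr (\<rho> - 1) * (integral {s..t} k - (t - s) *\<^sub>R a)) {s..t}"
      using st has_integral_const_real[of "a powr \<rho>" s t] has_integral_const_real[of a s t]
      by (intro has_integral_add has_integral_mult_right has_integral_diff integrable_integral ki) auto
    moreover have "((\<lambda>r. k r powr \<rho>) has_integral integral {s..t} (\<lambda>r. k r powr \<rho>)) {s..t}"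
      by (rule integrable_integral[OF kpi])
    ultimately have "(t - s) *\<^sub>R (a powr \<rho>) + \<rho> * a powr (\<rho> - 1) * (integral {s..t} k - (t - s) *\<^sub>R a)
        \<le> integral {s..t} (\<lambda>r. k r powr \<rho>)"
      by (rule has_integral_le) (use powr_tangent[OF a _ \<rho>] k(2) in auto)
    then have 1: "(t - s) * a powr \<rho> \<le> integral {s..t} (\<lambda>r. k r powr \<rho>)"
      by (simp add: int)
    have "integral {s..t} k powr \<rho> = (t - s) powr \<rho> * a powr \<rho>"
      using st a by (simp add: int powr_mult)
    also have "\<dots> = (t - s) powr (\<rho> - 1) * ((t - s) * a powr \<rho>)"
      using powr_mult_base[of "t - s" "\<rho> - 1"] st by (simp add: mult.commute)
    also have "\<dots> \<le> (t - s) powr (\<rho> - 1) * integral {s..t} (\<lambda>r. k r powr \<rho>)"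
      by (intro mult_left_mono 1) auto
    finally show ?thesis .
  qed
qed

lemma norm_integral_powr_le:
  fixes k :: "real \<Rightarrow> 'a::euclidean_space"
  assumes st: "s < t" and k: "continuous_on {s..t} k" and \<rho>: "1 \<le> \<rho>"
  shows "ennreal (norm (integral {s..t} k) powr \<rho>)
    \<le> ennreal ((t - s) powr (\<rho> - 1)) * (\<integral>\<^sup>+r\<in>{s..t}. ennreal (norm (k r) powr \<rho>) \<partial>lborel)"
proof -
  have kn: "continuous_on {s..t} (\<lambda>r. norm (k r))" by (intro continuous_intros k)
  have kp: "continuous_on {s..t} (\<lambda>r. norm (k r) powr \<rho>)"
    by (rule continuous_on_powr') (use kn \<rho> in \<open>auto intro: continuous_on_const\<close>)
  have "norm (integral {s..t} k) \<le> integral {s..t} (\<lambda>r. norm (k r))"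
    by (rule integral_norm_bound_integral) (auto intro!: integrable_continuous_real k kn)
  then have "norm (integral {s..t} k) powr \<rho> \<le> integral {s..t} (\<lambda>r. norm (k r)) powr \<rho>"
    using \<rho> by (intro powr_mono2) auto
  also have "\<dots> \<le> (t - s) powr (\<rho> - 1) * integral {s..t} (\<lambda>r. norm (k r) powr \<rho>)"
    by (rule integral_powr_le[OF st kn _ \<rho>]) auto
  finally have "ennreal (norm (integral {s..t} k) powr \<rho>)
      \<le> ennreal ((t - s) powr (\<rho> - 1)) * ennreal (integral {s..t} (\<lambda>r. norm (k r) powr \<rho>))"
    by (subst ennreal_mult[symmetric]) (auto intro!: ennreal_leI integral_nonneg integrable_continuous_real kp)
  then show ?thesis by (subst nn_integral_eq_integral_Icc[OF kp]) auto
qed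

context drift
begin

lemma continuous_on_drift:
  assumes "continuous_on S h" "S \<subseteq> {0..T}"
  shows "continuous_on S (\<lambda>t. f t (h t))"
proof -
  have "continuous_on S (\<lambda>t. (\<lambda>(t, x). f t x) (t, h t))"
    by (rule continuous_on_compose2[OF f_continuous]) (use assms in \<open>auto intro!: continuous_intros\<close>)
  then show ?thesis by simp
qed

text \<open>With additive noise \<open>x - j\<close> solves a random ordinary differential equation, to which the
  one-sided Lipschitz condition applies path by path.\<close>

lemma pathwise_bound:
  assumes x: "continuous_on {0..T} x" and j: "continuous_on {0..T} j"
    and eq: "\<And>t. t \<in> {0..T} \<Longrightarrow> x t = x0 + integral {0..t} (\<lambda>s. f s (x s)) + j t"
    and t: "t \<in> {0..T}"
  shows "(norm (x t - j t))\<^sup>2 \<le> exp ((2 * L + 1) * T) * ((norm x0)\<^sup>2 + integral {0..T} (\<lambda>s. (norm (f s (j s)))\<^sup>2))"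
proof -
  define c where "c = 2 * L + 1"
  define z where "z t = x0 + integral {0..t} (\<lambda>s. f s (x s))" for t
  define u where "u s = (norm (f s (j s)))\<^sup>2" for s
  have xz: "x s = z s + j s" if "s \<in> {0..T}" for s using eq[OF that] by (simp add: z_def)
  have fx: "continuous_on {0..T} (\<lambda>s. f s (x s))" by (rule continuous_on_drift[OF x]) simp
  have uc: "continuous_on {0..T} u" unfolding u_def by (intro continuous_intros continuous_on_drift j) simp
  have ui: "u integrable_on {a..b}" if "{a..b} \<subseteq> {0..T}" for a b
    by (rule integrable_continuous_real[OF continuous_on_subset[OF uc that]])
  have zd: "(z has_vector_derivative f s (x s)) (at s within {0..T})" if "s \<in> {0..T}" for s
    unfolding z_def using integral_has_vector_derivative[OF fx that] by (auto intro!: derivative_eq_intros)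
  \<comment> \<open>Gronwall's inequality as monotonicity of \<open>\<phi>\<close>. In the rate
    \<open>c\<close>, the part \<open>2 * L\<close> pays for the one-sided Lipschitz condition and
    the part 1 for the mixed term with the forcing \<open>f s (j s)\<close>.\<close>
  define \<phi> where "\<phi> s = exp (- c * s) * (z s \<bullet> z s) - integral {0..s} u" for s
  have \<phi>d: "(\<phi> has_real_derivative (exp (- c * s) * (2 * (z s \<bullet> f s (x s)) - c * (z s \<bullet> z s)) - u s)) (at s within {0..T})"
    if "s \<in> {0..T}" for s
  proof -
    have "((\<lambda>s. z s \<bullet> z s) has_vector_derivative z s \<bullet> f s (x s) + f s (x s) \<bullet> z s) (at s within {0..T})"
      using bounded_bilinear.has_vector_derivative[OF bounded_bilinear_inner zd[OF that] zd[OF that]] .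
    then have "((\<lambda>s. z s \<bullet> z s) has_real_derivative 2 * (z s \<bullet> f s (x s))) (at s within {0..T})"
      by (simp add: has_real_derivative_iff_has_vector_derivative inner_commute)
    then show ?thesis
      unfolding \<phi>_def using integral_has_real_derivative[OF uc that]
      by (auto intro!: derivative_eq_intros simp: algebra_simps)
  qed
  have neg: "exp (- c * s) * (2 * (z s \<bullet> f s (x s)) - c * (z s \<bullet> z s)) - u s \<le> 0" if s: "s \<in> {0..T}" for s
  proof -
    \<comment> \<open>The one-sided condition is applied to the pair \<open>x s\<close>,
      \<open>j s\<close>, whose difference is exactly \<open>z s\<close>. What remains is
      \<open>f\<close> along the known path \<open>j\<close>.\<close>
    have "z s \<bullet> f s (x s) = (f s (x s) - f s (j s)) \<bullet> (x s - j s) + z s \<bullet> f s (j s)"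
      using xz[OF s] by (simp add: inner_commute inner_diff_left inner_diff_right)
    also have "\<dots> \<le> L * (norm (z s))\<^sup>2 + norm (z s) * norm (f s (j s))"
      using f_one_sided[OF s, of "x s" "j s"] xz[OF s] norm_cauchy_schwarz[of "z s" "f s (j s)"] by (intro add_mono) auto
    finally have "2 * (z s \<bullet> f s (x s)) \<le> 2 * L * (norm (z s))\<^sup>2 + 2 * norm (z s) * norm (f s (j s))" by simp
    also have "\<dots> \<le> c * (norm (z s))\<^sup>2 + u s"
      using sum_squares_bound[of "norm (z s)" "norm (f s (j s))"] by (simp add: c_def u_def algebra_simps)
    finally have "2 * (z s \<bullet> f s (x s)) - c * (z s \<bullet> z s) \<le> u s" by (simp add: power2_norm_eq_inner)
    then have "exp (- c * s) * (2 * (z s \<bullet> f s (x s)) - c * (z s \<bullet> z s)) \<le> exp (- c * s) * u s"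
      by (intro mult_left_mono) auto
    also have "\<dots> \<le> u s"
    proof (rule mult_left_le_one_le)
      have "0 \<le> c * s" using s L_pos by (intro mult_nonneg_nonneg) (auto simp: c_def)
      then show "exp (- c * s) \<le> 1" by simp
    qed (auto simp: u_def)
    finally show ?thesis by simp
  qed
  have tT: "0 \<le> t" "t \<le> T" using t by auto
  have "\<phi> t \<le> \<phi> 0"
  proof (rule DERIV_nonpos_imp_decreasing_open[OF tT(1)])
    fix s assume s: "0 < s" "s < t"
    then have "s \<in> interior {0..T}" using tT by simp
    then have "at s within {0..T} = at s" by (rule at_within_interior)
    moreover have "s \<in> {0..T}" using s tT by simp
    ultimately show "\<exists>y. DERIV \<phi> s :> y \<and> y \<le> 0" using \<phi>d[of s] neg[of s] by (intro exI conjI) auto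
  next
    have "continuous_on {0..T} \<phi>"
      by (rule DERIV_continuous_on) (rule \<phi>d)
    then show "continuous_on {0..t} \<phi>" by (rule continuous_on_subset) (use tT in auto)
  qed
  then have "exp (- c * t) * (norm (z t))\<^sup>2 \<le> (norm x0)\<^sup>2 + integral {0..t} u"
    by (simp add: \<phi>_def z_def power2_norm_eq_inner)
  also have "integral {0..t} u \<le> integral {0..T} u"
    by (rule integral_subset_le) (use tT in \<open>auto intro!: ui simp: u_def\<close>)
  finally have "exp (c * t) * (exp (- c * t) * (norm (z t))\<^sup>2) \<le> exp (c * t) * ((norm x0)\<^sup>2 + integral {0..T} u)"
    by (intro mult_left_mono) auto
  then have "(norm (z t))\<^sup>2 \<le> exp (c * t) * ((norm x0)\<^sup>2 + integral {0..T} u)"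
    by (simp add: mult.assoc[symmetric] exp_add[symmetric])
  also have "\<dots> \<le> exp (c * T) * ((norm x0)\<^sup>2 + integral {0..T} u)"
    using tT L_pos by (intro mult_right_mono add_nonneg_nonneg integral_nonneg ui) (auto simp: u_def c_def)
  finally show ?thesis using xz[OF t] by (simp add: c_def u_def[abs_def])
qed

end

section \<open>Moments of the solution\<close>

lemma (in sigma_finite_measure) nn_integral_time_le:
  fixes g :: "real \<times> 'a \<Rightarrow> ennreal"
  assumes g [measurable]: "g \<in> borel_measurable (borel \<Otimes>\<^sub>M M)" and st: "s \<le> t"
    and le: "\<And>r. r \<in> {s..t} \<Longrightarrow> (\<integral>\<^sup>+w. g (r, w) \<partial>M) \<le> C"
  shows "(\<integral>\<^sup>+w. (\<integral>\<^sup>+r\<in>{s..t}. g (r, w) \<partial>lborel) \<partial>M) \<le> C * ennreal (t - s)"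
proof -
  interpret P: pair_sigma_finite lborel M ..
  have [measurable]: "g \<in> borel_measurable (lborel \<Otimes>\<^sub>M M)"
    using g by (simp cong: measurable_cong_sets sets_pair_measure_cong)
  have "(\<integral>\<^sup>+w. (\<integral>\<^sup>+r\<in>{s..t}. g (r, w) \<partial>lborel) \<partial>M)
      = (\<integral>\<^sup>+r. (\<integral>\<^sup>+w. g (r, w) * indicator {s..t} r \<partial>M) \<partial>lborel)"
    by (rule P.Fubini') measurable
  also have "\<dots> = (\<integral>\<^sup>+r\<in>{s..t}. (\<integral>\<^sup>+w. g (r, w) \<partial>M) \<partial>lborel)"
    by (intro nn_integral_cong nn_integral_multc) measurable
  also have "\<dots> \<le> (\<integral>\<^sup>+r\<in>{s..t}. C \<partial>lborel)"
    by (rule nn_integral_mono) (auto simp: indicator_def le)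
  also have "\<dots> = C * ennreal (t - s)" using st by (simp add: nn_integral_cmult_indicator)
  finally show ?thesis .
qed

text \<open>Jensen in time, then Fubini: a time integral gains one full power of
  \<open>t - s\<close> in every L^\<rho> norm. Only the majorant \<open>g\<close> has to be jointly
  measurable; the integrand \<open>k\<close> enters path by path.\<close>

lemma (in usual_filtered_prob_space) nn_integral_time_integral_le:
  fixes k :: "real \<Rightarrow> 'w \<Rightarrow> 'a::euclidean_space" and g :: "real \<times> 'w \<Rightarrow> real"
  assumes st: "s < t" and \<rho>: "1 \<le> \<rho>" and g: "g \<in> borel_measurable (borel \<Otimes>\<^sub>M M)"
    and k: "AE w in M. continuous_on {s..t} (\<lambda>r. k r w) \<and> Z w = integral {s..t} (\<lambda>r. k r w) \<and>
          (\<forall>r\<in>{s..t}. norm (k r w) powr \<rho> \<le> g (r, w))"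
    and C: "0 \<le> C" "\<And>r. r \<in> {s..t} \<Longrightarrow> (\<integral>\<^sup>+w. ennreal (g (r, w)) \<partial>M) \<le> ennreal C"
  shows "(\<integral>\<^sup>+w. ennreal (norm (Z w) powr \<rho>) \<partial>M) \<le> ennreal (C * (t - s) powr \<rho>)"
proof -
  have gm [measurable]: "(\<lambda>x. ennreal (g x)) \<in> borel_measurable (borel \<Otimes>\<^sub>M M)" using g by measurable
  have Im: "(\<lambda>w. \<integral>\<^sup>+r\<in>{s..t}. ennreal (g (r, w)) \<partial>lborel) \<in> borel_measurable M"
  proof -
    have "(\<lambda>x. ennreal (g (snd x, fst x))) \<in> borel_measurable (M \<Otimes>\<^sub>M lborel)" using g by measurable
    then show ?thesis by measurable
  qed
  have "(\<integral>\<^sup>+w. ennreal (norm (Z w) powr \<rho>) \<partial>M)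
      \<le> (\<integral>\<^sup>+w. ennreal ((t - s) powr (\<rho> - 1)) * (\<integral>\<^sup>+r\<in>{s..t}. ennreal (g (r, w)) \<partial>lborel) \<partial>M)"
  proof (rule nn_integral_mono_AE)
    show "AE w in M. ennreal (norm (Z w) powr \<rho>)
        \<le> ennreal ((t - s) powr (\<rho> - 1)) * (\<integral>\<^sup>+r\<in>{s..t}. ennreal (g (r, w)) \<partial>lborel)"
      using k
    proof eventually_elim
      case (elim w)
      then have kc: "continuous_on {s..t} (\<lambda>r. k r w)" and Z: "Z w = integral {s..t} (\<lambda>r. k r w)"
        and kg: "\<And>r. r \<in> {s..t} \<Longrightarrow> norm (k r w) powr \<rho> \<le> g (r, w)" by auto
      show ?case
        unfolding Z
      proof (rule order_trans[OF norm_integral_powr_le[OF st kc \<rho>]], rule mult_left_mono, rule nn_integral_mono)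
        fix r
        show "ennreal (norm (k r w) powr \<rho>) * indicator {s..t} r \<le> ennreal (g (r, w)) * indicator {s..t} r"
          using kg[of r] by (auto simp: indicator_def intro: ennreal_leI)
      qed simp
    qed
  qed
  also have "\<dots> = ennreal ((t - s) powr (\<rho> - 1)) * (\<integral>\<^sup>+w. (\<integral>\<^sup>+r\<in>{s..t}. ennreal (g (r, w)) \<partial>lborel) \<partial>M)"
    by (rule nn_integral_cmult[OF Im])
  also have "\<dots> \<le> ennreal ((t - s) powr (\<rho> - 1)) * (ennreal C * ennreal (t - s))"
    by (intro mult_left_mono nn_integral_time_le[OF gm] C(2)) (use st in auto)
  also have "\<dots> = ennreal (C * (t - s) powr \<rho>)"
    using st C(1) powr_mult_base[of "t - s" "\<rho> - 1"]
    by (simp add: ennreal_mult[symmetric] mult.commute mult.left_commute)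
  finally show ?thesis .
qed

text \<open>The interface between stochastics and numerics: of the stochastic integral there remain
  only the Gaussian scaling of the increments of \<open>J\<close> (\<open>J_moment\<close>) and
  their vanishing conditional mean (\<open>J_mean\<close>). Continuity for every \<open>w\<close>
  and joint measurability are obtained by passing to modifications, see
  \<open>continuous_modification\<close>.\<close>

locale additive_noise_sode = usual_filtered_prob_space M F T + drift f A T L q K
  for M :: "'w measure" and F and T :: real
    and f :: "real \<Rightarrow> 'a::euclidean_space \<Rightarrow> 'a" and A and L q K :: real +
  fixes X J :: "real \<Rightarrow> 'w \<Rightarrow> 'a"
  assumes X_adapted: "t \<in> {0..T} \<Longrightarrow> X t \<in> borel_measurable (F t)"
    and J_adapted: "t \<in> {0..T} \<Longrightarrow> J t \<in> borel_measurable (F t)"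
    and X_joint: "(\<lambda>(t, w). X t w) \<in> borel_measurable (borel \<Otimes>\<^sub>M M)"
    and J_joint: "(\<lambda>(t, w). J t w) \<in> borel_measurable (borel \<Otimes>\<^sub>M M)"
    and X_continuous: "w \<in> space M \<Longrightarrow> continuous_on {0..T} (\<lambda>t. X t w)"
    and J_continuous: "w \<in> space M \<Longrightarrow> continuous_on {0..T} (\<lambda>t. J t w)"
    and sode: "AE w in M. J 0 w = 0 \<and>
          (\<forall>t\<in>{0..T}. X t w = X 0 w + integral {0..t} (\<lambda>s. f s (X s w)) + J t w)"
    and J_moment: "0 \<le> r \<Longrightarrow> \<exists>C\<ge>0. \<forall>s t. 0 \<le> s \<and> s < t \<and> t \<le> T \<longrightarrow>
          (\<integral>\<^sup>+w. ennreal (norm (J t w - J s w) powr r) \<partial>M) \<le> ennreal (C * (t - s) powr (r / 2))"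
    and J_mean: "0 \<le> s \<Longrightarrow> s \<le> t \<Longrightarrow> t \<le> T \<Longrightarrow> B \<in> sets (F s) \<Longrightarrow>
          (\<integral>w. indicator B w *\<^sub>R (J t w - J s w) \<partial>M) = 0"
begin

lemma X_measurable [measurable]: "X t \<in> borel_measurable M"
  using measurable_compose[OF measurable_Pair1' X_joint, of t] by simp

lemma J_measurable [measurable]: "J t \<in> borel_measurable M"
  using measurable_compose[OF measurable_Pair1' J_joint, of t] by simp

lemma X_joint_compose [measurable]:
  "u \<in> borel_measurable N \<Longrightarrow> v \<in> measurable N M \<Longrightarrow> (\<lambda>x. X (u x) (v x)) \<in> borel_measurable N"
  using measurable_compose[OF measurable_Pair[of u N borel v M] X_joint] by simp

lemma J_joint_compose [measurable]:
  "u \<in> borel_measurable N \<Longrightarrow> v \<in> measurable N M \<Longrightarrow> (\<lambda>x. J (u x) (v x)) \<in> borel_measurable N"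
  using measurable_compose[OF measurable_Pair[of u N borel v M] J_joint] by simp

lemma nn_integral_1_plus_powr_le:
  fixes Y :: "'w \<Rightarrow> real"
  assumes [measurable]: "Y \<in> borel_measurable M" and r: "0 \<le> r" and Y0: "\<And>w. 0 \<le> Y w"
    and le: "(\<integral>\<^sup>+w. ennreal (Y w powr r) \<partial>M) \<le> ennreal C" and C: "0 \<le> C"
  shows "(\<integral>\<^sup>+w. ennreal ((1 + Y w) powr r) \<partial>M) \<le> ennreal (2 powr r * (1 + C))"
proof -
  have "(\<integral>\<^sup>+w. ennreal ((1 + Y w) powr r) \<partial>M) \<le> (\<integral>\<^sup>+w. ennreal (2 powr r) * (1 + ennreal (Y w powr r)) \<partial>M)"
  proof (rule nn_integral_mono)
    fix w
    have "ennreal ((1 + Y w) powr r) \<le> ennreal (2 powr r * (1 + Y w powr r))"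
      using powr_add_le[of 1 "Y w" r] Y0 r by (intro ennreal_leI) simp
    then show "ennreal ((1 + Y w) powr r) \<le> ennreal (2 powr r) * (1 + ennreal (Y w powr r))"
      by (simp add: ennreal_mult ennreal_1[symmetric] ennreal_plus[symmetric] del: ennreal_1 ennreal_plus)
  qed
  also have "\<dots> = ennreal (2 powr r) * (1 + (\<integral>\<^sup>+w. ennreal (Y w powr r) \<partial>M))"
    by (simp add: nn_integral_cmult nn_integral_add emeasure_space_1)
  also have "\<dots> \<le> ennreal (2 powr r) * (1 + ennreal C)"
    by (intro mult_left_mono add_left_mono le) auto
  also have "\<dots> = ennreal (2 powr r * (1 + C))"
    using C by (simp add: ennreal_mult ennreal_1[symmetric] ennreal_plus[symmetric] del: ennreal_1 ennreal_plus)
  finally show ?thesis .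
qed

lemma J_moment_uniform:
  assumes r: "0 < r"
  obtains C where "0 \<le> C" "\<And>t. t \<in> {0..T} \<Longrightarrow> (\<integral>\<^sup>+w. ennreal (norm (J t w) powr r) \<partial>M) \<le> ennreal C"
proof -
  obtain C where C: "0 \<le> C" "\<And>s t. 0 \<le> s \<and> s < t \<and> t \<le> T \<Longrightarrow>
          (\<integral>\<^sup>+w. ennreal (norm (J t w - J s w) powr r) \<partial>M) \<le> ennreal (C * (t - s) powr (r / 2))"
    using J_moment[OF less_imp_le[OF r]] by blast
  have J0: "AE w in M. J 0 w = 0" using sode by eventually_elim simp
  show ?thesis
  proof (rule that)
    show "0 \<le> C * T powr (r / 2)" using C by simp
    fix t assume t: "t \<in> {0..T}"
    show "(\<integral>\<^sup>+w. ennreal (norm (J t w) powr r) \<partial>M) \<le> ennreal (C * T powr (r / 2))"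
    proof (cases "t = 0")
      case True
      have "(\<integral>\<^sup>+w. ennreal (norm (J t w) powr r) \<partial>M) = (\<integral>\<^sup>+w. 0 \<partial>M)"
        by (rule nn_integral_cong_AE) (use J0 True in auto)
      then show ?thesis by simp
    next
      case False
      have "(\<integral>\<^sup>+w. ennreal (norm (J t w) powr r) \<partial>M) = (\<integral>\<^sup>+w. ennreal (norm (J t w - J 0 w) powr r) \<partial>M)"
        by (rule nn_integral_cong_AE) (use J0 in auto)
      also have "\<dots> \<le> ennreal (C * (t - 0) powr (r / 2))" using C(2)[of 0 t] t False by auto
      also have "\<dots> \<le> ennreal (C * T powr (r / 2))"
        using C(1) t r by (intro ennreal_leI mult_left_mono powr_mono2) auto
      finally show ?thesis .
    qed
  qed
qed

text \<open>The pathwise bound is raised to the power \<open>p / 2\<close>, which needs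
  \<open>2 \<le> p\<close> for Jensen. The forcing \<open>f s (J s)\<close> costs a moment of order
  \<open>q * p\<close>, but only of \<open>J\<close>, which has all moments; \<open>X 0\<close>
  enters with order \<open>p\<close>.\<close>

lemma X_moment:
  assumes p: "2 \<le> p" and X0: "(\<integral>\<^sup>+w. ennreal (norm (X 0 w) powr p) \<partial>M) < \<infinity>"
  obtains C where "0 \<le> C" "\<And>t. t \<in> {0..T} \<Longrightarrow> (\<integral>\<^sup>+w. ennreal (norm (X t w) powr p) \<partial>M) \<le> ennreal C"
proof -
  obtain C0 where C0: "0 \<le> C0" "(\<integral>\<^sup>+w. ennreal (norm (X 0 w) powr p) \<partial>M) = ennreal C0"
    using X0 by (cases "\<integral>\<^sup>+w. ennreal (norm (X 0 w) powr p) \<partial>M") auto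
  have qp: "0 < q * p" using q_ge p by simp
  obtain C1 where C1: "0 \<le> C1" "\<And>t. t \<in> {0..T} \<Longrightarrow> (\<integral>\<^sup>+w. ennreal (norm (J t w) powr p) \<partial>M) \<le> ennreal C1"
    using J_moment_uniform[of p] p by auto
  obtain C2 where C2: "0 \<le> C2" "\<And>t. t \<in> {0..T} \<Longrightarrow> (\<integral>\<^sup>+w. ennreal (norm (J t w) powr (q * p)) \<partial>M) \<le> ennreal C2"
    using J_moment_uniform[OF qp] by blast
  define E where "E = exp ((2 * L + 1) * T)"
  have E0: "0 < E" by (simp add: E_def)
  define H where "H = T powr (p / 2 - 1) * K powr p"
  have H0: "0 \<le> H" by (simp add: H_def)
  define g where "g x = ennreal ((1 + norm (J (fst x) (snd x))) powr (q * p))" for x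
  have g [measurable]: "g \<in> borel_measurable (borel \<Otimes>\<^sub>M M)" unfolding g_def by measurable
  define C3 where "C3 = 2 powr (q * p) * (1 + C2)"
  have C3: "0 \<le> C3" using C2 by (simp add: C3_def)
  have gb: "(\<integral>\<^sup>+w. g (r, w) \<partial>M) \<le> ennreal C3" if "r \<in> {0..T}" for r
    unfolding g_def C3_def using nn_integral_1_plus_powr_le[of "\<lambda>w. norm (J r w)" "q * p" C2] C2 that qp by simp
  define I where "I w = (\<integral>\<^sup>+r\<in>{0..T}. g (r, w) \<partial>lborel)" for w
  have Im [measurable]: "I \<in> borel_measurable M"
  proof -
    have "(\<lambda>x. g (snd x, fst x)) \<in> borel_measurable (M \<Otimes>\<^sub>M lborel)" by measurable
    then show ?thesis unfolding I_def by measurable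
  qed
  have IE: "(\<integral>\<^sup>+w. I w \<partial>M) \<le> ennreal C3 * ennreal (T - 0)"
    unfolding I_def by (rule nn_integral_time_le[OF g]) (use T_pos gb in auto)
  define a where "a = 2 powr p"
  have a0: "0 \<le> a" by (simp add: a_def)
  have point: "AE w in M. \<forall>t\<in>{0..T}. ennreal (norm (X t w) powr p)
     \<le> ennreal a * ennreal (norm (J t w) powr p) + ennreal (a * E powr (p / 2) * a) * (ennreal (norm (X 0 w) powr p) + ennreal H * I w)"
    using sode AE_space
  proof eventually_elim
    case (elim w)
    have eq: "X t w = X 0 w + integral {0..t} (\<lambda>s. f s (X s w)) + J t w" if "t \<in> {0..T}" for t
      using elim(1) that by blast
    have w: "w \<in> space M" by (rule elim(2))
    show ?case
    proof
      fix t assume t: "t \<in> {0..T}"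
      let ?u = "\<lambda>s. (norm (f s (J s w)))\<^sup>2"
      let ?U = "integral {0..T} ?u"
      have uc: "continuous_on {0..T} ?u"
        by (intro continuous_intros continuous_on_drift J_continuous w) simp
      have U0: "0 \<le> ?U" by (intro integral_nonneg integrable_continuous_real uc) auto
      have "(norm (X t w - J t w))\<^sup>2 \<le> E * ((norm (X 0 w))\<^sup>2 + ?U)"
        unfolding E_def by (rule pathwise_bound[OF X_continuous[OF w] J_continuous[OF w] eq t])
      then have "((norm (X t w - J t w))\<^sup>2) powr (p / 2) \<le> (E * ((norm (X 0 w))\<^sup>2 + ?U)) powr (p / 2)"
        using p by (intro powr_mono2) auto
      moreover have sq: "(x\<^sup>2) powr (p / 2) = x powr p" if "0 \<le> x" for x :: real
        using that powr_powr[of x 2 "p/2"] by simp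
      ultimately have "norm (X t w - J t w) powr p \<le> E powr (p / 2) * ((norm (X 0 w))\<^sup>2 + ?U) powr (p / 2)"
        using U0 E0 by (simp add: powr_mult)
      also have "\<dots> \<le> E powr (p / 2) * (a * (norm (X 0 w) powr p + ?U powr (p / 2)))"
      proof (intro mult_left_mono)
        have "((norm (X 0 w))\<^sup>2 + ?U) powr (p / 2) \<le> 2 powr (p / 2) * (((norm (X 0 w))\<^sup>2) powr (p / 2) + ?U powr (p / 2))"
          using U0 p by (intro powr_add_le) auto
        also have "\<dots> \<le> a * (norm (X 0 w) powr p + ?U powr (p / 2))"
          unfolding a_def sq[OF norm_ge_zero] using p by (intro mult_right_mono powr_mono) auto
        finally show "((norm (X 0 w))\<^sup>2 + ?U) powr (p / 2) \<le> a * (norm (X 0 w) powr p + ?U powr (p / 2))" .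
      qed auto
      finally have 1: "norm (X t w - J t w) powr p \<le> E powr (p / 2) * (a * (norm (X 0 w) powr p + ?U powr (p / 2)))" .
      have "norm (X t w) \<le> norm (J t w) + norm (X t w - J t w)"
        using norm_triangle_ineq[of "J t w" "X t w - J t w"] by simp
      then have "norm (X t w) powr p \<le> (norm (J t w) + norm (X t w - J t w)) powr p"
        using p by (intro powr_mono2) auto
      also have "\<dots> \<le> a * (norm (J t w) powr p + norm (X t w - J t w) powr p)"
        unfolding a_def using p by (intro powr_add_le) auto
      also have "\<dots> \<le> a * (norm (J t w) powr p + E powr (p / 2) * (a * (norm (X 0 w) powr p + ?U powr (p / 2))))"
        by (intro mult_left_mono add_left_mono 1 a0)
      finally have 2: "ennreal (norm (X t w) powr p) \<le> ennreal (a * (norm (J t w) powr p)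
          + (a * E powr (p / 2) * a) * (norm (X 0 w) powr p + ?U powr (p / 2)))"
        by (intro ennreal_leI) (simp add: algebra_simps)
      have U: "ennreal (?U powr (p / 2)) \<le> ennreal H * I w"
      proof -
        have "ennreal (norm (integral {0..T} ?u) powr (p / 2))
          \<le> ennreal (T powr (p / 2 - 1)) * (\<integral>\<^sup>+r\<in>{0..T}. ennreal (norm (?u r) powr (p / 2)) \<partial>lborel)"
          using norm_integral_powr_le[OF T_pos uc, of "p / 2"] p by simp
        also have "\<dots> \<le> ennreal (T powr (p / 2 - 1)) * (\<integral>\<^sup>+r. ennreal (K powr p) * (g (r, w) * indicator {0..T} r) \<partial>lborel)"
        proof (rule mult_left_mono, rule nn_integral_mono)
          fix r
          show "ennreal (norm (?u r) powr (p / 2)) * indicator {0..T} r \<le> ennreal (K powr p) * (g (r, w) * indicator {0..T} r)"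
          proof (cases "r \<in> {0..T}")
            case True
            have "norm (?u r) powr (p / 2) = norm (f r (J r w)) powr p" using sq[of "norm (f r (J r w))"] by simp
            also have "\<dots> \<le> (K * (1 + norm (J r w)) powr q) powr p"
              using p by (intro powr_mono2 f_growth True) auto
            also have "\<dots> = K powr p * (1 + norm (J r w)) powr (q * p)"
              using K_ge by (simp add: powr_mult powr_powr)
            finally show ?thesis using True by (simp add: g_def ennreal_mult[symmetric] ennreal_leI)
          qed simp
        qed simp
        also have "(\<integral>\<^sup>+r. ennreal (K powr p) * (g (r, w) * indicator {0..T} r) \<partial>lborel) = ennreal (K powr p) * I w"
          unfolding I_def using w by (intro nn_integral_cmult) measurable
        finally show ?thesis using U0 by (simp add: H_def ennreal_mult mult.assoc)
      qed
      note 2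
      also have "ennreal (a * (norm (J t w) powr p)
          + (a * E powr (p / 2) * a) * (norm (X 0 w) powr p + ?U powr (p / 2))) = ennreal a * ennreal (norm (J t w) powr p)
          + ennreal (a * E powr (p / 2) * a) * (ennreal (norm (X 0 w) powr p) + ennreal (?U powr (p / 2)))"
        using a0 by (simp add: ennreal_mult)
      also have "\<dots> \<le> ennreal a * ennreal (norm (J t w) powr p) + ennreal (a * E powr (p / 2) * a) * (ennreal (norm (X 0 w) powr p) + ennreal H * I w)"
        by (intro add_left_mono mult_left_mono U) simp
      finally show "ennreal (norm (X t w) powr p)
         \<le> ennreal a * ennreal (norm (J t w) powr p) + ennreal (a * E powr (p / 2) * a) * (ennreal (norm (X 0 w) powr p) + ennreal H * I w)" .
    qed
  qed
  define Ctot where "Ctot = a * C1 + (a * E powr (p / 2) * a) * (C0 + H * (C3 * T))"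
  show ?thesis
  proof (rule that)
    show "0 \<le> Ctot" using a0 C1 C0 H0 C3 T_pos by (simp add: Ctot_def)
    fix t assume t: "t \<in> {0..T}"
    have "(\<integral>\<^sup>+w. ennreal (norm (X t w) powr p) \<partial>M)
      \<le> (\<integral>\<^sup>+w. ennreal a * ennreal (norm (J t w) powr p) + ennreal (a * E powr (p / 2) * a) * (ennreal (norm (X 0 w) powr p) + ennreal H * I w) \<partial>M)"
    proof (rule nn_integral_mono_AE)
      show "AE w in M. ennreal (norm (X t w) powr p)
        \<le> ennreal a * ennreal (norm (J t w) powr p) + ennreal (a * E powr (p / 2) * a) * (ennreal (norm (X 0 w) powr p) + ennreal H * I w)"
        using point by eventually_elim (rule bspec[OF _ t])
    qed
    also have "\<dots> = ennreal a * (\<integral>\<^sup>+w. ennreal (norm (J t w) powr p) \<partial>M)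
       + ennreal (a * E powr (p / 2) * a) * ((\<integral>\<^sup>+w. ennreal (norm (X 0 w) powr p) \<partial>M) + ennreal H * (\<integral>\<^sup>+w. I w \<partial>M))"
      by (simp add: nn_integral_add nn_integral_cmult)
    also have "\<dots> \<le> ennreal a * ennreal C1 + ennreal (a * E powr (p / 2) * a) * (ennreal C0 + ennreal H * (ennreal C3 * ennreal (T - 0)))"
      unfolding C0(2) by (intro add_mono mult_left_mono C1(2)[OF t] IE) auto
    also have "\<dots> = ennreal Ctot"
      using a0 C1 C0 H0 C3 T_pos by (simp add: Ctot_def ennreal_mult)
    finally show "(\<integral>\<^sup>+w. ennreal (norm (X t w) powr p) \<partial>M) \<le> ennreal Ctot" .
  qed
qed

end

section \<open>Local error\<close>

text \<open>Here \<open>x\<close>, \<open>y\<close>, \<open>j\<close> stand for \<open>X s\<close>,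
  \<open>X r\<close>, \<open>J r - J s\<close>. Everything is rescaled to order one: the drift part
  \<open>D\<close> of the increment equals \<open>h * e powr q\<close> in norm, so \<open>e\<close>
  has the weight of one power of \<open>norm x\<close>, and the noise part equals
  \<open>sqrt h * i\<close>. With these units the expansion error is of order \<open>h\<close>, the
  Jacobian applied to the noise of order \<open>sqrt h\<close>.\<close>

lemma (in drift) local_error_integrand_le:
  assumes s: "0 \<le> s" "s < r" "r \<le> T"
  defines "P \<equiv> 6 * q - 4"
  defines "V x y \<equiv> 1 + norm x + norm y"
    and "d x y j \<equiv> (norm (y - x - j) / (r - s)) powr (1 / q)"
  shows "(norm (f r y - f s x - A s x j))\<^sup>2 \<le> 4 * K\<^sup>2 * (6 + 4 * T\<^sup>2) * (r - s)\<^sup>2 *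
      (V x y powr P + d x y j powr P + (norm j / sqrt (r - s)) powr P)" (is ?A)
    and "(K * (1 + norm x) powr (q - 1) * norm j)\<^sup>2 \<le> K\<^sup>2 * (r - s) *
      (V x y powr P + (norm j / sqrt (r - s)) powr P)" (is ?B)
proof -
  define h where "h = r - s"
  have h: "0 < h" "h \<le> T" using s by (auto simp: h_def)
  define v where "v = V x y"
  define e where "e = d x y j"
  define i where "i = norm j / sqrt h"
  define D where "D = y - x - j"
  have v1: "1 \<le> v" by (simp add: v_def V_def)
  have e0: "0 \<le> e" by (simp add: e_def d_def)
  have i0: "0 \<le> i" using h by (simp add: i_def)
  have q2: "2 \<le> q" "0 < q" using q_ge by auto
  have rs: "r \<in> {0..T}" "s \<in> {0..T}" using s by auto
  have D_eq: "norm D = h * e powr q"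
    using h q2 by (simp add: e_def d_def D_def[symmetric] h_def[symmetric] powr_powr)
  have j_eq: "(norm j)\<^sup>2 = h * i\<^sup>2" using h by (simp add: i_def power_divide)
  have sq: "(x powr p)\<^sup>2 = x powr (2 * p)" for x p :: real
    by (simp add: power2_eq_square powr_add[symmetric])
  have V_x: "1 + norm x \<le> v" "1 + norm y \<le> v" by (auto simp: v_def V_def)
  let ?a = "K * v powr q * h" and ?b = "2 * K * v powr (q - 2) * (norm D)\<^sup>2"
  let ?c = "2 * K * v powr (q - 2) * (norm j)\<^sup>2" and ?d = "K * v powr (q - 1) * norm D"
  \<comment> \<open>Change of time at fixed \<open>y\<close>, Taylor remainder in space at time
    \<open>s\<close>, and the Jacobian applied to the drift part. The Jacobian applied to
    \<open>j\<close> has been subtracted, since it is too large and must be treated by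
    orthogonality.\<close>
  have "norm (f r y - f s x - A s x j)
      \<le> norm (f r y - f s y) + norm (f s y - f s x - A s x (y - x)) + norm (A s x D)"
  proof -
    interpret A: linear "A s x" by (rule A_linear[OF rs(2)])
    have "A s x D = A s x (y - x) - A s x j" by (simp add: D_def A.diff)
    then have "f r y - f s x - A s x j = (f r y - f s y) + (f s y - f s x - A s x (y - x)) + A s x D" by simp
    then show ?thesis
      using norm_triangle_le[OF add_mono[OF norm_triangle_ineq order_refl]] by metis
  qed
  also have "norm (f r y - f s y) \<le> ?a"
  proof -
    have "norm (f r y - f s y) \<le> K * (1 + norm y) powr q * h"
      using f_time_lipschitz[OF rs(2,1), of y] s by (simp add: h_def)
    also have "\<dots> \<le> ?a"
      using K_ge h q2 V_x by (intro mult_right_mono mult_left_mono powr_mono2) auto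
    finally show ?thesis .
  qed
  also have "norm (f s y - f s x - A s x (y - x)) \<le> ?b + ?c"
  proof -
    have "y - x = D + j" by (simp add: D_def)
    then have "(norm (y - x))\<^sup>2 \<le> (norm D + norm j)\<^sup>2" by (auto intro!: power_mono norm_triangle_ineq)
    also have "\<dots> \<le> 2 * (norm D)\<^sup>2 + 2 * (norm j)\<^sup>2"
      using sum_squares_bound[of "norm D" "norm j"] by (simp add: power2_sum)
    finally have "K * v powr (q - 2) * (norm (y - x))\<^sup>2 \<le> K * v powr (q - 2) * (2 * (norm D)\<^sup>2 + 2 * (norm j)\<^sup>2)"
      using K_ge by (intro mult_left_mono) auto
    then show ?thesis
      using f_taylor[OF rs(2), of y x] by (simp add: v_def V_def algebra_simps)
  qed
  also have "norm (A s x D) \<le> ?d"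
  proof -
    have "norm (A s x D) \<le> K * (1 + norm x) powr (q - 1) * norm D" by (rule A_growth[OF rs(2)])
    also have "\<dots> \<le> ?d"
      using K_ge q2 V_x by (intro mult_right_mono mult_left_mono powr_mono2) auto
    finally show ?thesis .
  qed
  finally have "norm (f r y - f s x - A s x j) \<le> ?a + (?b + ?c) + ?d" by simp
  then have "(norm (f r y - f s x - A s x j))\<^sup>2 \<le> (?a + (?b + ?c) + ?d)\<^sup>2" by (intro power_mono) auto
  also have "\<dots> \<le> 4 * (?a\<^sup>2 + ?b\<^sup>2 + ?c\<^sup>2 + ?d\<^sup>2)"
  proof -
    have "(a + (b + c) + d)\<^sup>2 \<le> 4 * (a\<^sup>2 + b\<^sup>2 + c\<^sup>2 + d\<^sup>2)" for a b c d :: real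
      using sum_squares_bound[of a b] sum_squares_bound[of a c] sum_squares_bound[of a d]
        sum_squares_bound[of b c] sum_squares_bound[of b d] sum_squares_bound[of c d]
      by (simp add: power2_eq_square algebra_simps)
    then show ?thesis .
  qed
  also have "\<dots> \<le> 4 * (K\<^sup>2 * h\<^sup>2 * (v powr P) + 4 * K\<^sup>2 * h^4 * (v powr P + e powr P)
      + 4 * K\<^sup>2 * h\<^sup>2 * (v powr P + i powr P) + K\<^sup>2 * h\<^sup>2 * (v powr P + e powr P))"
  proof (intro mult_left_mono add_mono)
    have "?a\<^sup>2 = K\<^sup>2 * h\<^sup>2 * v powr (2 * q)" by (simp add: power_mult_distrib sq)
    also have "\<dots> \<le> K\<^sup>2 * h\<^sup>2 * v powr P"
      using v1 q2 by (intro mult_left_mono powr_mono) (auto simp: P_def)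
    finally show "?a\<^sup>2 \<le> K\<^sup>2 * h\<^sup>2 * v powr P" .
    \<comment> \<open>The term that fixes the order of integrability: the exponents add up to
      exactly \<open>6 * q - 4\<close>; the other terms need less or the same.\<close>
    have "?b\<^sup>2 = 4 * K\<^sup>2 * h^4 * (v powr (2 * q - 4) * e powr (4 * q))"
    proof -
      have "((norm D)\<^sup>2)\<^sup>2 = h^4 * e powr (4 * q)"
        by (simp add: D_eq power_mult_distrib sq)
      then show ?thesis by (simp add: power_mult_distrib sq)
    qed
    also have "\<dots> \<le> 4 * K\<^sup>2 * h^4 * (v powr P + e powr P)"
      using v1 e0 q2 by (intro mult_left_mono powr_young) (auto simp: P_def)
    finally show "?b\<^sup>2 \<le> 4 * K\<^sup>2 * h^4 * (v powr P + e powr P)" .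
    have "?c\<^sup>2 = 4 * K\<^sup>2 * h\<^sup>2 * (v powr (2 * q - 4) * i powr 4)"
    proof -
      have "((norm j)\<^sup>2)\<^sup>2 = h\<^sup>2 * i powr 4"
        using i0 by (simp add: j_eq power_mult_distrib)
      then show ?thesis by (simp add: power_mult_distrib sq)
    qed
    also have "\<dots> \<le> 4 * K\<^sup>2 * h\<^sup>2 * (v powr P + i powr P)"
      using v1 i0 q2 by (intro mult_left_mono powr_young) (auto simp: P_def)
    finally show "?c\<^sup>2 \<le> 4 * K\<^sup>2 * h\<^sup>2 * (v powr P + i powr P)" .
    have "?d\<^sup>2 = K\<^sup>2 * h\<^sup>2 * (v powr (2 * q - 2) * e powr (2 * q))"
      by (simp add: power_mult_distrib sq D_eq algebra_simps)
    also have "\<dots> \<le> K\<^sup>2 * h\<^sup>2 * (v powr P + e powr P)"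
      using v1 e0 q2 by (intro mult_left_mono powr_young) (auto simp: P_def)
    finally show "?d\<^sup>2 \<le> K\<^sup>2 * h\<^sup>2 * (v powr P + e powr P)" .
  qed simp
  also have "\<dots> = 4 * K\<^sup>2 * h\<^sup>2 * (v powr P + 4 * h\<^sup>2 * (v powr P + e powr P)
      + 4 * (v powr P + i powr P) + (v powr P + e powr P))"
    by (simp add: algebra_simps power2_eq_square power4_eq_xxxx)
  also have "\<dots> \<le> 4 * K\<^sup>2 * h\<^sup>2 * ((6 + 4 * T\<^sup>2) * (v powr P + e powr P + i powr P))"
  proof (intro mult_left_mono)
    have "h\<^sup>2 \<le> T\<^sup>2" using h by (intro power_mono) auto
    then have "4 * h\<^sup>2 * (v powr P + e powr P) \<le> 4 * T\<^sup>2 * (v powr P + e powr P)"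
      by (intro mult_right_mono) auto
    also have "\<dots> \<le> 4 * T\<^sup>2 * (v powr P + e powr P + i powr P)"
      by (intro mult_left_mono) auto
    finally have 1: "4 * h\<^sup>2 * (v powr P + e powr P) \<le> 4 * T\<^sup>2 * (v powr P + e powr P + i powr P)" .
    have aux: "a + x + 4 * (a + i') + (a + e') \<le> y + 6 * (a + e' + i')"
      if "x \<le> y" "0 \<le> e'" "0 \<le> i'" for a x y e' i' :: real
      using that by (simp add: algebra_simps)
    have "v powr P + 4 * h\<^sup>2 * (v powr P + e powr P)
      + 4 * (v powr P + i powr P) + (v powr P + e powr P)
      \<le> 4 * T\<^sup>2 * (v powr P + e powr P + i powr P) + 6 * (v powr P + e powr P + i powr P)"
      by (rule aux[OF 1]) simp_all
    then show "v powr P + 4 * h\<^sup>2 * (v powr P + e powr P)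
      + 4 * (v powr P + i powr P) + (v powr P + e powr P)
      \<le> (6 + 4 * T\<^sup>2) * (v powr P + e powr P + i powr P)" by (simp add: distrib_right)
  qed simp
  finally show ?A by (simp add: v_def e_def i_def h_def mult.assoc mult.left_commute)
  have "(K * (1 + norm x) powr (q - 1) * norm j)\<^sup>2 \<le> (K * v powr (q - 1) * norm j)\<^sup>2"
    using K_ge q2 V_x by (intro power_mono mult_right_mono mult_left_mono powr_mono2) auto
  also have "\<dots> = K\<^sup>2 * h * (v powr (2 * q - 2) * i powr 2)"
    using i0 by (simp add: power_mult_distrib sq j_eq algebra_simps)
  also have "\<dots> \<le> K\<^sup>2 * h * (v powr P + i powr P)"
    using v1 i0 q2 h by (intro mult_left_mono powr_young) (auto simp: P_def)
  finally show ?B by (simp add: v_def i_def h_def)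
qed

context additive_noise_sode
begin

lemma sode_increment:
  "AE w in M. \<forall>s r. 0 \<le> s \<longrightarrow> s \<le> r \<longrightarrow> r \<le> T \<longrightarrow>
     X r w - X s w - (J r w - J s w) = integral {s..r} (\<lambda>u. f u (X u w))"
  using sode AE_space
proof eventually_elim
  case (elim w)
  show ?case
  proof (intro allI impI)
    fix s r :: real assume sr: "0 \<le> s" "s \<le> r" "r \<le> T"
    let ?I = "\<lambda>a b. integral {a..b} (\<lambda>u. f u (X u w))"
    have eq: "X t w = X 0 w + ?I 0 t + J t w" if "t \<in> {0..T}" for t
      using elim(1) that by blast
    have "continuous_on {0..r} (\<lambda>u. f u (X u w))"
      by (rule continuous_on_drift, rule continuous_on_subset[OF X_continuous[OF elim(2)]]) (use sr in auto)
    then have "?I 0 s + ?I s r = ?I 0 r"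
      using sr by (intro Henstock_Kurzweil_Integration.integral_combine integrable_continuous_real) auto
    then show "X r w - X s w - (J r w - J s w) = ?I s r"
      using eq[of r] eq[of s] sr by (simp add: algebra_simps)
  qed
qed

lemma drift_increment_moment:
  assumes \<rho>: "1 \<le> \<rho>" and C: "0 \<le> C" "\<And>t. t \<in> {0..T} \<Longrightarrow> (\<integral>\<^sup>+w. ennreal (norm (X t w) powr (q * \<rho>)) \<partial>M) \<le> ennreal C"
    and sr: "0 \<le> s" "s < r" "r \<le> T"
  shows "(\<integral>\<^sup>+w. ennreal (norm (X r w - X s w - (J r w - J s w)) powr \<rho>) \<partial>M)
    \<le> ennreal (K powr \<rho> * (2 powr (q * \<rho>) * (1 + C)) * (r - s) powr \<rho>)"
proof -
  define g where "g x = K powr \<rho> * (1 + norm (X (fst x) (snd x))) powr (q * \<rho>)" for x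
  have g [measurable]: "g \<in> borel_measurable (borel \<Otimes>\<^sub>M M)" unfolding g_def by measurable
  define C3 where "C3 = 2 powr (q * \<rho>) * (1 + C)"
  have C3: "0 \<le> C3" using C by (simp add: C3_def)
  have q\<rho>: "0 \<le> q * \<rho>" using q_ge \<rho> by simp
  have "(\<integral>\<^sup>+w. ennreal (norm (X r w - X s w - (J r w - J s w)) powr \<rho>) \<partial>M)
      \<le> ennreal (K powr \<rho> * C3 * (r - s) powr \<rho>)"
  proof (rule nn_integral_time_integral_le[OF sr(2) \<rho> g])
    show "AE w in M. continuous_on {s..r} (\<lambda>u. f u (X u w)) \<and>
        X r w - X s w - (J r w - J s w) = integral {s..r} (\<lambda>u. f u (X u w)) \<and>
        (\<forall>u\<in>{s..r}. norm (f u (X u w)) powr \<rho> \<le> g (u, w))"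
      using sode_increment AE_space
    proof eventually_elim
      case (elim w)
      have "norm (f u (X u w)) powr \<rho> \<le> g (u, w)" if "u \<in> {s..r}" for u
      proof -
        have "norm (f u (X u w)) powr \<rho> \<le> (K * (1 + norm (X u w)) powr q) powr \<rho>"
          using \<rho> that sr by (intro powr_mono2 f_growth) auto
        also have "\<dots> = g (u, w)" using K_ge by (simp add: g_def powr_mult powr_powr)
        finally show ?thesis .
      qed
      moreover have "continuous_on {s..r} (\<lambda>u. f u (X u w))"
        by (rule continuous_on_drift, rule continuous_on_subset[OF X_continuous[OF elim(2)]]) (use sr in auto)
      moreover have "X r w - X s w - (J r w - J s w) = integral {s..r} (\<lambda>u. f u (X u w))"
        using elim(1) sr by auto
      ultimately show ?case by blast
    qed
    show "0 \<le> K powr \<rho> * C3" using C3 by simp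
    fix u assume u: "u \<in> {s..r}"
    have "(\<integral>\<^sup>+w. ennreal (g (u, w)) \<partial>M)
        = ennreal (K powr \<rho>) * (\<integral>\<^sup>+w. ennreal ((1 + norm (X u w)) powr (q * \<rho>)) \<partial>M)"
      by (simp add: g_def ennreal_mult nn_integral_cmult)
    also have "\<dots> \<le> ennreal (K powr \<rho>) * ennreal C3"
      unfolding C3_def using C u sr q\<rho> by (intro mult_left_mono nn_integral_1_plus_powr_le) auto
    finally show "(\<integral>\<^sup>+w. ennreal (g (u, w)) \<partial>M) \<le> ennreal (K powr \<rho> * C3)"
      using C3 by (simp add: ennreal_mult)
  qed
  then show ?thesis by (simp add: C3_def)
qed

text \<open>For \<open>s = r\<close> the quotients are \<open>0 / 0 = 0\<close>.\<close>

lemma scaled_moments: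
  defines "P \<equiv> 6 * q - 4"
  assumes X0: "(\<integral>\<^sup>+w. ennreal (norm (X 0 w) powr P) \<partial>M) < \<infinity>"
  obtains C where "0 \<le> C"
    "\<And>s r. 0 \<le> s \<Longrightarrow> s \<le> r \<Longrightarrow> r \<le> T \<Longrightarrow>
       (\<integral>\<^sup>+w. ennreal ((1 + norm (X s w) + norm (X r w)) powr P) \<partial>M) \<le> ennreal C"
    "\<And>s r. 0 \<le> s \<Longrightarrow> s \<le> r \<Longrightarrow> r \<le> T \<Longrightarrow>
       (\<integral>\<^sup>+w. ennreal (((norm (X r w - X s w - (J r w - J s w)) / (r - s)) powr (1 / q)) powr P) \<partial>M) \<le> ennreal C"
    "\<And>s r. 0 \<le> s \<Longrightarrow> s \<le> r \<Longrightarrow> r \<le> T \<Longrightarrow>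
       (\<integral>\<^sup>+w. ennreal ((norm (J r w - J s w) / sqrt (r - s)) powr P) \<partial>M) \<le> ennreal C"
proof -
  have P: "2 \<le> P" "0 < P" using q_ge by (auto simp: P_def)
  \<comment> \<open>The rescaled drift part is the power \<open>1 / q\<close> of a difference
    quotient, so its moment of order \<open>P\<close> is one of order \<open>P / q\<close> of the
    quotient; by the growth of \<open>f\<close> this costs order \<open>P\<close> of
    \<open>X\<close> again.\<close>
  define \<rho> where "\<rho> = P / q"
  have \<rho>: "1 \<le> \<rho>" "q * \<rho> = P" using q_ge by (auto simp: \<rho>_def P_def divide_simps)
  obtain C1 where C1: "0 \<le> C1" "\<And>t. t \<in> {0..T} \<Longrightarrow> (\<integral>\<^sup>+w. ennreal (norm (X t w) powr P) \<partial>M) \<le> ennreal C1"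
    using X_moment[OF P(1) X0] by blast
  obtain C2 where C2: "0 \<le> C2" "\<And>s t. 0 \<le> s \<and> s < t \<and> t \<le> T \<Longrightarrow>
          (\<integral>\<^sup>+w. ennreal (norm (J t w - J s w) powr P) \<partial>M) \<le> ennreal (C2 * (t - s) powr (P / 2))"
    using J_moment[OF less_imp_le[OF P(2)]] by blast
  define Ca where "Ca = 2 powr P * (2 powr P * (1 + C1) + C1)"
  define Cb where "Cb = K powr \<rho> * (2 powr P * (1 + C1))"
  have Ca: "0 \<le> Ca" "0 \<le> Cb" using C1 by (auto simp: Ca_def Cb_def)
  show ?thesis
  proof (rule that[of "Ca + Cb + C2"])
    show "0 \<le> Ca + Cb + C2" using Ca C2 by simp
    fix s r assume sr: "0 \<le> s" "s \<le> r" "r \<le> T"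
    have "(\<integral>\<^sup>+w. ennreal ((1 + norm (X s w) + norm (X r w)) powr P) \<partial>M)
      \<le> (\<integral>\<^sup>+w. ennreal (2 powr P) * (ennreal ((1 + norm (X s w)) powr P) + ennreal (norm (X r w) powr P)) \<partial>M)"
    proof (rule nn_integral_mono)
      fix w
      have "ennreal ((1 + norm (X s w) + norm (X r w)) powr P) \<le> ennreal (2 powr P * ((1 + norm (X s w)) powr P + norm (X r w) powr P))"
        using P by (intro ennreal_leI powr_add_le) auto
      then show "ennreal ((1 + norm (X s w) + norm (X r w)) powr P) \<le> ennreal (2 powr P) * (ennreal ((1 + norm (X s w)) powr P) + ennreal (norm (X r w) powr P))"
        by (simp add: ennreal_mult)
    qed
    also have "\<dots> = ennreal (2 powr P) * ((\<integral>\<^sup>+w. ennreal ((1 + norm (X s w)) powr P) \<partial>M) + (\<integral>\<^sup>+w. ennreal (norm (X r w) powr P) \<partial>M))"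
      by (simp add: nn_integral_cmult nn_integral_add)
    also have "\<dots> \<le> ennreal (2 powr P) * (ennreal (2 powr P * (1 + C1)) + ennreal C1)"
    proof (intro mult_left_mono add_mono)
      show "(\<integral>\<^sup>+w. ennreal ((1 + norm (X s w)) powr P) \<partial>M) \<le> ennreal (2 powr P * (1 + C1))"
        by (rule nn_integral_1_plus_powr_le) (use P C1 sr in auto)
      show "(\<integral>\<^sup>+w. ennreal (norm (X r w) powr P) \<partial>M) \<le> ennreal C1" using C1 sr by simp
    qed simp
    also have "\<dots> = ennreal Ca" using C1 by (simp add: Ca_def ennreal_mult)
    also have "\<dots> \<le> ennreal (Ca + Cb + C2)" using Ca C2 by (intro ennreal_leI) auto
    finally show "(\<integral>\<^sup>+w. ennreal ((1 + norm (X s w) + norm (X r w)) powr P) \<partial>M) \<le> ennreal (Ca + Cb + C2)" .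
    have cancel: "(\<integral>\<^sup>+w. ennreal ((Y w / c) powr u) \<partial>M) \<le> ennreal (Ca + Cb + C2)"
      if "(\<integral>\<^sup>+w. ennreal (Y w powr u) \<partial>M) \<le> ennreal (C * c powr u)" "0 < c" "0 \<le> C" "C \<le> Ca + Cb + C2"
        "Y \<in> borel_measurable M" "\<And>w. 0 \<le> Y w" for Y :: "'w \<Rightarrow> real" and c C u
    proof -
      note [measurable] = that(5)
      have "(\<integral>\<^sup>+w. ennreal ((Y w / c) powr u) \<partial>M) = (\<integral>\<^sup>+w. ennreal (1 / c powr u) * ennreal (Y w powr u) \<partial>M)"
        using that by (intro nn_integral_cong) (simp add: ennreal_mult[symmetric] powr_divide)
      also have "\<dots> = ennreal (1 / c powr u) * (\<integral>\<^sup>+w. ennreal (Y w powr u) \<partial>M)"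
        by (rule nn_integral_cmult) measurable
      also have "\<dots> \<le> ennreal (1 / c powr u) * ennreal (C * c powr u)" by (intro mult_left_mono that(1)) auto
      also have "\<dots> = ennreal C" using that by (simp add: ennreal_mult[symmetric])
      also have "\<dots> \<le> ennreal (Ca + Cb + C2)" by (intro ennreal_leI that)
      finally show ?thesis .
    qed
    show "(\<integral>\<^sup>+w. ennreal (((norm (X r w - X s w - (J r w - J s w)) / (r - s)) powr (1 / q)) powr P) \<partial>M) \<le> ennreal (Ca + Cb + C2)"
    proof (cases "s = r")
      case False
      have "(\<integral>\<^sup>+w. ennreal ((norm (X r w - X s w - (J r w - J s w)) / (r - s)) powr \<rho>) \<partial>M) \<le> ennreal (Ca + Cb + C2)"
      proof (rule cancel[of _ _ Cb])
        show "(\<integral>\<^sup>+w. ennreal (norm (X r w - X s w - (J r w - J s w)) powr \<rho>) \<partial>M) \<le> ennreal (Cb * (r - s) powr \<rho>)"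
          using drift_increment_moment[OF \<rho>(1) C1(1), of s r] C1(2) sr False unfolding \<rho>(2) by (simp add: Cb_def)
      qed (use sr False Ca C2 in auto)
      then show ?thesis by (simp add: powr_powr \<rho>_def)
    qed simp
    show "(\<integral>\<^sup>+w. ennreal ((norm (J r w - J s w) / sqrt (r - s)) powr P) \<partial>M) \<le> ennreal (Ca + Cb + C2)"
    proof (cases "s = r")
      case False
      show ?thesis
      proof (rule cancel[of _ _ C2])
        have "(sqrt (r - s)) powr P = (r - s) powr (P / 2)"
          using sr by (simp add: powr_half_sqrt[symmetric] powr_powr)
        then show "(\<integral>\<^sup>+w. ennreal (norm (J r w - J s w) powr P) \<partial>M) \<le> ennreal (C2 * (sqrt (r - s)) powr P)"
          using C2(2)[of s r] sr False by simp
      qed (use sr False Ca C2 in auto)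
    qed simp
  qed
qed

end

section \<open>Orthogonality to the past and the splitting of the local error\<close>

context usual_filtered_prob_space
begin

text \<open>Vanishing means on all sets of \<open>F s\<close> say that the conditional expectation
  of each component of \<open>Z\<close> is 0. Pulling out the known factor then also covers
  unbounded \<open>U\<close>, as long as the product is integrable.\<close>

lemma cond_mean_zero_inner:
  fixes Z :: "'w \<Rightarrow> 'a::euclidean_space"
  assumes s: "s \<in> {0..T}" and Z: "integrable M Z"
    and mean: "\<And>B. B \<in> sets (F s) \<Longrightarrow> (\<integral>w. indicator B w *\<^sub>R Z w \<partial>M) = 0"
    and U: "U \<in> borel_measurable (F s)" and int: "integrable M (\<lambda>w. U w * (Z w \<bullet> e))"
  shows "(\<integral>w. U w * (Z w \<bullet> e) \<partial>M) = 0"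
proof -
  interpret S: finite_measure_subalgebra M "F s"
    by unfold_locales (rule subalgebra_F[OF s])
  have Ze: "integrable M (\<lambda>w. Z w \<bullet> e)" using Z by simp
  have "AE w in M. real_cond_exp M (F s) (\<lambda>w. Z w \<bullet> e) w = 0"
  proof (rule S.real_cond_exp_charact)
    fix B assume B: "B \<in> sets (F s)"
    then have BM: "B \<in> sets M" by (rule sets_F_M[OF s])
    have "integrable M (\<lambda>w. indicator B w *\<^sub>R Z w)" by (rule integrable_mult_indicator[OF BM Z])
    then have "(\<integral>w. (indicator B w *\<^sub>R Z w) \<bullet> e \<partial>M) = (\<integral>w. indicator B w *\<^sub>R Z w \<partial>M) \<bullet> e"
      by (intro integral_inner_left)
    then have "(\<integral>w. (indicator B w *\<^sub>R Z w) \<bullet> e \<partial>M) = 0" by (simp only: mean[OF B] inner_zero_left)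
    then show "set_lebesgue_integral M B (\<lambda>w. Z w \<bullet> e) = set_lebesgue_integral M B (\<lambda>w. 0)"
      by (simp add: set_lebesgue_integral_def)
  qed (use Ze in auto)
  then have "(\<integral>w. U w * real_cond_exp M (F s) (\<lambda>w. Z w \<bullet> e) w \<partial>M) = (\<integral>w. 0 \<partial>M)"
    by (intro integral_cong_AE) (use measurable_F_M[OF s U] in auto)
  then show ?thesis
    using S.real_cond_exp_intg(2)[OF int U] Ze by simp
qed

lemma integrable_mult_of_squares:
  fixes U V :: "'w \<Rightarrow> real"
  assumes [measurable]: "U \<in> borel_measurable M" "V \<in> borel_measurable M"
    and "integrable M (\<lambda>w. (U w)\<^sup>2)" "integrable M (\<lambda>w. (V w)\<^sup>2)"
  shows "integrable M (\<lambda>w. U w * V w)"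
proof (rule Bochner_Integration.integrable_bound)
  show "integrable M (\<lambda>w. (U w)\<^sup>2 + (V w)\<^sup>2)" using assms by simp
  show "AE w in M. norm (U w * V w) \<le> norm ((U w)\<^sup>2 + (V w)\<^sup>2)"
  proof (rule AE_I2)
    fix w
    have "2 * (\<bar>U w\<bar> * \<bar>V w\<bar>) \<le> (U w)\<^sup>2 + (V w)\<^sup>2" using sum_squares_bound[of "\<bar>U w\<bar>" "\<bar>V w\<bar>"] by simp
    moreover have "0 \<le> \<bar>U w\<bar> * \<bar>V w\<bar>" by simp
    ultimately have "\<bar>U w\<bar> * \<bar>V w\<bar> \<le> (U w)\<^sup>2 + (V w)\<^sup>2" by linarith
    then show "norm (U w * V w) \<le> norm ((U w)\<^sup>2 + (V w)\<^sup>2)"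
      by (simp add: abs_mult)
  qed
qed simp

end

context additive_noise_sode
begin

lemma J_increment_square:
  obtains C where "0 \<le> C" "\<And>s t. 0 \<le> s \<Longrightarrow> s \<le> t \<Longrightarrow> t \<le> T \<Longrightarrow>
    (\<integral>\<^sup>+w. ennreal ((norm (J t w - J s w))\<^sup>2) \<partial>M) \<le> ennreal C"
proof -
  obtain C where C: "0 \<le> C" "\<And>s t. 0 \<le> s \<and> s < t \<and> t \<le> T \<Longrightarrow>
          (\<integral>\<^sup>+w. ennreal (norm (J t w - J s w) powr 2) \<partial>M) \<le> ennreal (C * (t - s) powr (2 / 2))"
    using J_moment[of 2] by (metis zero_le_numeral)
  show ?thesis
  proof (rule that)
    show "0 \<le> C * T" using C T_pos by simp
    fix s t assume st: "0 \<le> s" "s \<le> t" "t \<le> T"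
    show "(\<integral>\<^sup>+w. ennreal ((norm (J t w - J s w))\<^sup>2) \<partial>M) \<le> ennreal (C * T)"
    proof (cases "s = t")
      case False
      then have "(\<integral>\<^sup>+w. ennreal ((norm (J t w - J s w))\<^sup>2) \<partial>M) \<le> ennreal (C * (t - s))"
        using C(2)[of s t] st by simp
      also have "\<dots> \<le> ennreal (C * T)" using C(1) st by (intro ennreal_leI mult_left_mono) auto
      finally show ?thesis .
    qed simp
  qed
qed

text \<open>\<open>\<eta>\<close> is the noise that a method adds in one step. Its deviation from
  the true noise may be as large as \<open>(t - s) powr (3 / 2)\<close> in L^2, which sums up
  correctly because the deviation has mean zero given the past.\<close>

definition noise_approximation :: "real \<Rightarrow> real \<Rightarrow> real \<Rightarrow> ('w \<Rightarrow> 'a) \<Rightarrow> bool" where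
  "noise_approximation c s t \<eta> \<longleftrightarrow> \<eta> \<in> borel_measurable (F t) \<and>
     (\<integral>\<^sup>+w. ennreal ((norm (J t w - J s w - \<eta> w))\<^sup>2) \<partial>M) \<le> ennreal (c * (t - s)^3) \<and>
     (\<forall>B\<in>sets (F s). (\<integral>w. indicator B w *\<^sub>R (J t w - J s w - \<eta> w) \<partial>M) = 0)"

text \<open>In one step of the exact solution, \<open>b\<close> is the drift error and \<open>m\<close> the noise error, which has
  mean zero given the past.\<close>

definition local_error_bound :: "real \<Rightarrow> real \<Rightarrow> real \<Rightarrow> ('w \<Rightarrow> 'a) \<Rightarrow> bool" where
  "local_error_bound C s t \<eta> \<longleftrightarrow>
     (\<exists>b m. b \<in> borel_measurable M \<and> m \<in> borel_measurable M \<and>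
        (\<forall>w. X t w = X s w + (t - s) *\<^sub>R f s (X s w) + b w + m w + \<eta> w) \<and>
        (\<integral>\<^sup>+w. ennreal ((norm (b w))\<^sup>2) \<partial>M) \<le> ennreal (C * (t - s)^4) \<and>
        (\<integral>\<^sup>+w. ennreal ((norm (m w))\<^sup>2) \<partial>M) \<le> ennreal (C * (t - s)^3) \<and>
        (\<forall>Y. Y \<in> borel_measurable (F s) \<longrightarrow> integrable M (\<lambda>w. (norm (Y w))\<^sup>2) \<longrightarrow>
          (\<integral>w. Y w \<bullet> m w \<partial>M) = 0))"

text \<open>The constant is uniform in the step and in \<open>\<eta>\<close>, as the recursion over
  arbitrary grids demands. The powers arise as follows: integrating over a step gives
  \<open>h\<^sup>2\<close> in mean square, and the integrands contribute \<open>h\<^sup>2\<close>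
  for \<open>b\<close> and \<open>h\<close> for the Jacobian part of \<open>m\<close>.\<close>

lemma local_error:
  assumes X0: "(\<integral>\<^sup>+w. ennreal (norm (X 0 w) powr (6 * q - 4)) \<partial>M) < \<infinity>" and c: "0 \<le> c"
  obtains C where "0 \<le> C"
    "\<And>s t \<eta>. 0 \<le> s \<Longrightarrow> s < t \<Longrightarrow> t \<le> T \<Longrightarrow> noise_approximation c s t \<eta> \<Longrightarrow> local_error_bound C s t \<eta>"
proof -
  define P where "P = 6 * q - 4"
  obtain C0 where C0: "0 \<le> C0"
    and mV: "\<And>s r. 0 \<le> s \<Longrightarrow> s \<le> r \<Longrightarrow> r \<le> T \<Longrightarrow>
       (\<integral>\<^sup>+w. ennreal ((1 + norm (X s w) + norm (X r w)) powr P) \<partial>M) \<le> ennreal C0"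
    and mD: "\<And>s r. 0 \<le> s \<Longrightarrow> s \<le> r \<Longrightarrow> r \<le> T \<Longrightarrow>
       (\<integral>\<^sup>+w. ennreal (((norm (X r w - X s w - (J r w - J s w)) / (r - s)) powr (1 / q)) powr P) \<partial>M) \<le> ennreal C0"
    and mJ: "\<And>s r. 0 \<le> s \<Longrightarrow> s \<le> r \<Longrightarrow> r \<le> T \<Longrightarrow>
       (\<integral>\<^sup>+w. ennreal ((norm (J r w - J s w) / sqrt (r - s)) powr P) \<partial>M) \<le> ennreal C0"
    by (rule scaled_moments[OF X0, folded P_def]) (rule that; assumption)
  define Cb where "Cb = 4 * K\<^sup>2 * (6 + 4 * T\<^sup>2) * (3 * C0)"
  define Cm where "Cm = K\<^sup>2 * (2 * C0)"
  define C where "C = Cb + (2 * Cm + 2 * c)"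
  have CC: "0 \<le> Cb" "0 \<le> Cm" using C0 by (auto simp: Cb_def Cm_def)
  show ?thesis
  proof (rule that)
    show "0 \<le> C" using CC c by (simp add: C_def)
    fix s t \<eta>
    assume st: "0 \<le> s" "s < t" "t \<le> T" and \<eta>a: "noise_approximation c s t \<eta>"
    have sT: "s \<in> {0..T}" "t \<in> {0..T}" using st by auto
    have \<eta>m [measurable]: "\<eta> \<in> borel_measurable M"
      and \<eta>: "(\<integral>\<^sup>+w. ennreal ((norm (J t w - J s w - \<eta> w))\<^sup>2) \<partial>M) \<le> ennreal (c * (t - s)^3)"
      and \<eta>0: "\<forall>B\<in>sets (F s). (\<integral>w. indicator B w *\<^sub>R (J t w - J s w - \<eta> w) \<partial>M) = 0"
      using \<eta>a measurable_F_M[OF sT(2)] unfolding noise_approximation_def by blast+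
    define h where "h = t - s"
    have h: "0 < h" "h \<le> T" using st by (auto simp: h_def)
    interpret A: linear "A s x" for x by (rule A_linear[OF sT(1)])
    have Abl: "bounded_linear (A s x)" for x
      using A_linear[OF sT(1)] by (simp add: linear_conv_bounded_linear)
    \<comment> \<open>The Lebesgue form makes \<open>N\<close> measurable and accessible to Fubini;
      on each path it agrees with the integral used for the equation.\<close>
    define N where "N w = (\<integral>r. indicator {s..t} r *\<^sub>R (J r w - J s w) \<partial>lborel)" for w
    have N_eq: "N w = integral {s..t} (\<lambda>r. J r w - J s w)"
      and Jc: "continuous_on {s..t} (\<lambda>r. J r w - J s w)" if w: "w \<in> space M" for w
    proof -
      show c: "continuous_on {s..t} (\<lambda>r. J r w - J s w)"
        by (intro continuous_intros continuous_on_subset[OF J_continuous[OF w]]) (use st in auto)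
      show "N w = integral {s..t} (\<lambda>r. J r w - J s w)"
        using set_borel_integral_eq_integral(2)[OF borel_integrable_atLeastAtMost'[OF c]]
        by (simp add: N_def set_lebesgue_integral_def)
    qed
    have Nm [measurable]: "N \<in> borel_measurable M"
    proof -
      have "(\<lambda>x. indicator {s..t} (snd x) *\<^sub>R (J (snd x) (fst x) - J s (fst x))) \<in> borel_measurable (M \<Otimes>\<^sub>M lborel)"
        by measurable
      then show ?thesis unfolding N_def by measurable
    qed
    have XF: "X s \<in> borel_measurable (F s)" by (rule X_adapted[OF sT(1)])
    have Ae: "(\<lambda>w. A s (X s w) e) \<in> borel_measurable (F s)" for e
      using measurable_compose[OF XF borel_measurable_continuous_onI[OF A_continuous[OF sT(1)]]] .
    have Aem [measurable]: "(\<lambda>w. A s (X s w) e) \<in> borel_measurable M" for e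
      using measurable_F_M[OF sT(1) Ae] .
    \<comment> \<open>Separates coefficients that are known at time \<open>s\<close> from the
      coordinates of the argument, the form to which \<open>cond_mean_zero_inner\<close>
      applies.\<close>
    have A_expand: "A s x v = (\<Sum>e\<in>Basis. (v \<bullet> e) *\<^sub>R A s x e)" for x v
    proof -
      have "A s x v = A s x (\<Sum>e\<in>Basis. (v \<bullet> e) *\<^sub>R e)" by (simp add: euclidean_representation)
      then show ?thesis by (simp add: A.sum A.scale)
    qed
    define m0 where "m0 w = A s (X s w) (N w)" for w
    have m0m [measurable]: "m0 \<in> borel_measurable M"
      unfolding m0_def by (subst A_expand) measurable
    have fm [measurable]: "(\<lambda>w. f s (X s w)) \<in> borel_measurable M"
    proof -
      have "continuous_on UNIV (\<lambda>x. (\<lambda>(t, x). f t x) (s, x))"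
        by (rule continuous_on_compose2[OF f_continuous]) (use sT in \<open>auto intro!: continuous_intros\<close>)
      then have "f s \<in> borel_measurable borel" by (simp add: borel_measurable_continuous_onI)
      then show ?thesis by (rule measurable_compose[OF X_measurable])
    qed
    define m where "m w = m0 w + (J t w - J s w - \<eta> w)" for w
    \<comment> \<open>Defined as the remainder, so that the decomposition holds for every
      \<open>w\<close>; the equation enters only in its representation as a time integral, which
      holds almost surely.\<close>
    define b where "b w = X t w - X s w - (J t w - J s w) - h *\<^sub>R f s (X s w) - m0 w" for w
    have bm: "b \<in> borel_measurable M" "m \<in> borel_measurable M" unfolding b_def m_def by measurable
    have decomp: "X t w = X s w + (t - s) *\<^sub>R f s (X s w) + b w + m w + \<eta> w" for w
      by (simp add: b_def m_def h_def)
    define V where "V r w = (1 + norm (X s w) + norm (X r w)) powr P" for r w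
    define D where "D r w = ((norm (X r w - X s w - (J r w - J s w)) / (r - s)) powr (1 / q)) powr P" for r w
    define I where "I r w = (norm (J r w - J s w) / sqrt (r - s)) powr P" for r w
    have VDI: "(\<lambda>x. V (fst x) (snd x)) \<in> borel_measurable (borel \<Otimes>\<^sub>M M)"
      "(\<lambda>x. D (fst x) (snd x)) \<in> borel_measurable (borel \<Otimes>\<^sub>M M)"
      "(\<lambda>x. I (fst x) (snd x)) \<in> borel_measurable (borel \<Otimes>\<^sub>M M)"
      unfolding V_def D_def I_def by measurable
    note [measurable] = VDI
    have VDI' [measurable]: "V r \<in> borel_measurable M" "D r \<in> borel_measurable M" "I r \<in> borel_measurable M" for r
      unfolding V_def D_def I_def by measurable
    have nn: "0 \<le> V r w" "0 \<le> D r w" "0 \<le> I r w" for r w by (auto simp: V_def D_def I_def)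
    have E: "(\<integral>\<^sup>+w. ennreal (V r w) \<partial>M) \<le> ennreal C0" "(\<integral>\<^sup>+w. ennreal (D r w) \<partial>M) \<le> ennreal C0"
      "(\<integral>\<^sup>+w. ennreal (I r w) \<partial>M) \<le> ennreal C0" if "r \<in> {s..t}" for r
      unfolding V_def D_def I_def using mV[of s r] mD[of s r] mJ[of s r] st that by auto
    \<comment> \<open>Uniform in \<open>r\<close>, since \<open>r - s \<le> h\<close>. The time
      integral contributes another \<open>h\<^sup>2\<close>, which makes
      \<open>h ^ 4\<close>.\<close>
    define kb where "kb = 4 * K\<^sup>2 * (6 + 4 * T\<^sup>2) * h\<^sup>2"
    have kb: "0 \<le> kb" by (simp add: kb_def)
    define gb where "gb x = kb * (V (fst x) (snd x) + D (fst x) (snd x) + I (fst x) (snd x))" for x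
    have gbm: "gb \<in> borel_measurable (borel \<Otimes>\<^sub>M M)" unfolding gb_def by measurable
    have b_bound: "(\<integral>\<^sup>+w. ennreal ((norm (b w))\<^sup>2) \<partial>M) \<le> ennreal (Cb * h^4)"
    proof -
      let ?k = "\<lambda>r w. f r (X r w) - f s (X s w) - A s (X s w) (J r w - J s w)"
      have "(\<integral>\<^sup>+w. ennreal (norm (b w) powr 2) \<partial>M) \<le> ennreal (kb * (3 * C0) * (t - s) powr 2)"
      proof (rule nn_integral_time_integral_le[OF st(2) _ gbm])
        show "AE w in M. continuous_on {s..t} (\<lambda>r. ?k r w) \<and> b w = integral {s..t} (\<lambda>r. ?k r w) \<and>
            (\<forall>r\<in>{s..t}. norm (?k r w) powr 2 \<le> gb (r, w))"
          using sode_increment AE_space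
        proof eventually_elim
          case (elim w)
          have eq: "X t w - X s w - (J t w - J s w) = integral {s..t} (\<lambda>u. f u (X u w))"
            using elim(1) st by auto
          have fc: "continuous_on {s..t} (\<lambda>u. f u (X u w))"
            by (rule continuous_on_drift, rule continuous_on_subset[OF X_continuous[OF elim(2)]]) (use st in auto)
          have Ac: "continuous_on {s..t} (\<lambda>r. A s (X s w) (J r w - J s w))"
            by (rule bounded_linear.continuous_on[OF Abl Jc[OF elim(2)]])
          have kc: "continuous_on {s..t} (\<lambda>r. ?k r w)" by (intro continuous_intros fc Ac)
          have "integral {s..t} (\<lambda>r. A s (X s w) (J r w - J s w)) = m0 w"
            unfolding m0_def N_eq[OF elim(2)]
            using integral_linear[OF integrable_continuous_real[OF Jc[OF elim(2)]] Abl] by (simp add: o_def)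
          moreover have "integral {s..t} (\<lambda>r. ?k r w) = integral {s..t} (\<lambda>u. f u (X u w)) - integral {s..t} (\<lambda>u. f s (X s w))
              - integral {s..t} (\<lambda>r. A s (X s w) (J r w - J s w))"
            by (subst Henstock_Kurzweil_Integration.integral_diff[symmetric]
                | intro integrable_diff integrable_continuous_real fc Ac continuous_on_const refl)+
          ultimately have bk: "b w = integral {s..t} (\<lambda>r. ?k r w)"
            unfolding b_def eq using h st by (simp add: h_def)
          have "norm (?k r w) powr 2 \<le> gb (r, w)" if "r \<in> {s..t}" for r
          proof (cases "r = s")
            case True
            then show ?thesis using kb nn by (simp add: A.zero gb_def)
          next
            case False
            then have r: "s < r" "r \<le> T" "r - s \<le> h" using that st by (auto simp: h_def)
            have "(norm (?k r w))\<^sup>2 \<le> 4 * K\<^sup>2 * (6 + 4 * T\<^sup>2) * (r - s)\<^sup>2 * (V r w + D r w + I r w)"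
              unfolding V_def D_def I_def P_def by (rule local_error_integrand_le(1)[OF st(1) r(1,2)])
            also have "\<dots> \<le> kb * (V r w + D r w + I r w)"
              unfolding kb_def using nn r by (intro mult_right_mono mult_left_mono power_mono add_nonneg_nonneg) auto
            finally show ?thesis by (simp add: gb_def)
          qed
          then show ?case using kc bk by blast
        qed
        show "0 \<le> kb * (3 * C0)" using kb C0 by simp
        fix r assume r: "r \<in> {s..t}"
        have "(\<integral>\<^sup>+w. ennreal (gb (r, w)) \<partial>M) = ennreal kb * ((\<integral>\<^sup>+w. ennreal (V r w) \<partial>M) + (\<integral>\<^sup>+w. ennreal (D r w) \<partial>M) + (\<integral>\<^sup>+w. ennreal (I r w) \<partial>M))"
          using kb nn by (simp add: gb_def ennreal_mult nn_integral_cmult nn_integral_add)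
        also have "\<dots> \<le> ennreal kb * (ennreal C0 + ennreal C0 + ennreal C0)"
          by (intro mult_left_mono add_mono E r) simp
        also have "\<dots> = ennreal (kb * (3 * C0))"
          using kb C0 by (simp add: ennreal_mult[symmetric] ennreal_plus[symmetric] del: ennreal_plus)
        finally show "(\<integral>\<^sup>+w. ennreal (gb (r, w)) \<partial>M) \<le> ennreal (kb * (3 * C0))" .
      qed simp
      moreover have "kb * (3 * C0) * (t - s) powr 2 = Cb * h^4"
        using h by (simp add: kb_def Cb_def h_def[symmetric] power2_eq_square power4_eq_xxxx)
      ultimately show ?thesis by simp
    qed
    \<comment> \<open>A common majorant: by growth of the Jacobian it dominates \<open>m0\<close>,
      and because its weight is at least 1 it dominates \<open>N\<close> as well.\<close>
    define G where "G w = K * (1 + norm (X s w)) powr (q - 1) * norm (N w)" for w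
    have Gm [measurable]: "G \<in> borel_measurable M" unfolding G_def by measurable
    have G_bound: "(\<integral>\<^sup>+w. ennreal ((G w)\<^sup>2) \<partial>M) \<le> ennreal (Cm * h^3)"
    proof -
      define km where "km = K\<^sup>2 * h"
      have km: "0 \<le> km" using h by (simp add: km_def)
      define gm where "gm x = km * (V (fst x) (snd x) + I (fst x) (snd x))" for x
      have gmm: "gm \<in> borel_measurable (borel \<Otimes>\<^sub>M M)" unfolding gm_def by measurable
      define a where "a w = K * (1 + norm (X s w)) powr (q - 1)" for w
      have a0: "0 \<le> a w" for w using K_ge by (simp add: a_def)
      have "(\<integral>\<^sup>+w. ennreal (norm (a w *\<^sub>R N w) powr 2) \<partial>M) \<le> ennreal (km * (2 * C0) * (t - s) powr 2)"
      proof (rule nn_integral_time_integral_le[OF st(2) _ gmm])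
        show "AE w in M. continuous_on {s..t} (\<lambda>r. a w *\<^sub>R (J r w - J s w)) \<and>
            a w *\<^sub>R N w = integral {s..t} (\<lambda>r. a w *\<^sub>R (J r w - J s w)) \<and>
            (\<forall>r\<in>{s..t}. norm (a w *\<^sub>R (J r w - J s w)) powr 2 \<le> gm (r, w))"
          using AE_space
        proof eventually_elim
          case (elim w)
          have "norm (a w *\<^sub>R (J r w - J s w)) powr 2 \<le> gm (r, w)" if "r \<in> {s..t}" for r
          proof (cases "r = s")
            case True
            then show ?thesis using km nn by (simp add: gm_def)
          next
            case False
            then have r: "s < r" "r \<le> T" "r - s \<le> h" using that st by (auto simp: h_def)
            have "norm (a w *\<^sub>R (J r w - J s w)) powr 2 = (a w * norm (J r w - J s w))\<^sup>2"
              using a0[of w] by simp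
            also have "\<dots> \<le> K\<^sup>2 * (r - s) * (V r w + I r w)"
              unfolding V_def I_def P_def a_def by (rule local_error_integrand_le(2)[OF st(1) r(1,2)])
            also have "\<dots> \<le> km * (V r w + I r w)"
              unfolding km_def using nn r by (intro mult_right_mono mult_left_mono add_nonneg_nonneg) auto
            finally show ?thesis by (simp add: gm_def)
          qed
          moreover have "continuous_on {s..t} (\<lambda>r. a w *\<^sub>R (J r w - J s w))"
            by (intro continuous_intros Jc[OF elim])
          ultimately show ?case unfolding N_eq[OF elim] by simp
        qed
        show "0 \<le> km * (2 * C0)" using km C0 by simp
        fix r assume r: "r \<in> {s..t}"
        have "(\<integral>\<^sup>+w. ennreal (gm (r, w)) \<partial>M) = ennreal km * ((\<integral>\<^sup>+w. ennreal (V r w) \<partial>M) + (\<integral>\<^sup>+w. ennreal (I r w) \<partial>M))"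
          using km nn by (simp add: gm_def ennreal_mult nn_integral_cmult nn_integral_add)
        also have "\<dots> \<le> ennreal km * (ennreal C0 + ennreal C0)"
          by (intro mult_left_mono add_mono E r) simp
        also have "\<dots> = ennreal (km * (2 * C0))"
          using km C0 by (simp add: ennreal_mult[symmetric] ennreal_plus[symmetric] del: ennreal_plus)
        finally show "(\<integral>\<^sup>+w. ennreal (gm (r, w)) \<partial>M) \<le> ennreal (km * (2 * C0))" .
      qed simp
      moreover have "norm (a w *\<^sub>R N w) powr 2 = (G w)\<^sup>2" for w
        using a0[of w] by (simp add: G_def a_def[symmetric])
      moreover have "km * (2 * C0) * (t - s) powr 2 = Cm * h^3"
        using h by (simp add: km_def Cm_def h_def[symmetric] power2_eq_square power3_eq_cube)
      ultimately show ?thesis by simp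
    qed
    have m0G: "norm (m0 w) \<le> G w" for w
      unfolding m0_def G_def by (rule A_growth[OF sT(1)])
    have m_bound: "(\<integral>\<^sup>+w. ennreal ((norm (m w))\<^sup>2) \<partial>M) \<le> ennreal ((2 * Cm + 2 * c) * h^3)"
    proof -
      have "(\<integral>\<^sup>+w. ennreal ((norm (m w))\<^sup>2) \<partial>M)
        \<le> (\<integral>\<^sup>+w. 2 * ennreal ((G w)\<^sup>2) + 2 * ennreal ((norm (J t w - J s w - \<eta> w))\<^sup>2) \<partial>M)"
      proof (rule nn_integral_mono)
        fix w
        have "ennreal ((norm (m0 w))\<^sup>2) \<le> ennreal ((G w)\<^sup>2)"
          by (intro ennreal_leI power_mono m0G) simp
        then show "ennreal ((norm (m w))\<^sup>2) \<le> 2 * ennreal ((G w)\<^sup>2) + 2 * ennreal ((norm (J t w - J s w - \<eta> w))\<^sup>2)"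
          unfolding m_def by (rule order_trans[OF ennreal_norm_add_sq_le add_right_mono[OF mult_left_mono]]) simp
      qed
      also have "\<dots> = 2 * (\<integral>\<^sup>+w. ennreal ((G w)\<^sup>2) \<partial>M) + 2 * (\<integral>\<^sup>+w. ennreal ((norm (J t w - J s w - \<eta> w))\<^sup>2) \<partial>M)"
        by (simp add: nn_integral_add nn_integral_cmult)
      also have "\<dots> \<le> 2 * ennreal (Cm * h^3) + 2 * ennreal (c * h^3)"
        by (intro add_mono mult_left_mono G_bound \<eta>[folded h_def]) auto
      also have "\<dots> = ennreal ((2 * Cm + 2 * c) * h^3)"
        using CC c h by (simp add: ennreal_mult distrib_right mult.assoc)
      finally show ?thesis .
    qed
    have Nmean: "integrable M N" "(\<integral>w. indicator B w *\<^sub>R N w \<partial>M) = 0" if B: "B \<in> sets (F s)" for B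
    proof -
      have BM [measurable]: "B \<in> sets M" by (rule sets_F_M[OF sT(1) B])
      interpret Pr: pair_sigma_finite M lborel ..
      let ?g = "\<lambda>(w, r). indicator B w *\<^sub>R (indicator {s..t} r *\<^sub>R (J r w - J s w))"
      have gm: "?g \<in> borel_measurable (M \<Otimes>\<^sub>M lborel)" by measurable
      have gint: "integrable (M \<Otimes>\<^sub>M lborel) ?g"
      proof (rule integrableI_bounded[OF gm])
        \<comment> \<open>The bound \<open>x \<le> 1 + x\<^sup>2\<close> reduces integrability on
          the product space to the second moments of the increments of \<open>J\<close>.\<close>
        define gj where "gj x = ennreal (1 + (norm (J (fst x) (snd x) - J s (snd x)))\<^sup>2)" for x
        have gjm [measurable]: "gj \<in> borel_measurable (borel \<Otimes>\<^sub>M M)" unfolding gj_def by measurable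
        obtain C2 where C2: "0 \<le> C2" "\<And>s t. 0 \<le> s \<Longrightarrow> s \<le> t \<Longrightarrow> t \<le> T \<Longrightarrow>
          (\<integral>\<^sup>+w. ennreal ((norm (J t w - J s w))\<^sup>2) \<partial>M) \<le> ennreal C2"
          by (rule J_increment_square) (rule that; assumption)
        have gjE: "(\<integral>\<^sup>+w. gj (r, w) \<partial>M) \<le> ennreal (1 + C2)" if r: "r \<in> {s..t}" for r
          using add_left_mono[OF C2(2)[of s r], of 1] C2(1) r st
          by (simp add: gj_def nn_integral_add emeasure_space_1)
        have "(\<integral>\<^sup>+x. ennreal (norm (?g x)) \<partial>(M \<Otimes>\<^sub>M lborel)) = (\<integral>\<^sup>+w. \<integral>\<^sup>+r. ennreal (norm (?g (w, r))) \<partial>lborel \<partial>M)"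
          by (rule lborel.nn_integral_fst[symmetric]) (use gm in measurable)
        also have "\<dots> \<le> (\<integral>\<^sup>+w. (\<integral>\<^sup>+r\<in>{s..t}. gj (r, w) \<partial>lborel) \<partial>M)"
        proof (intro nn_integral_mono)
          fix w r
          show "ennreal (norm (?g (w, r))) \<le> gj (r, w) * indicator {s..t} r"
            by (auto simp: gj_def indicator_def self_le_one_plus_square simp del: ennreal_plus intro!: ennreal_leI)
        qed
        also have "\<dots> \<le> ennreal (1 + C2) * ennreal (t - s)"
          by (rule nn_integral_time_le[OF gjm]) (use st gjE in auto)
        also have "\<dots> < \<infinity>" by (simp add: ennreal_mult_less_top)
        finally show "(\<integral>\<^sup>+x. ennreal (norm (?g x)) \<partial>(M \<Otimes>\<^sub>M lborel)) < \<infinity>" .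
      qed
      have inner: "(\<integral>r. ?g (w, r) \<partial>lborel) = indicator B w *\<^sub>R N w" for w
        by (cases "w \<in> B") (auto simp: N_def)
      have z: "(\<integral>w. ?g (w, r) \<partial>M) = 0" for r
      proof (cases "r \<in> {s..t}")
        case True
        then show ?thesis using J_mean[of s r B] B st by simp
      qed simp
      \<comment> \<open>Fubini takes the mean at each fixed time \<open>r\<close>, where it vanishes
        because \<open>B\<close> belongs to the past of \<open>s \<le> r\<close>.\<close>
      have "(\<integral>w. indicator B w *\<^sub>R N w \<partial>M) = (\<integral>w. (\<integral>r. ?g (w, r) \<partial>lborel) \<partial>M)" unfolding inner ..
      also have "\<dots> = (\<integral>r. (\<integral>w. ?g (w, r) \<partial>M) \<partial>lborel)"
        using Pr.Fubini_integral[of "\<lambda>w r. ?g (w, r)"] gint by (simp add: case_prod_beta')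
      also have "\<dots> = 0" unfolding z by simp
      finally show "(\<integral>w. indicator B w *\<^sub>R N w \<partial>M) = 0" .
    next
      show "integrable M N"
      proof (rule integrable_norm_sq_imp_integrable[OF Nm], rule Bochner_Integration.integrable_bound)
        show "integrable M (\<lambda>w. (G w)\<^sup>2)"
          using integrable_norm_sq[OF Gm] G_bound by simp
        show "AE w in M. norm ((norm (N w))\<^sup>2) \<le> norm ((G w)\<^sup>2)"
        proof (rule AE_I2)
          fix w
          have "1 * 1 \<le> K * (1 + norm (X s w)) powr (q - 1)"
            using K_ge q_ge by (intro mult_mono ge_one_powr_ge_zero) auto
          then have "1 * norm (N w) \<le> G w" unfolding G_def by (intro mult_right_mono) auto
          then show "norm ((norm (N w))\<^sup>2) \<le> norm ((G w)\<^sup>2)" by (simp add: power_mono)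
        qed
      qed simp
    qed
    have orth: "(\<integral>w. Y w \<bullet> m w \<partial>M) = 0" if Y: "Y \<in> borel_measurable (F s)" "integrable M (\<lambda>w. (norm (Y w))\<^sup>2)" for Y
    proof -
      have Ym [measurable]: "Y \<in> borel_measurable M" by (rule measurable_F_M[OF sT(1) Y(1)])
      let ?Z = "\<lambda>w. J t w - J s w - \<eta> w"
      have Zm: "?Z \<in> borel_measurable M" by measurable
      have Z2: "integrable M (\<lambda>w. (norm (?Z w))\<^sup>2)" by (rule integrable_norm_sq[OF Zm \<eta>])
      have Zi: "integrable M ?Z" by (rule integrable_norm_sq_imp_integrable[OF Zm Z2])
      have G2: "integrable M (\<lambda>w. (G w)\<^sup>2)"
        using integrable_norm_sq[OF Gm] G_bound by simp
      have comp: "integrable M (\<lambda>w. (u w \<bullet> e)\<^sup>2)"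
        if "e \<in> Basis" "integrable M (\<lambda>w. (norm (u w))\<^sup>2)" "u \<in> borel_measurable M" for u and e :: 'a
      proof (rule Bochner_Integration.integrable_bound[OF that(2)])
        show "(\<lambda>w. (u w \<bullet> e)\<^sup>2) \<in> borel_measurable M" using that(3) by measurable
        show "AE w in M. norm ((u w \<bullet> e)\<^sup>2) \<le> norm ((norm (u w))\<^sup>2)"
          by (rule AE_I2) (use Basis_le_norm[OF that(1)] in \<open>auto simp: power2_le_iff_abs_le\<close>)
      qed
      have 1: "integrable M (\<lambda>w. (Y w \<bullet> e) * (?Z w \<bullet> e))" "(\<integral>w. (Y w \<bullet> e) * (?Z w \<bullet> e) \<partial>M) = 0"
        if e: "e \<in> Basis" for e
      proof -
        show i: "integrable M (\<lambda>w. (Y w \<bullet> e) * (?Z w \<bullet> e))"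
          by (rule integrable_mult_of_squares) (use comp[OF e Y(2) Ym] comp[OF e Z2 Zm] in auto)
        show "(\<integral>w. (Y w \<bullet> e) * (?Z w \<bullet> e) \<partial>M) = 0"
          by (rule cond_mean_zero_inner[OF sT(1) Zi \<eta>0[rule_format] _ i]) (use Y in auto)
      qed
      have 2: "integrable M (\<lambda>w. (Y w \<bullet> A s (X s w) e) * (N w \<bullet> e))"
         "(\<integral>w. (Y w \<bullet> A s (X s w) e) * (N w \<bullet> e) \<partial>M) = 0" if e: "e \<in> Basis" for e
      proof -
        show i: "integrable M (\<lambda>w. (Y w \<bullet> A s (X s w) e) * (N w \<bullet> e))"
        proof (rule Bochner_Integration.integrable_bound)
          show "integrable M (\<lambda>w. norm (Y w) * G w)"
            by (rule integrable_mult_of_squares) (use Y G2 in auto)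
          show "AE w in M. norm ((Y w \<bullet> A s (X s w) e) * (N w \<bullet> e)) \<le> norm (norm (Y w) * G w)"
          proof (rule AE_I2)
            fix w
            have "\<bar>Y w \<bullet> A s (X s w) e\<bar> * \<bar>N w \<bullet> e\<bar>
              \<le> (norm (Y w) * (K * (1 + norm (X s w)) powr (q - 1))) * norm (N w)"
            proof (intro mult_mono)
              have "\<bar>Y w \<bullet> A s (X s w) e\<bar> \<le> norm (Y w) * norm (A s (X s w) e)" by (rule Cauchy_Schwarz_ineq2)
              also have "\<dots> \<le> norm (Y w) * (K * (1 + norm (X s w)) powr (q - 1) * norm e)"
                by (intro mult_left_mono A_growth sT) simp
              finally show "\<bar>Y w \<bullet> A s (X s w) e\<bar> \<le> norm (Y w) * (K * (1 + norm (X s w)) powr (q - 1))"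
                using e by simp
            qed (use Basis_le_norm[OF e] K_ge in auto)
            then show "norm ((Y w \<bullet> A s (X s w) e) * (N w \<bullet> e)) \<le> norm (norm (Y w) * G w)"
              using K_ge by (simp add: G_def abs_mult mult.assoc)
          qed
        qed measurable
        show "(\<integral>w. (Y w \<bullet> A s (X s w) e) * (N w \<bullet> e) \<partial>M) = 0"
        proof (rule cond_mean_zero_inner[OF sT(1) Nmean(1) Nmean(2) _ i])
          \<comment> \<open>Integrability of \<open>N\<close> was proved together with its mean
            under \<open>B \<in> sets (F s)\<close>; the empty set serves as
            \<open>B\<close>.\<close>
          show "{} \<in> sets (F s)" by simp
          show "(\<lambda>w. Y w \<bullet> A s (X s w) e) \<in> borel_measurable (F s)" using Y(1) Ae by simp
        qed
      qed
      have "Y w \<bullet> m w = (\<Sum>e\<in>Basis. (Y w \<bullet> A s (X s w) e) * (N w \<bullet> e)) + (\<Sum>e\<in>Basis. (Y w \<bullet> e) * (?Z w \<bullet> e))" for w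
      proof -
        have "Y w \<bullet> m0 w = (\<Sum>e\<in>Basis. (Y w \<bullet> A s (X s w) e) * (N w \<bullet> e))"
          unfolding m0_def by (subst A_expand) (simp add: inner_sum_right mult.commute)
        moreover have "Y w \<bullet> ?Z w = (\<Sum>e\<in>Basis. (Y w \<bullet> e) * (?Z w \<bullet> e))"
          by (rule euclidean_inner)
        ultimately show ?thesis by (simp add: m_def inner_add_right)
      qed
      then show ?thesis using 1 2 by simp
    qed
    have "(\<integral>\<^sup>+w. ennreal ((norm (b w))\<^sup>2) \<partial>M) \<le> ennreal (C * (t - s)^4)"
      by (rule order_trans[OF b_bound]) (use CC c h in \<open>auto simp: C_def h_def intro!: ennreal_leI mult_right_mono\<close>)
    moreover have "(\<integral>\<^sup>+w. ennreal ((norm (m w))\<^sup>2) \<partial>M) \<le> ennreal (C * (t - s)^3)"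
      by (rule order_trans[OF m_bound]) (use CC c h in \<open>auto simp: C_def h_def intro!: ennreal_leI mult_right_mono\<close>)
    ultimately show "local_error_bound C s t \<eta>"
      unfolding local_error_bound_def
      using bm decomp orth by blast
  qed
qed

end

section \<open>Convergence of one-step methods\<close>

lemma grid_simps: "grid h 0 = 0" "grid h (Suc n) = grid h n + h (Suc n)"
  by (simp_all add: grid_def)

lemma step_sizes_pos: "step_sizes T hbar N h \<Longrightarrow> i \<in> {1..N} \<Longrightarrow> 0 < h i"
  by (simp add: step_sizes_def)

lemma grid_mono:
  assumes "step_sizes T hbar N h" "m \<le> n" "n \<le> N"
  shows "grid h m \<le> grid h n"
  using assms(2,3)
proof (induction n rule: dec_induct)
  case (step n)
  then show ?case using step_sizes_pos[OF assms(1), of "Suc n"] by (simp add: grid_simps)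
qed simp

lemma grid_bounds:
  assumes "step_sizes T hbar N h" "n \<le> N"
  shows "0 \<le> grid h n" "grid h n \<le> T"
proof -
  show "0 \<le> grid h n" using grid_mono[OF assms(1), of 0 n] assms(2) by (simp add: grid_simps)
  have "grid h N = T" using assms(1) by (simp add: step_sizes_def grid_def)
  then show "grid h n \<le> T" using grid_mono[OF assms(1), of n N] assms(2) by simp
qed

lemma step_le_max_step: "i \<in> {1..N} \<Longrightarrow> h i \<le> max_step N h"
  by (simp add: max_step_def)

lemma max_step_pos:
  assumes "step_sizes T hbar N h"
  shows "0 < max_step N h"
proof -
  have "1 \<in> {1..N}" using assms by (auto simp: step_sizes_def)
  then show ?thesis using step_le_max_step[of 1 N h] step_sizes_pos[OF assms, of 1] by simp
qed

text \<open>The stability estimate itself makes the one-step maps continuous and hence measurable;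
  this covers the implicit map, which is given by a \<open>THE\<close>.\<close>

lemma continuous_on_of_norm_sq_le:
  fixes \<Phi> :: "'a::real_normed_vector \<Rightarrow> 'b::real_normed_vector"
  assumes "\<And>x y. (norm (\<Phi> x - \<Phi> y))\<^sup>2 \<le> c * (norm (x - y))\<^sup>2" "0 \<le> c"
  shows "continuous_on UNIV \<Phi>"
proof (rule lipschitz_on_continuous_on)
  show "(sqrt c)-lipschitz_on UNIV \<Phi>"
  proof (rule lipschitz_onI)
    fix x y
    have "sqrt ((norm (\<Phi> x - \<Phi> y))\<^sup>2) \<le> sqrt (c * (norm (x - y))\<^sup>2)"
      using assms(1)[of x y] by (simp only: real_sqrt_le_iff)
    then show "dist (\<Phi> x) (\<Phi> y) \<le> sqrt c * dist x y"
      by (simp add: dist_norm real_sqrt_mult)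
  qed (use assms in simp)
qed

context usual_filtered_prob_space
begin

lemma expectation_norm_sq_le:
  fixes Y :: "'w \<Rightarrow> 'a::euclidean_space"
  assumes "Y \<in> borel_measurable M" "(\<integral>\<^sup>+w. ennreal ((norm (Y w))\<^sup>2) \<partial>M) \<le> ennreal C" "0 \<le> C"
  shows "expectation (\<lambda>w. (norm (Y w))\<^sup>2) \<le> C"
  using nn_integral_eq_integral[OF integrable_norm_sq[OF assms(1,2)]] assms(2,3) by simp

end

context additive_noise_sode
begin

text \<open>The new error is \<open>u + b - m\<close>, with \<open>u\<close> the propagated old
  error. The product of \<open>u\<close> and \<open>b\<close> is split with weights \<open>h\<close>
  and \<open>1 / h\<close>, which costs \<open>h ^ 4 / h\<close>; the product of \<open>u\<close>
  and \<open>m\<close> has mean zero, since \<open>u\<close> is known at time \<open>s\<close>. The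
  one-sided stability of \<open>\<Phi>\<close> is all that is used about \<open>Y\<close>, so no
  moments of the method enter beyond those of its error.\<close>

lemma one_step_error_recursion:
  assumes st: "0 \<le> s" "s < t" "t \<le> T" and pos: "0 \<le> Cs" "0 \<le> Cb" "0 \<le> Cm" "0 \<le> a"
    and Y: "Y \<in> borel_measurable (F s)"
      "(\<integral>\<^sup>+w. ennreal ((norm (Y w - X s w))\<^sup>2) \<partial>M) \<le> ennreal a"
    and stable: "\<And>x y. (norm (\<Phi> x - \<Phi> y))\<^sup>2 \<le> (1 + Cs * (t - s)) * (norm (x - y))\<^sup>2"
    and decomp: "\<And>w. X t w = \<Phi> (X s w) - b w + m w + \<eta> w"
    and bm: "b \<in> borel_measurable M" "m \<in> borel_measurable M"
    and b: "(\<integral>\<^sup>+w. ennreal ((norm (b w))\<^sup>2) \<partial>M) \<le> ennreal (Cb * (t - s)^4)"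
    and m: "(\<integral>\<^sup>+w. ennreal ((norm (m w))\<^sup>2) \<partial>M) \<le> ennreal (Cm * (t - s)^3)"
    and orth: "\<And>U. U \<in> borel_measurable (F s) \<Longrightarrow> integrable M (\<lambda>w. (norm (U w))\<^sup>2) \<Longrightarrow>
          (\<integral>w. U w \<bullet> m w \<partial>M) = 0"
    and Y': "Y' \<in> borel_measurable M" "\<And>w. Y' w = \<Phi> (Y w) + \<eta> w"
  shows "(\<integral>\<^sup>+w. ennreal ((norm (Y' w - X t w))\<^sup>2) \<partial>M)
    \<le> ennreal ((1 + (1 + Cs + Cs * T) * (t - s)) * a + ((2 * T + 1) * Cb + 2 * Cm) * (t - s)^3)"
proof -
  define h where "h = t - s"
  have h: "0 < h" "h \<le> T" using st by (auto simp: h_def)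
  have sT: "s \<in> {0..T}" using st by auto
  note [measurable] = bm Y'(1)
  have Ym [measurable]: "Y \<in> borel_measurable M" by (rule measurable_F_M[OF sT Y(1)])
  have Csh: "0 \<le> 1 + Cs * h" using pos h by simp
  have \<Phi>c: "continuous_on UNIV \<Phi>"
    by (rule continuous_on_of_norm_sq_le) (use stable Csh in \<open>auto simp: h_def\<close>)
  then have \<Phi>m: "\<Phi> \<in> borel_measurable borel" by (rule borel_measurable_continuous_onI)
  define u where "u w = \<Phi> (Y w) - \<Phi> (X s w)" for w
  have uF: "u \<in> borel_measurable (F s)"
    unfolding u_def using measurable_compose[OF Y(1) \<Phi>m] measurable_compose[OF X_adapted[OF sT] \<Phi>m]
    by (rule borel_measurable_diff)
  have um [measurable]: "u \<in> borel_measurable M" by (rule measurable_F_M[OF sT uF])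
  have u: "(\<integral>\<^sup>+w. ennreal ((norm (u w))\<^sup>2) \<partial>M) \<le> ennreal ((1 + Cs * h) * a)"
  proof -
    have "(\<integral>\<^sup>+w. ennreal ((norm (u w))\<^sup>2) \<partial>M) \<le> (\<integral>\<^sup>+w. ennreal (1 + Cs * h) * ennreal ((norm (Y w - X s w))\<^sup>2) \<partial>M)"
      using Csh by (intro nn_integral_mono) (simp add: u_def ennreal_mult[symmetric] ennreal_leI stable[folded h_def])
    also have "\<dots> = ennreal (1 + Cs * h) * (\<integral>\<^sup>+w. ennreal ((norm (Y w - X s w))\<^sup>2) \<partial>M)"
      by (rule nn_integral_cmult) measurable
    also have "\<dots> \<le> ennreal (1 + Cs * h) * ennreal a" by (intro mult_left_mono Y(2)) simp
    also have "\<dots> = ennreal ((1 + Cs * h) * a)" using Csh pos by (simp add: ennreal_mult)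
    finally show ?thesis .
  qed
  note iu = integrable_norm_sq[OF um u] and ib = integrable_norm_sq[OF bm(1) b]
    and im = integrable_norm_sq[OF bm(2) m]
  have Eu: "expectation (\<lambda>w. (norm (u w))\<^sup>2) \<le> (1 + Cs * h) * a"
    by (rule expectation_norm_sq_le[OF um u]) (use Csh pos in simp)
  have Eb: "expectation (\<lambda>w. (norm (b w))\<^sup>2) \<le> Cb * h^4"
    using expectation_norm_sq_le[OF bm(1) b] pos h by (simp add: h_def)
  have Em: "expectation (\<lambda>w. (norm (m w))\<^sup>2) \<le> Cm * h^3"
    using expectation_norm_sq_le[OF bm(2) m] pos h by (simp add: h_def)
  have ium: "integrable M (\<lambda>w. u w \<bullet> m w)"
  proof (rule Bochner_Integration.integrable_bound)
    show "integrable M (\<lambda>w. norm (u w) * norm (m w))"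
      by (rule integrable_mult_of_squares) (use iu im in auto)
    show "AE w in M. norm (u w \<bullet> m w) \<le> norm (norm (u w) * norm (m w))"
      using Cauchy_Schwarz_ineq2 by (intro AE_I2) simp
  qed measurable
  \<comment> \<open>The mixed term of \<open>u\<close> and \<open>m\<close> is kept rather than
    estimated, so that its expectation can vanish.\<close>
  define R where "R w = (1 + h) * (norm (u w))\<^sup>2 + (2 + 1 / h) * (norm (b w))\<^sup>2 + 2 * (norm (m w))\<^sup>2 - 2 * (u w \<bullet> m w)" for w
  have point: "(norm (Y' w - X t w))\<^sup>2 \<le> R w" for w
  proof -
    have e: "Y' w - X t w = u w + b w - m w" unfolding Y'(2) decomp u_def by simp
    have "2 * (u w \<bullet> b w) \<le> h * (norm (u w))\<^sup>2 + (1 / h) * (norm (b w))\<^sup>2"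
    proof -
      have "2 * (u w \<bullet> b w) \<le> 2 * (norm (u w) * norm (b w))" using norm_cauchy_schwarz[of "u w" "b w"] by simp
      also have "\<dots> = 2 * (sqrt h * norm (u w)) * (norm (b w) / sqrt h)" using h by simp
      also have "\<dots> \<le> (sqrt h * norm (u w))\<^sup>2 + (norm (b w) / sqrt h)\<^sup>2" by (rule sum_squares_bound)
      also have "\<dots> = h * (norm (u w))\<^sup>2 + (1 / h) * (norm (b w))\<^sup>2"
        using h by (simp add: power_mult_distrib power_divide)
      finally show ?thesis .
    qed
    moreover have "- (2 * (b w \<bullet> m w)) \<le> (norm (b w))\<^sup>2 + (norm (m w))\<^sup>2"
      using norm_cauchy_schwarz[of "- b w" "m w"] sum_squares_bound[of "norm (b w)" "norm (m w)"] by simp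
    moreover have "(norm (u w + b w - m w))\<^sup>2 = (norm (u w))\<^sup>2 + (norm (b w))\<^sup>2 + (norm (m w))\<^sup>2
        + 2 * (u w \<bullet> b w) - 2 * (u w \<bullet> m w) - 2 * (b w \<bullet> m w)"
      unfolding power2_norm_eq_inner
      by (simp add: inner_add_left inner_add_right inner_diff_left inner_diff_right inner_commute)
    ultimately show ?thesis unfolding e R_def by (simp add: distrib_right)
  qed
  have iR: "integrable M R" unfolding R_def using iu ib im ium by auto
  have R0: "0 \<le> R w" for w by (rule order_trans[OF zero_le_power2 point])
  have "expectation R = (1 + h) * expectation (\<lambda>w. (norm (u w))\<^sup>2) + (2 + 1 / h) * expectation (\<lambda>w. (norm (b w))\<^sup>2)
      + 2 * expectation (\<lambda>w. (norm (m w))\<^sup>2)"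
    unfolding R_def using iu ib im ium orth[OF uF iu] by simp
  also have "\<dots> \<le> (1 + h) * ((1 + Cs * h) * a) + (2 + 1 / h) * (Cb * h^4) + 2 * (Cm * h^3)"
    using h by (intro add_mono mult_left_mono Eu Eb Em) auto
  also have "\<dots> \<le> (1 + (1 + Cs + Cs * T) * h) * a + ((2 * T + 1) * Cb + 2 * Cm) * h^3"
  proof -
    have "(1 + h) * (1 + Cs * h) = 1 + (1 + Cs + Cs * h) * h" by (simp add: algebra_simps)
    also have "\<dots> \<le> 1 + (1 + Cs + Cs * T) * h" using pos h by (intro add_left_mono mult_right_mono mult_left_mono) auto
    finally have 1: "(1 + h) * ((1 + Cs * h) * a) \<le> (1 + (1 + Cs + Cs * T) * h) * a"
      unfolding mult.assoc[symmetric] using pos by (intro mult_right_mono) auto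
    have "(2 + 1 / h) * (Cb * h^4) = (2 * h + 1) * (Cb * h^3)"
      using h by (simp add: field_simps power4_eq_xxxx power3_eq_cube)
    also have "\<dots> \<le> (2 * T + 1) * (Cb * h^3)" using pos h by (intro mult_right_mono) auto
    finally show ?thesis using 1 by (simp add: algebra_simps)
  qed
  finally have ER: "expectation R \<le> (1 + (1 + Cs + Cs * T) * h) * a + ((2 * T + 1) * Cb + 2 * Cm) * h^3" .
  have "(\<integral>\<^sup>+w. ennreal ((norm (Y' w - X t w))\<^sup>2) \<partial>M) \<le> (\<integral>\<^sup>+w. ennreal (R w) \<partial>M)"
    by (intro nn_integral_mono ennreal_leI point)
  also have "\<dots> = ennreal (expectation R)" by (rule nn_integral_eq_integral[OF iR]) (use R0 in auto)
  also have "\<dots> \<le> ennreal ((1 + (1 + Cs + Cs * T) * h) * a + ((2 * T + 1) * Cb + 2 * Cm) * h^3)"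
    by (rule ennreal_leI[OF ER])
  finally show ?thesis by (simp add: h_def)
qed

text \<open>Consistency is measured against the Euler increment at the left end point, for implicit
  methods too, so that both methods share the local error of the exact solution. The constants are
  parameters because they must not depend on the grid.\<close>

definition one_step_method ::
    "real \<Rightarrow> real \<Rightarrow> real \<Rightarrow> real \<Rightarrow> nat \<Rightarrow> (nat \<Rightarrow> real) \<Rightarrow> (nat \<Rightarrow> 'w \<Rightarrow> 'a) \<Rightarrow> (nat \<Rightarrow> 'a \<Rightarrow> 'a) \<Rightarrow> (nat \<Rightarrow> 'w \<Rightarrow> 'a) \<Rightarrow> bool"
  where
  "one_step_method Cs Cc \<kappa> c N h Y \<Phi> \<eta> \<longleftrightarrow>
     Y 0 \<in> borel_measurable (F 0) \<and> (AE w in M. Y 0 w = X 0 w) \<and>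
     (\<forall>n<N. (\<forall>w. Y (Suc n) w = \<Phi> n (Y n w) + \<eta> n w) \<and>
        (\<forall>x y. (norm (\<Phi> n x - \<Phi> n y))\<^sup>2 \<le> (1 + Cs * h (Suc n)) * (norm (x - y))\<^sup>2) \<and>
        (\<forall>x. norm (\<Phi> n x - x - h (Suc n) *\<^sub>R f (grid h n) x) \<le> Cc * (h (Suc n))\<^sup>2 * (1 + norm x) powr \<kappa>) \<and>
        noise_approximation c (grid h n) (grid h (Suc n)) (\<eta> n))"

text \<open>The order \<open>2 * \<kappa>\<close> arises because the consistency bound is squared
  and evaluated at \<open>X\<close>. The constant is fixed before the grid, the method and its
  noise.\<close>

lemma one_step_method_convergence:
  assumes X0: "(\<integral>\<^sup>+w. ennreal (norm (X 0 w) powr (6 * q - 4)) \<partial>M) < \<infinity>"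
    and X0': "(\<integral>\<^sup>+w. ennreal (norm (X 0 w) powr (2 * \<kappa>)) \<partial>M) < \<infinity>" and \<kappa>: "1 \<le> \<kappa>"
    and pos: "0 \<le> Cs" "0 \<le> Cc" "0 \<le> c"
  obtains C where "0 \<le> C"
    "\<And>hbar N h Y \<Phi> \<eta>. step_sizes T hbar N h \<Longrightarrow> one_step_method Cs Cc \<kappa> c N h Y \<Phi> \<eta> \<Longrightarrow>
      \<forall>n\<le>N. Y n \<in> borel_measurable M \<and>
        (\<integral>\<^sup>+w. ennreal ((norm (Y n w - X (grid h n) w))\<^sup>2) \<partial>M) \<le> ennreal (C * (max_step N h)\<^sup>2)"
proof -
  obtain Cl where Cl: "0 \<le> Cl" and loc: "\<And>s t \<eta>. 0 \<le> s \<Longrightarrow> s < t \<Longrightarrow> t \<le> T \<Longrightarrow>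
      noise_approximation c s t \<eta> \<Longrightarrow> local_error_bound Cl s t \<eta>"
    by (rule local_error[OF X0 pos(3)]) (rule that; assumption)
  have \<kappa>2: "2 \<le> 2 * \<kappa>" using \<kappa> by simp
  obtain Cx where Cx: "0 \<le> Cx" "\<And>t. t \<in> {0..T} \<Longrightarrow> (\<integral>\<^sup>+w. ennreal (norm (X t w) powr (2 * \<kappa>)) \<partial>M) \<le> ennreal Cx"
    by (rule X_moment[OF \<kappa>2 X0']) (rule that; assumption)
  define Cy where "Cy = 2 powr (2 * \<kappa>) * (1 + Cx)"
  have Cy: "0 \<le> Cy" using Cx by (simp add: Cy_def)
  have mom: "(\<integral>\<^sup>+w. ennreal ((1 + norm (X t w)) powr (2 * \<kappa>)) \<partial>M) \<le> ennreal Cy" if "t \<in> {0..T}" for t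
    unfolding Cy_def by (rule nn_integral_1_plus_powr_le) (use \<kappa> Cx that in auto)
  define Cb where "Cb = 2 * (Cc\<^sup>2 * Cy) + 2 * Cl"
  have Cb: "0 \<le> Cb" using Cl Cy by (simp add: Cb_def)
  define C1 where "C1 = 1 + Cs + Cs * T"
  define C2 where "C2 = (2 * T + 1) * Cb + 2 * Cl"
  have C12: "0 \<le> C1" "0 \<le> C2" using pos Cb Cl T_pos by (auto simp: C1_def C2_def)
  show ?thesis
  proof (rule that)
    show "0 \<le> exp (C1 * T) * C2 * T" using C12 T_pos by simp
    fix hbar N h and Y :: "nat \<Rightarrow> 'w \<Rightarrow> 'a" and \<Phi> \<eta>
    assume step: "step_sizes T hbar N h"
      and osm: "one_step_method Cs Cc \<kappa> c N h Y \<Phi> \<eta>"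
    have Y0: "Y 0 \<in> borel_measurable (F 0)" "AE w in M. Y 0 w = X 0 w"
      and YS: "\<And>n w. n < N \<Longrightarrow> Y (Suc n) w = \<Phi> n (Y n w) + \<eta> n w"
      and stable: "\<And>n x y. n < N \<Longrightarrow> (norm (\<Phi> n x - \<Phi> n y))\<^sup>2 \<le> (1 + Cs * h (Suc n)) * (norm (x - y))\<^sup>2"
      and cons: "\<And>n x. n < N \<Longrightarrow> norm (\<Phi> n x - x - h (Suc n) *\<^sub>R f (grid h n) x)
          \<le> Cc * (h (Suc n))\<^sup>2 * (1 + norm x) powr \<kappa>"
      and \<eta>a: "\<And>n. n < N \<Longrightarrow> noise_approximation c (grid h n) (grid h (Suc n)) (\<eta> n)"
      using osm by (auto simp only: one_step_method_def)
    define H where "H = max_step N h"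
    \<comment> \<open>The closed form of the discrete Gronwall inequality: with
      \<open>h ^ 3 \<le> H\<^sup>2 * h\<close> the local contributions add up to the elapsed time,
      for grids of any shape.\<close>
    define a where "a n = exp (C1 * grid h n) * (C2 * H\<^sup>2 * grid h n)" for n
    have ind: "Y n \<in> borel_measurable (F (grid h n)) \<and>
        (\<integral>\<^sup>+w. ennreal ((norm (Y n w - X (grid h n) w))\<^sup>2) \<partial>M) \<le> ennreal (a n)" if "n \<le> N" for n
      using that
    proof (induction n)
      case 0
      have "(\<integral>\<^sup>+w. ennreal ((norm (Y 0 w - X 0 w))\<^sup>2) \<partial>M) = (\<integral>\<^sup>+w. 0 \<partial>M)"
        by (rule nn_integral_cong_AE) (use Y0(2) in \<open>eventually_elim, simp\<close>)
      then show ?case using Y0 by (simp add: grid_simps)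
    next
      case (Suc n)
      then have nN: "n < N" by simp
      let ?s = "grid h n" and ?t = "grid h (Suc n)"
      have hp: "0 < h (Suc n)" using step_sizes_pos[OF step] nN by simp
      have hH: "h (Suc n) \<le> H" unfolding H_def using nN by (intro step_le_max_step) auto
      have ts: "?t - ?s = h (Suc n)" by (simp add: grid_simps)
      have st: "0 \<le> ?s" "?s < ?t" "?t \<le> T"
        using grid_bounds[OF step, of n] grid_bounds[OF step, of "Suc n"] nN hp ts by auto
      have sT: "?s \<in> {0..T}" "?t \<in> {0..T}" using st by auto
      have IH: "Y n \<in> borel_measurable (F ?s)"
        "(\<integral>\<^sup>+w. ennreal ((norm (Y n w - X ?s w))\<^sup>2) \<partial>M) \<le> ennreal (a n)"
        using Suc nN by auto
      have \<eta>F: "\<eta> n \<in> borel_measurable (F ?t)" using \<eta>a[OF nN] by (simp add: noise_approximation_def)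
      obtain b m where bm [measurable]: "b \<in> borel_measurable M" "m \<in> borel_measurable M"
        and dec: "\<forall>w. X ?t w = X ?s w + (?t - ?s) *\<^sub>R f ?s (X ?s w) + b w + m w + \<eta> n w"
        and b: "(\<integral>\<^sup>+w. ennreal ((norm (b w))\<^sup>2) \<partial>M) \<le> ennreal (Cl * (?t - ?s)^4)"
        and m: "(\<integral>\<^sup>+w. ennreal ((norm (m w))\<^sup>2) \<partial>M) \<le> ennreal (Cl * (?t - ?s)^3)"
        and orth: "\<forall>Y. Y \<in> borel_measurable (F ?s) \<longrightarrow> integrable M (\<lambda>w. (norm (Y w))\<^sup>2) \<longrightarrow>
          (\<integral>w. Y w \<bullet> m w \<partial>M) = 0"
        using loc[OF st \<eta>a[OF nN]] unfolding local_error_bound_def by blast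
      \<comment> \<open>Consistency error of the method minus drift error of the exact solution; the
        sign matches the \<open>- b\<close> in \<open>one_step_error_recursion\<close>.\<close>
      define b' where "b' w = \<Phi> n (X ?s w) - X ?s w - h (Suc n) *\<^sub>R f ?s (X ?s w) - b w" for w
      have \<Phi>m: "\<Phi> n \<in> borel_measurable borel"
        by (rule borel_measurable_continuous_onI, rule continuous_on_of_norm_sq_le[OF stable[OF nN]])
          (use pos hp in simp)
      have fm: "f ?s \<in> borel_measurable borel"
        by (rule borel_measurable_continuous_onI, rule continuous_on_compose2[OF f_continuous, where f = "\<lambda>x. (?s, x)", simplified prod.case])
          (use sT in \<open>auto intro!: continuous_intros\<close>)
      note [measurable] = measurable_compose[OF X_measurable \<Phi>m] measurable_compose[OF X_measurable fm]
      have b'm [measurable]: "b' \<in> borel_measurable M" unfolding b'_def by measurable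
      have b': "(\<integral>\<^sup>+w. ennreal ((norm (b' w))\<^sup>2) \<partial>M) \<le> ennreal (Cb * (?t - ?s)^4)"
      proof -
        have "(\<integral>\<^sup>+w. ennreal ((norm (b' w))\<^sup>2) \<partial>M)
          \<le> (\<integral>\<^sup>+w. 2 * (ennreal (Cc\<^sup>2 * h (Suc n)^4) * ennreal ((1 + norm (X ?s w)) powr (2 * \<kappa>))) + 2 * ennreal ((norm (b w))\<^sup>2) \<partial>M)"
        proof (rule nn_integral_mono)
          fix w
          let ?r = "\<Phi> n (X ?s w) - X ?s w - h (Suc n) *\<^sub>R f ?s (X ?s w)"
          have "(norm ?r)\<^sup>2 \<le> (Cc * (h (Suc n))\<^sup>2 * (1 + norm (X ?s w)) powr \<kappa>)\<^sup>2"
            by (intro power_mono cons nN) simp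
          also have "\<dots> = Cc\<^sup>2 * h (Suc n)^4 * (1 + norm (X ?s w)) powr (2 * \<kappa>)"
          proof -
            have "((1 + norm (X ?s w)) powr \<kappa>)\<^sup>2 = (1 + norm (X ?s w)) powr (2 * \<kappa>)"
              by (simp add: power2_eq_square powr_add[symmetric])
            then show ?thesis by (simp add: power_mult_distrib)
          qed
          finally have "ennreal ((norm ?r)\<^sup>2) \<le> ennreal (Cc\<^sup>2 * h (Suc n)^4) * ennreal ((1 + norm (X ?s w)) powr (2 * \<kappa>))"
            by (subst ennreal_mult[symmetric]) (auto intro!: ennreal_leI)
          then show "ennreal ((norm (b' w))\<^sup>2) \<le> 2 * (ennreal (Cc\<^sup>2 * h (Suc n)^4) * ennreal ((1 + norm (X ?s w)) powr (2 * \<kappa>))) + 2 * ennreal ((norm (b w))\<^sup>2)"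
            using order_trans[OF ennreal_norm_add_sq_le[of ?r "- b w"] add_right_mono[OF mult_left_mono]]
            by (simp add: b'_def)
        qed
        also have "\<dots> = 2 * (ennreal (Cc\<^sup>2 * h (Suc n)^4) * (\<integral>\<^sup>+w. ennreal ((1 + norm (X ?s w)) powr (2 * \<kappa>)) \<partial>M))
            + 2 * (\<integral>\<^sup>+w. ennreal ((norm (b w))\<^sup>2) \<partial>M)"
          by (simp add: nn_integral_add nn_integral_cmult)
        also have "\<dots> \<le> 2 * (ennreal (Cc\<^sup>2 * h (Suc n)^4) * ennreal Cy) + 2 * ennreal (Cl * (?t - ?s)^4)"
          by (intro add_mono mult_left_mono mom sT b) auto
        also have "\<dots> = ennreal (2 * (Cc\<^sup>2 * h (Suc n)^4 * Cy) + 2 * (Cl * (?t - ?s)^4))"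
          using Cy Cl hp unfolding ts by (simp add: ennreal_mult)
        also have "2 * (Cc\<^sup>2 * h (Suc n)^4 * Cy) + 2 * (Cl * (?t - ?s)^4) = Cb * (?t - ?s)^4"
          unfolding ts Cb_def by (simp add: algebra_simps)
        finally show ?thesis .
      qed
      have dec': "X ?t w = \<Phi> n (X ?s w) - b' w + m w + \<eta> n w" for w
        using dec[rule_format, of w] unfolding b'_def ts by simp
      have \<Phi>Y: "(\<lambda>w. \<Phi> n (Y n w)) \<in> borel_measurable (F ?t)"
        using measurable_F_mono[OF st(1) less_imp_le[OF st(2)] st(3) measurable_compose[OF IH(1) \<Phi>m]] .
      have "Y (Suc n) = (\<lambda>w. \<Phi> n (Y n w) + \<eta> n w)" using YS[OF nN] by auto
      then have YF: "Y (Suc n) \<in> borel_measurable (F ?t)"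
        using borel_measurable_add[OF \<Phi>Y \<eta>F] by simp
      have YM: "Y (Suc n) \<in> borel_measurable M" by (rule measurable_F_M[OF sT(2) YF])
      have a0: "0 \<le> a n" using C12 st by (simp add: a_def)
      have "(\<integral>\<^sup>+w. ennreal ((norm (Y (Suc n) w - X ?t w))\<^sup>2) \<partial>M)
        \<le> ennreal ((1 + (1 + Cs + Cs * T) * (?t - ?s)) * a n + ((2 * T + 1) * Cb + 2 * Cl) * (?t - ?s)^3)"
        by (rule one_step_error_recursion[where \<Phi> = "\<Phi> n" and b = b' and m = m and \<eta> = "\<eta> n" and Y = "Y n",
              OF st pos(1) Cb Cl a0 IH stable[OF nN, folded ts] dec' b'm bm(2) b' m orth[rule_format] YM YS[OF nN]])
      also have "\<dots> = ennreal ((1 + C1 * h (Suc n)) * a n + C2 * h (Suc n)^3)"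
        by (simp add: C1_def C2_def ts)
      also have "(1 + C1 * h (Suc n)) * a n + C2 * h (Suc n)^3 \<le> a (Suc n)"
      proof -
        let ?E = "exp (C1 * ?t)"
        have "1 + C1 * h (Suc n) \<le> exp (C1 * h (Suc n))" by (rule exp_ge_add_one_self)
        then have "(1 + C1 * h (Suc n)) * a n \<le> exp (C1 * h (Suc n)) * a n" using a0 by (rule mult_right_mono)
        also have "\<dots> = ?E * (C2 * H\<^sup>2 * ?s)"
          by (simp add: a_def grid_simps distrib_left exp_add)
        finally have 1: "(1 + C1 * h (Suc n)) * a n \<le> ?E * (C2 * H\<^sup>2 * ?s)" .
        have "C2 * h (Suc n)^3 = C2 * (h (Suc n))\<^sup>2 * h (Suc n)" by (simp add: power2_eq_square power3_eq_cube)
        also have "\<dots> \<le> C2 * H\<^sup>2 * h (Suc n)"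
          using C12 hp hH by (intro mult_right_mono mult_left_mono power_mono) auto
        also have "\<dots> \<le> ?E * (C2 * H\<^sup>2 * h (Suc n))"
        proof -
          have "1 \<le> ?E" using C12 st hp by simp
          moreover have "0 \<le> C2 * H\<^sup>2 * h (Suc n)" using C12 hp by simp
          ultimately show ?thesis using mult_right_mono[of 1 ?E "C2 * H\<^sup>2 * h (Suc n)"] by simp
        qed
        finally show ?thesis using 1 by (simp add: a_def grid_simps distrib_left)
      qed
      finally show ?case using YF by (simp add: ennreal_leI)
    qed
    show "\<forall>n\<le>N. Y n \<in> borel_measurable M \<and>
        (\<integral>\<^sup>+w. ennreal ((norm (Y n w - X (grid h n) w))\<^sup>2) \<partial>M) \<le> ennreal (exp (C1 * T) * C2 * T * (max_step N h)\<^sup>2)"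
    proof (intro allI impI)
      fix n assume n: "n \<le> N"
      have gT: "0 \<le> grid h n" "grid h n \<le> T" using grid_bounds[OF step n] by auto
      have "a n \<le> exp (C1 * T) * (C2 * H\<^sup>2 * T)"
        unfolding a_def using gT C12 T_pos by (intro mult_mono) (auto intro!: mult_left_mono)
      also have "\<dots> = exp (C1 * T) * C2 * T * (max_step N h)\<^sup>2" by (simp add: H_def)
      finally have an: "a n \<le> exp (C1 * T) * C2 * T * (max_step N h)\<^sup>2" .
      have "grid h n \<in> {0..T}" using gT by simp
      then show "Y n \<in> borel_measurable M \<and>
        (\<integral>\<^sup>+w. ennreal ((norm (Y n w - X (grid h n) w))\<^sup>2) \<partial>M) \<le> ennreal (exp (C1 * T) * C2 * T * (max_step N h)\<^sup>2)"
        using ind[OF n] measurable_F_M order_trans[OF _ ennreal_leI[OF an]] by blast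
    qed
  qed
qed

end

section \<open>The one-step maps of the two methods\<close>

text \<open>Identifies the truncation with the metric projection onto a ball, hence onto a closed
  convex set. This is why it is nonexpansive and does not spoil stability.\<close>

lemma pem_projection_eq_closest_point:
  fixes x :: "'a::euclidean_space"
  assumes "0 < \<eta>"
  shows "pem_projection \<alpha> \<eta> x = closest_point (cball 0 (\<eta> powr - \<alpha>)) x"
proof (rule closest_point_unique)
  define R where "R = \<eta> powr - \<alpha>"
  have R: "0 < R" using assms by (simp add: R_def)
  have small: "pem_projection \<alpha> \<eta> x = x" if "norm x \<le> R"
  proof (cases "x = 0")
    case False
    then have "1 \<le> R * inverse (norm x)" using that by (simp add: field_simps)
    then show ?thesis using False by (simp add: pem_projection_def R_def)
  qed (simp add: pem_projection_def)
  have large: "pem_projection \<alpha> \<eta> x = (R / norm x) *\<^sub>R x" if "R < norm x"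
  proof -
    have "x \<noteq> 0" using that R by auto
    moreover have "R * inverse (norm x) \<le> 1" using that \<open>x \<noteq> 0\<close> by (simp add: field_simps)
    ultimately show ?thesis by (simp add: pem_projection_def R_def divide_inverse)
  qed
  show "convex (cball (0::'a) (\<eta> powr - \<alpha>))" "closed (cball (0::'a) (\<eta> powr - \<alpha>))" by simp_all
  show "pem_projection \<alpha> \<eta> x \<in> cball 0 (\<eta> powr - \<alpha>)"
    unfolding R_def[symmetric] using small large R by (cases "norm x \<le> R") auto
  show "\<forall>z\<in>cball 0 (\<eta> powr - \<alpha>). dist x (pem_projection \<alpha> \<eta> x) \<le> dist x z"
  proof
    fix z :: 'a assume "z \<in> cball 0 (\<eta> powr - \<alpha>)"
    then have z: "norm z \<le> R" by (simp add: R_def)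
    show "dist x (pem_projection \<alpha> \<eta> x) \<le> dist x z"
    proof (cases "norm x \<le> R")
      case False
      then have x: "R < norm x" "x \<noteq> 0" using R by auto
      have "x - (R / norm x) *\<^sub>R x = (1 - R / norm x) *\<^sub>R x" by (simp add: scaleR_diff_left)
      then have "dist x (pem_projection \<alpha> \<eta> x) = \<bar>1 - R / norm x\<bar> * norm x"
        by (simp add: large[OF x(1)] dist_norm)
      also have "\<dots> = norm x - R" using x by (simp add: abs_if field_simps)
      also have "\<dots> \<le> norm x - norm z" using z by simp
      also have "\<dots> \<le> dist x z" unfolding dist_norm by (rule norm_triangle_ineq2)
      finally show ?thesis .
    qed (simp add: small)
  qed
qed

lemma pem_projection_nonexpansive:
  "0 < \<eta> \<Longrightarrow> norm (pem_projection \<alpha> \<eta> x - pem_projection \<alpha> \<eta> y) \<le> norm (x - y)"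
  using closest_point_lipschitz[of "cball 0 (\<eta> powr - \<alpha>)" x y]
  by (simp add: pem_projection_eq_closest_point dist_norm)

lemma norm_pem_projection_le:
  assumes "0 < \<eta>"
  shows "norm (pem_projection \<alpha> \<eta> x) \<le> \<eta> powr - \<alpha>" "norm (pem_projection \<alpha> \<eta> x) \<le> norm x"
proof -
  have "closest_point (cball 0 (\<eta> powr - \<alpha>)) x \<in> cball 0 (\<eta> powr - \<alpha>)"
    by (rule closest_point_in_set) auto
  then show "norm (pem_projection \<alpha> \<eta> x) \<le> \<eta> powr - \<alpha>"
    by (simp add: pem_projection_eq_closest_point[OF assms])
  show "norm (pem_projection \<alpha> \<eta> x) \<le> norm x"
    using pem_projection_nonexpansive[OF assms, of \<alpha> x 0] by (simp add: pem_projection_def)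
qed

text \<open>The error vanishes unless \<open>\<eta> powr \<alpha> * norm x\<close> exceeds 1, and
  then any power of this quantity can be inserted for free. So every order in the step size is
  available at the price of powers of \<open>norm x\<close>.\<close>

lemma norm_pem_projection_error_le:
  assumes "0 < \<eta>" "0 \<le> k"
  shows "norm (x - pem_projection \<alpha> \<eta> x) \<le> \<eta> powr (\<alpha> * k) * norm x powr (k + 1)"
proof (cases "norm x \<le> \<eta> powr - \<alpha>")
  case True
  then have "pem_projection \<alpha> \<eta> x = x"
    using closest_point_self[of x "cball 0 (\<eta> powr - \<alpha>)"] by (simp add: pem_projection_eq_closest_point[OF assms(1)])
  then show ?thesis by simp
next
  case False
  then have x: "\<eta> powr - \<alpha> < norm x" "x \<noteq> 0" using powr_ge_zero[of \<eta> "- \<alpha>"] by auto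
  define c where "c = min 1 (\<eta> powr - \<alpha> * inverse (norm x))"
  have c: "0 \<le> c" "c \<le> 1" by (auto simp: c_def)
  have "x - pem_projection \<alpha> \<eta> x = (1 - c) *\<^sub>R x"
    using x by (simp add: pem_projection_def c_def scaleR_diff_left)
  then have "norm (x - pem_projection \<alpha> \<eta> x) = (1 - c) * norm x" using c by simp
  also have "\<dots> \<le> 1 * norm x" using c by (intro mult_right_mono) auto
  also have "\<dots> \<le> (\<eta> powr \<alpha> * norm x) powr k * norm x"
  proof (intro mult_right_mono)
    have "\<eta> powr \<alpha> * \<eta> powr - \<alpha> \<le> \<eta> powr \<alpha> * norm x"
      using x by (intro mult_left_mono) auto
    then have "1 \<le> \<eta> powr \<alpha> * norm x" using assms by (simp add: powr_add[symmetric])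
    then show "1 \<le> (\<eta> powr \<alpha> * norm x) powr k" using assms by (intro ge_one_powr_ge_zero)
  qed simp
  also have "\<dots> = \<eta> powr (\<alpha> * k) * norm x powr (k + 1)"
    using x by (simp add: powr_mult powr_powr powr_add)
  finally show ?thesis .
qed

lemma one_plus_powr_mono:
  fixes x a b :: real
  assumes "0 \<le> x" "a \<le> b"
  shows "(1 + x) powr a \<le> (1 + x) powr b"
  using assms by (intro powr_mono) auto

context drift
begin

abbreviation (input) "pem_exponent \<equiv> 1 / (2 * (q - 1))"

text \<open>The choice of the exponent makes \<open>R powr (2 * (q - 1)) = 1 / h\<close> for the
  radius \<open>R\<close>. On the ball the squared Lipschitz constant of \<open>f\<close> is
  therefore of order \<open>1 / h\<close>, and the term with \<open>h\<^sup>2\<close> in the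
  expanded square becomes linear in \<open>h\<close>. As \<open>h \<le> 1\<close>, the radius is at
  least 1, whence the factor 3.\<close>

lemma pem_step_stable:
  assumes h: "0 < h" "h \<le> 1" and t: "t \<in> {0..T}"
  defines "\<pi> \<equiv> pem_projection pem_exponent h"
  shows "(norm ((\<pi> x + h *\<^sub>R f t (\<pi> x)) - (\<pi> y + h *\<^sub>R f t (\<pi> y))))\<^sup>2
    \<le> (1 + (2 * L + K\<^sup>2 * 3 powr (2 * (q - 1))) * h) * (norm (x - y))\<^sup>2"
proof -
  define u v where "u = \<pi> x" and "v = \<pi> y"
  define R where "R = h powr - pem_exponent"
  have q: "0 < q - 1" using q_ge by simp
  have R1: "1 \<le> R" using h q powr_mono'[of "- pem_exponent" 0 h] by (simp add: R_def)
  have R2: "R powr (2 * (q - 1)) = 1 / h"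
  proof -
    have "- pem_exponent * (2 * (q - 1)) = - 1" using q by simp
    then have "R powr (2 * (q - 1)) = h powr - 1" unfolding R_def powr_powr by (simp only:)
    then show ?thesis using h by (simp add: powr_neg_one)
  qed
  have "norm u \<le> R" "norm v \<le> R" unfolding u_def v_def \<pi>_def R_def by (rule norm_pem_projection_le(1)[OF h(1)])+
  then have uv: "1 + norm u + norm v \<le> 3 * R" using R1 by simp
  have "norm (f t u - f t v) \<le> K * (1 + norm u + norm v) powr (q - 1) * norm (u - v)"
    by (rule f_lipschitz[OF t])
  also have "\<dots> \<le> K * (3 * R) powr (q - 1) * norm (u - v)"
    using K_ge uv q by (intro mult_right_mono mult_left_mono powr_mono2) auto
  finally have "(norm (f t u - f t v))\<^sup>2 \<le> (K * (3 * R) powr (q - 1) * norm (u - v))\<^sup>2"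
    by (intro power_mono) auto
  also have "\<dots> = K\<^sup>2 * ((3 * R) powr (2 * (q - 1))) * (norm (u - v))\<^sup>2"
  proof -
    have "((3 * R) powr (q - 1))\<^sup>2 = (3 * R) powr (2 * (q - 1))"
      by (simp add: power2_eq_square powr_add[symmetric])
    then show ?thesis by (simp add: power_mult_distrib)
  qed
  also have "\<dots> = K\<^sup>2 * 3 powr (2 * (q - 1)) / h * (norm (u - v))\<^sup>2"
    using R1 R2 by (simp add: powr_mult)
  finally have 1: "h\<^sup>2 * (norm (f t u - f t v))\<^sup>2 \<le> h\<^sup>2 * (K\<^sup>2 * 3 powr (2 * (q - 1)) / h * (norm (u - v))\<^sup>2)"
    by (intro mult_left_mono) auto
  have 2: "2 * h * ((f t u - f t v) \<bullet> (u - v)) \<le> 2 * h * (L * (norm (u - v))\<^sup>2)"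
    using h by (intro mult_left_mono f_one_sided t) auto
  have "(norm ((u + h *\<^sub>R f t u) - (v + h *\<^sub>R f t v)))\<^sup>2 = (norm ((u - v) + h *\<^sub>R (f t u - f t v)))\<^sup>2"
    by (simp add: algebra_simps)
  also have "\<dots> = (norm (u - v))\<^sup>2 + 2 * h * ((f t u - f t v) \<bullet> (u - v)) + h\<^sup>2 * (norm (f t u - f t v))\<^sup>2"
    unfolding power2_norm_eq_inner
    by (simp add: inner_add_left inner_add_right inner_commute power2_eq_square)
  also have "\<dots> \<le> (norm (u - v))\<^sup>2 + 2 * h * (L * (norm (u - v))\<^sup>2) + h\<^sup>2 * (K\<^sup>2 * 3 powr (2 * (q - 1)) / h * (norm (u - v))\<^sup>2)"
    using 1 2 by linarith
  also have "\<dots> = (1 + (2 * L + K\<^sup>2 * 3 powr (2 * (q - 1))) * h) * (norm (u - v))\<^sup>2"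
    using h by (simp add: field_simps power2_eq_square)
  also have "\<dots> \<le> (1 + (2 * L + K\<^sup>2 * 3 powr (2 * (q - 1))) * h) * (norm (x - y))\<^sup>2"
    unfolding u_def v_def \<pi>_def using h L_pos
    by (intro mult_left_mono power_mono pem_projection_nonexpansive) (auto intro!: add_nonneg_nonneg mult_nonneg_nonneg)
  finally show ?thesis by (simp add: u_def v_def)
qed

text \<open>The projection error is used twice: with \<open>k = 4 * (q - 1)\<close> it is of order
  \<open>h\<^sup>2\<close> with weight \<open>4 * q - 3\<close>, which determines the final weight.
  Inside \<open>f\<close> there is already a factor \<open>h\<close>, so
  \<open>k = 2 * (q - 1)\<close> suffices, and the weight is only \<open>3 * q - 2\<close>.\<close>

lemma pem_step_consistent:
  assumes h: "0 < h" and t: "t \<in> {0..T}"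
  defines "\<pi> \<equiv> pem_projection pem_exponent h"
  shows "norm ((\<pi> x + h *\<^sub>R f t (\<pi> x)) - x - h *\<^sub>R f t x)
    \<le> (1 + K * 2 powr (q - 1)) * h\<^sup>2 * (1 + norm x) powr (4 * q - 3)"
proof -
  have q: "0 < q - 1" using q_ge by simp
  have e4: "norm (x - \<pi> x) \<le> h\<^sup>2 * (1 + norm x) powr (4 * q - 3)"
  proof -
    have "norm (x - \<pi> x) \<le> h powr (pem_exponent * (4 * (q - 1))) * norm x powr (4 * (q - 1) + 1)"
      unfolding \<pi>_def using q by (intro norm_pem_projection_error_le h) simp
    also have "pem_exponent * (4 * (q - 1)) = 2" using q by (simp add: field_simps)
    also have "h powr 2 = h\<^sup>2" using h by simp
    also have "norm x powr (4 * (q - 1) + 1) \<le> (1 + norm x) powr (4 * q - 3)"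
      using q by (simp add: algebra_simps powr_mono2)
    finally show ?thesis using h by (simp add: mult_left_mono)
  qed
  have e2: "norm (x - \<pi> x) \<le> h * (1 + norm x) powr (2 * q - 1)"
  proof -
    have "norm (x - \<pi> x) \<le> h powr (pem_exponent * (2 * (q - 1))) * norm x powr (2 * (q - 1) + 1)"
      unfolding \<pi>_def using q by (intro norm_pem_projection_error_le h) simp
    also have "pem_exponent * (2 * (q - 1)) = 1" using q by (simp add: field_simps)
    also have "h powr 1 = h" using h by simp
    also have "norm x powr (2 * (q - 1) + 1) \<le> (1 + norm x) powr (2 * q - 1)"
      using q by (simp add: algebra_simps powr_mono2)
    finally show ?thesis using h by (simp add: mult_left_mono)
  qed
  have "norm (f t (\<pi> x) - f t x) \<le> K * (1 + norm (\<pi> x) + norm x) powr (q - 1) * norm (\<pi> x - x)"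
    by (rule f_lipschitz[OF t])
  also have "\<dots> \<le> K * (2 * (1 + norm x)) powr (q - 1) * (h * (1 + norm x) powr (2 * q - 1))"
  proof (intro mult_mono powr_mono2)
    show "1 + norm (\<pi> x) + norm x \<le> 2 * (1 + norm x)"
      using norm_pem_projection_le(2)[OF h, of pem_exponent x] by (simp add: \<pi>_def)
    show "norm (\<pi> x - x) \<le> h * (1 + norm x) powr (2 * q - 1)" using e2 by (simp add: norm_minus_commute)
  qed (use K_ge q in auto)
  also have "\<dots> = K * 2 powr (q - 1) * h * ((1 + norm x) powr (q - 1) * (1 + norm x) powr (2 * q - 1))"
    by (subst powr_mult) (simp_all add: algebra_simps)
  also have "(1 + norm x) powr (q - 1) * (1 + norm x) powr (2 * q - 1) = (1 + norm x) powr (3 * q - 2)"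
    by (simp add: powr_add[symmetric])
  also have "K * 2 powr (q - 1) * h * (1 + norm x) powr (3 * q - 2) \<le> K * 2 powr (q - 1) * h * (1 + norm x) powr (4 * q - 3)"
    using K_ge h q by (intro mult_left_mono one_plus_powr_mono) auto
  finally have f: "norm (f t (\<pi> x) - f t x) \<le> K * 2 powr (q - 1) * h * (1 + norm x) powr (4 * q - 3)" .
  have "norm ((\<pi> x + h *\<^sub>R f t (\<pi> x)) - x - h *\<^sub>R f t x) = norm ((\<pi> x - x) + h *\<^sub>R (f t (\<pi> x) - f t x))"
    by (simp add: algebra_simps)
  also have "\<dots> \<le> norm (\<pi> x - x) + h * norm (f t (\<pi> x) - f t x)"
    using norm_triangle_ineq[of "\<pi> x - x" "h *\<^sub>R (f t (\<pi> x) - f t x)"] h by simp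
  also have "\<dots> \<le> h\<^sup>2 * (1 + norm x) powr (4 * q - 3) + h * (K * 2 powr (q - 1) * h * (1 + norm x) powr (4 * q - 3))"
    using h e4 f by (intro add_mono mult_left_mono) (auto simp: norm_minus_commute)
  also have "\<dots> = (1 + K * 2 powr (q - 1)) * h\<^sup>2 * (1 + norm x) powr (4 * q - 3)"
    by (simp add: algebra_simps power2_eq_square)
  finally show ?thesis .
qed

text \<open>The inverse of the map \<open>y - h *\<^sub>R f t y\<close>, written with the same
  \<open>THE\<close> as in \<open>split_step_backward_euler\<close>.\<close>

definition resolvent :: "real \<Rightarrow> real \<Rightarrow> 'a \<Rightarrow> 'a" where
  "resolvent h t x = (THE y. y = x + h *\<^sub>R f t y)"

text \<open>Take the inner product of the difference of the two equations with \<open>u - v\<close>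
  and apply the one-sided condition. This gives uniqueness, the Lipschitz constant of the resolvent,
  and the distance from a point to its image.\<close>

lemma implicit_step_distance:
  assumes h: "0 \<le> h" and t: "t \<in> {0..T}"
    and u: "u = x + h *\<^sub>R f t u" and v: "v = y + h *\<^sub>R f t v"
  shows "(1 - h * L) * norm (u - v) \<le> norm (x - y)"
proof (cases "u = v")
  case False
  have "(u - v) \<bullet> (u - v) = (x - y + h *\<^sub>R (f t u - f t v)) \<bullet> (u - v)"
  proof -
    have "u - v = x - y + h *\<^sub>R (f t u - f t v)" using u v by (simp add: algebra_simps)
    then show ?thesis by simp
  qed
  also have "\<dots> = (x - y) \<bullet> (u - v) + h * ((f t u - f t v) \<bullet> (u - v))" by (simp add: inner_add_left)
  also have "\<dots> \<le> norm (x - y) * norm (u - v) + h * (L * (norm (u - v))\<^sup>2)"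
    using h by (intro add_mono norm_cauchy_schwarz mult_left_mono f_one_sided t)
  finally have "((1 - h * L) * norm (u - v)) * norm (u - v) \<le> norm (x - y) * norm (u - v)"
    by (simp add: power2_norm_eq_inner[symmetric] power2_eq_square algebra_simps)
  then show ?thesis using False by simp
qed simp

text \<open>By the one-sided condition the field \<open>G\<close> points outwards on a large sphere
  around \<open>x\<close>. If \<open>G\<close> had no zero, the ball would be mapped continuously to
  the sphere by the direction opposite to \<open>G\<close>, and at a fixed point given by Brouwer's
  theorem \<open>G\<close> would point inwards.\<close>

lemma implicit_step_exists:
  assumes h: "0 \<le> h" "h * L < 1" and t: "t \<in> {0..T}"
  shows "\<exists>y. y = x + h *\<^sub>R f t y"
proof (rule ccontr)
  assume no: "\<not> ?thesis"
  define G where "G z = z - x - h *\<^sub>R f t z" for z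
  have G0: "G z \<noteq> 0" for z using no by (auto simp: G_def algebra_simps)
  \<comment> \<open>Large enough for \<open>h * norm (f t x) < (1 - h * L) * r\<close>, which makes
    \<open>G\<close> point outwards; the summand 1 makes the inequality strict and \<open>r\<close>
    positive.\<close>
  define r where "r = h * norm (f t x) / (1 - h * L) + 1"
  have "0 \<le> h * norm (f t x) / (1 - h * L)" using h by (intro divide_nonneg_nonneg) auto
  then have r: "0 < r" by (simp add: r_def)
  have "(1 - h * L) * r = h * norm (f t x) + (1 - h * L)" using h by (simp add: r_def distrib_left)
  then have r2: "h * norm (f t x) < (1 - h * L) * r" using h by simp
  have pos: "0 < G z \<bullet> (z - x)" if z: "norm (z - x) = r" for z
  proof -
    have "(f t z - f t x) \<bullet> (z - x) + f t x \<bullet> (z - x) \<le> L * r\<^sup>2 + norm (f t x) * r"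
      using f_one_sided[OF t, of z x] norm_cauchy_schwarz[of "f t x" "z - x"] z by simp
    then have "h * (f t z \<bullet> (z - x)) \<le> h * (L * r\<^sup>2 + norm (f t x) * r)"
      using h by (intro mult_left_mono) (auto simp: inner_diff_left)
    moreover have "h * (L * r\<^sup>2 + norm (f t x) * r) < r\<^sup>2"
    proof -
      have "h * norm (f t x) * r < (1 - h * L) * r * r" using r r2 by (intro mult_strict_right_mono)
      then show ?thesis by (simp add: algebra_simps power2_eq_square)
    qed
    moreover have "G z \<bullet> (z - x) = r\<^sup>2 - h * (f t z \<bullet> (z - x))"
    proof -
      have "G z \<bullet> (z - x) = (z - x) \<bullet> (z - x) - (h *\<^sub>R f t z) \<bullet> (z - x)"
        unfolding G_def by (rule inner_diff_left)
      then show ?thesis unfolding power2_norm_eq_inner[symmetric] z by simp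
    qed
    ultimately show ?thesis by linarith
  qed
  have ftc: "continuous_on UNIV (f t)"
    by (rule continuous_on_compose2[OF f_continuous, where f = "\<lambda>x. (t, x)", simplified prod.case])
      (use t in \<open>auto intro!: continuous_intros\<close>)
  have Gc: "continuous_on (cball x r) G"
    unfolding G_def by (intro continuous_intros continuous_on_subset[OF ftc]) simp
  define \<phi> where "\<phi> z = x - (r / norm (G z)) *\<^sub>R G z" for z
  have \<phi>n: "norm (\<phi> z - x) = r" for z using G0[of z] r by (simp add: \<phi>_def)
  obtain z where z: "z \<in> cball x r" "\<phi> z = z"
  proof (rule brouwer[of "cball x r" \<phi>])
    show "compact (cball x r)" "convex (cball x r)" "cball x r \<noteq> {}" using r by auto
    show "continuous_on (cball x r) \<phi>"
      unfolding \<phi>_def by (intro continuous_intros Gc) (use G0 in auto)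
    have "\<phi> z \<in> cball x r" for z using \<phi>n[of z] by (simp add: dist_norm norm_minus_commute)
    then show "\<phi> \<in> cball x r \<rightarrow> cball x r" by auto
  qed
  have "norm (z - x) = r" using \<phi>n[of z] z(2) by simp
  then have "0 < G z \<bullet> (z - x)" by (rule pos)
  also have "z - x = - ((r / norm (G z)) *\<^sub>R G z)" using z(2) by (simp add: \<phi>_def algebra_simps)
  also have "G z \<bullet> (- ((r / norm (G z)) *\<^sub>R G z)) = - (r / norm (G z) * (G z \<bullet> G z))" by simp
  also have "\<dots> \<le> 0" using r by simp
  finally show False by simp
qed

lemma resolvent_eq:
  assumes h: "0 \<le> h" "h * L < 1" and t: "t \<in> {0..T}"
  shows "resolvent h t x = x + h *\<^sub>R f t (resolvent h t x)"
proof -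
  obtain y where y: "y = x + h *\<^sub>R f t y" using implicit_step_exists[OF assms] by blast
  show ?thesis
    unfolding resolvent_def
  proof (rule theI[of "\<lambda>y. y = x + h *\<^sub>R f t y", OF y])
    fix z assume z: "z = x + h *\<^sub>R f t z"
    have "(1 - h * L) * norm (z - y) \<le> 0" using implicit_step_distance[OF h(1) t z y] by simp
    then have "norm (z - y) \<le> 0" using h by (simp add: mult_le_0_iff)
    then show "z = y" by simp
  qed
qed

text \<open>\<open>a\<close> bounds the Lipschitz constant of the resolvent uniformly for steps up
  to \<open>hbar\<close>, and \<open>1 / (1 - h * L) = 1 + h * L / (1 - h * L)\<close> exhibits the
  linear dependence on \<open>h\<close>. For consistency, \<open>u - x = h *\<^sub>R f t u\<close>,
  and \<open>f t u\<close> is compared first with \<open>f t x\<close>, then with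
  \<open>f s x\<close>; the weights \<open>q - 1\<close> and \<open>q\<close> add up to
  \<open>2 * q - 1\<close>.\<close>

lemma resolvent_bounds:
  assumes h: "0 < h" "h \<le> hbar" "hbar * L < 1" and st: "s \<in> {0..T}" "t \<in> {0..T}" "t - s = h"
  defines "a \<equiv> 1 / (1 - hbar * L)"
  shows resolvent_stable: "(norm (resolvent h t x - resolvent h t y))\<^sup>2
      \<le> (1 + (2 * (a * L) + (a * L)\<^sup>2 * hbar) * h) * (norm (x - y))\<^sup>2"
    and resolvent_consistent: "norm (resolvent h t x - x - h *\<^sub>R f s x)
      \<le> (K\<^sup>2 * a * (2 + a + a * hbar * K) powr (q - 1) + K) * h\<^sup>2 * (1 + norm x) powr (2 * q - 1)"
proof -
  have hL: "h * L \<le> hbar * L" using h L_pos by (intro mult_right_mono) auto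
  have hL1: "h * L < 1" using hL h by simp
  have h0: "0 \<le> h" using h by simp
  have a: "0 < a" using h by (simp add: a_def)
  have ah: "1 / (1 - h * L) \<le> a" unfolding a_def using hL h by (intro divide_left_mono mult_pos_pos) auto
  have q: "0 < q - 1" using q_ge by simp
  note eq = resolvent_eq[OF h0 hL1 st(2)]
  have div: "n \<le> c * a" if "(1 - h * L) * n \<le> c" "0 \<le> c" for n c
  proof -
    have "n \<le> c * (1 / (1 - h * L))" using that hL1 by (simp add: field_simps)
    also have "\<dots> \<le> c * a" using that ah by (intro mult_left_mono) auto
    finally show ?thesis .
  qed
  have dist: "norm (resolvent h t x - resolvent h t y) \<le> norm (x - y) * (1 / (1 - h * L))" for x y
    using implicit_step_distance[OF h0 st(2) eq[of x] eq[of y]] hL1 by (simp add: field_simps)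
  have incr: "norm (resolvent h t x - x) \<le> h * norm (f t x) * a" for x
  proof (rule div)
    \<comment> \<open>The point \<open>x\<close> solves the implicit equation with data
      \<open>x - h *\<^sub>R f t x\<close>, so the distance lemma compares it with its own
      resolvent.\<close>
    have "x = (x - h *\<^sub>R f t x) + h *\<^sub>R f t x" by simp
    from implicit_step_distance[OF h0 st(2) eq[of x] this]
    show "(1 - h * L) * norm (resolvent h t x - x) \<le> h * norm (f t x)" using h by simp
  qed (use h in simp)
  show "(norm (resolvent h t x - resolvent h t y))\<^sup>2
      \<le> (1 + (2 * (a * L) + (a * L)\<^sup>2 * hbar) * h) * (norm (x - y))\<^sup>2"
  proof -
    have "1 / (1 - h * L) = 1 + h * L * (1 / (1 - h * L))" using hL1 by (simp add: field_simps)
    also have "\<dots> \<le> 1 + h * L * a" using h L_pos ah by (intro add_left_mono mult_left_mono) auto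
    finally have c: "1 / (1 - h * L) \<le> 1 + a * L * h" by (simp add: algebra_simps)
    have "norm (resolvent h t x - resolvent h t y) \<le> norm (x - y) * (1 + a * L * h)"
      using dist[of x y] mult_left_mono[OF c norm_ge_zero[of "x - y"]] by linarith
    then have "(norm (resolvent h t x - resolvent h t y))\<^sup>2 \<le> (norm (x - y) * (1 + a * L * h))\<^sup>2"
      by (intro power_mono) auto
    also have "\<dots> = (1 + a * L * h)\<^sup>2 * (norm (x - y))\<^sup>2" by (simp add: power_mult_distrib)
    also have "(1 + a * L * h)\<^sup>2 \<le> 1 + (2 * (a * L) + (a * L)\<^sup>2 * hbar) * h"
    proof -
      have "(1 + a * L * h)\<^sup>2 = 1 + (2 * (a * L) + (a * L)\<^sup>2 * h) * h"
        by (simp add: power2_eq_square algebra_simps)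
      also have "\<dots> \<le> 1 + (2 * (a * L) + (a * L)\<^sup>2 * hbar) * h"
        using h by (intro add_left_mono mult_right_mono mult_left_mono) auto
      finally show ?thesis .
    qed
    finally show ?thesis by (simp add: mult_right_mono)
  qed
  \<comment> \<open>Linear growth of the resolvent: Lipschitz constant at most \<open>a\<close>, and
    norm at most \<open>a * hbar * K\<close> at the point 0.\<close>
  define B where "B = 1 + a + a * hbar * K"
  have B: "1 \<le> B" using a h K_ge by (simp add: B_def)
  define u where "u = resolvent h t x"
  have u1: "1 + norm u \<le> B * (1 + norm x)"
  proof -
    have "norm (u - resolvent h t 0) \<le> norm x * (1 / (1 - h * L))" using dist[of x 0] by (simp add: u_def)
    also have "\<dots> \<le> norm x * a" using ah by (intro mult_left_mono) auto
    finally have 1: "norm (u - resolvent h t 0) \<le> norm x * a" .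
    have "norm (resolvent h t 0) \<le> h * norm (f t 0) * a" using incr[of 0] by simp
    also have "\<dots> \<le> hbar * K * a"
      using h a f_growth[OF st(2), of 0] K_ge by (intro mult_right_mono mult_mono) auto
    finally have 2: "norm (resolvent h t 0) \<le> hbar * K * a" .
    have "norm u \<le> norm x * a + hbar * K * a"
      using 1 2 norm_triangle_ineq[of "u - resolvent h t 0" "resolvent h t 0"] by simp
    then have "norm u \<le> a * norm x + a * hbar * K" by (simp add: mult_ac)
    moreover have "0 \<le> a * hbar * K * norm x" "0 \<le> norm x" using a h K_ge by simp_all
    moreover have eqB: "B * (1 + norm x) = 1 + a + a * hbar * K + norm x + a * norm x + a * hbar * K * norm x"
      by (simp add: B_def algebra_simps)
    moreover have "0 \<le> a * norm x" using a by simp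
    ultimately show ?thesis using a unfolding eqB by linarith
  qed
  have ux: "norm (u - x) \<le> h * (K * (1 + norm x) powr q) * a"
    unfolding u_def by (rule order_trans[OF incr]) (use h a in \<open>auto intro!: mult_right_mono mult_left_mono f_growth st\<close>)
  have "norm (f t u - f t x) \<le> K * (1 + norm u + norm x) powr (q - 1) * norm (u - x)"
    by (rule f_lipschitz[OF st(2)])
  also have "\<dots> \<le> K * ((1 + B) * (1 + norm x)) powr (q - 1) * (h * (K * (1 + norm x) powr q) * a)"
  proof (intro mult_mono powr_mono2 ux)
    show "1 + norm u + norm x \<le> (1 + B) * (1 + norm x)" using u1 by (simp add: distrib_right)
  qed (use K_ge q in auto)
  also have "\<dots> = K\<^sup>2 * a * (1 + B) powr (q - 1) * h * ((1 + norm x) powr (q - 1) * (1 + norm x) powr q)"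
    using B by (simp add: powr_mult power2_eq_square)
  also have "(1 + norm x) powr (q - 1) * (1 + norm x) powr q = (1 + norm x) powr (2 * q - 1)"
    by (simp add: powr_add[symmetric])
  finally have 1: "norm (f t u - f t x) \<le> K\<^sup>2 * a * (1 + B) powr (q - 1) * h * (1 + norm x) powr (2 * q - 1)" .
  have "norm (f t x - f s x) \<le> K * (1 + norm x) powr q * h"
    using f_time_lipschitz[OF st(1,2), of x] st(3) h by simp
  also have "\<dots> \<le> K * (1 + norm x) powr (2 * q - 1) * h"
    using K_ge h q_ge by (intro mult_right_mono mult_left_mono one_plus_powr_mono) auto
  finally have 2: "norm (f t x - f s x) \<le> K * (1 + norm x) powr (2 * q - 1) * h" .
  have "u - x = h *\<^sub>R f t u" using eq[of x] unfolding u_def[symmetric] by (metis add_diff_cancel_left')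
  then have "u - x - h *\<^sub>R f s x = h *\<^sub>R ((f t u - f t x) + (f t x - f s x))"
    by (simp add: algebra_simps)
  then have "norm (u - x - h *\<^sub>R f s x) = h * norm ((f t u - f t x) + (f t x - f s x))" using h by simp
  also have "\<dots> \<le> h * (norm (f t u - f t x) + norm (f t x - f s x))"
    using h by (intro mult_left_mono norm_triangle_ineq) auto
  also have "\<dots> \<le> h * (K\<^sup>2 * a * (1 + B) powr (q - 1) * h * (1 + norm x) powr (2 * q - 1) + K * (1 + norm x) powr (2 * q - 1) * h)"
    using h by (intro mult_left_mono add_mono 1 2) auto
  also have "\<dots> = (K\<^sup>2 * a * (1 + B) powr (q - 1) + K) * h\<^sup>2 * (1 + norm x) powr (2 * q - 1)"
    by (simp add: algebra_simps power2_eq_square)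
  also have "1 + B = 2 + a + a * hbar * K" by (simp add: B_def)
  finally show "norm (resolvent h t x - x - h *\<^sub>R f s x)
      \<le> (K\<^sup>2 * a * (2 + a + a * hbar * K) powr (q - 1) + K) * h\<^sup>2 * (1 + norm x) powr (2 * q - 1)"
    by (simp add: u_def)
qed

end

section \<open>Additive noise\<close>

lemma sum_powr_le:
  fixes a :: "'i \<Rightarrow> real"
  assumes S: "finite S" "S \<noteq> {}" and nn: "\<And>i. i \<in> S \<Longrightarrow> 0 \<le> a i" and p: "0 \<le> p"
  shows "(\<Sum>i\<in>S. a i) powr p \<le> real (card S) powr p * (\<Sum>i\<in>S. a i powr p)"
proof -
  have "Max (a ` S) \<in> a ` S" using S by (intro Max_in) auto
  then obtain k where k: "k \<in> S" "Max (a ` S) = a k" by auto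
  have "(\<Sum>i\<in>S. a i) \<le> (\<Sum>i\<in>S. a k)" using k S by (intro sum_mono) (metis Max_ge finite_imageI imageI)
  then have "(\<Sum>i\<in>S. a i) powr p \<le> (real (card S) * a k) powr p"
    using p by (intro powr_mono2) (auto intro!: sum_nonneg nn)
  also have "\<dots> = real (card S) powr p * a k powr p" using nn[OF k(1)] by (simp add: powr_mult)
  also have "\<dots> \<le> real (card S) powr p * (\<Sum>i\<in>S. a i powr p)"
    using k S by (intro mult_left_mono member_le_sum) auto
  finally show ?thesis .
qed

context usual_filtered_prob_space
begin

text \<open>The partition points are nonnegative, so all approximating simple integrals vanish at
  time 0, and \<open>J 0\<close> is their mean square limit.\<close>

lemma ito_integral_0:
  fixes J :: "real \<Rightarrow> 'w \<Rightarrow> 'a::euclidean_space"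
  assumes ito: "is_ito_integral M F T W G J" and T: "0 \<le> T"
  shows "AE w in M. J 0 w = 0"
proof -
  obtain k \<tau> \<xi> where s: "\<And>n. simple_integrand M F T (k n) (\<tau> n) (\<xi> n)"
    and lim: "\<forall>t\<in>{0..T}. (\<lambda>n. \<integral>\<^sup>+w.
            ennreal ((norm (simple_integral W (k n) (\<tau> n) (\<xi> n) t w - J t w))\<^sup>2) \<partial>M) \<longlonglongrightarrow> 0"
    using ito unfolding is_ito_integral_def by blast
  have "simple_integral W (k n) (\<tau> n) (\<xi> n) 0 w = 0" for n w
  proof -
    have nn: "0 \<le> \<tau> n j" if "j \<le> k n" for j
      using partition_mono[of "k n" "\<tau> n" 0 j] s[of n] that by (auto simp: simple_integrand_def)
    then have "min (\<tau> n j) 0 = 0" if "j \<le> k n" for j using nn[OF that] by simp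
    then show ?thesis by (simp add: simple_integral_def)
  qed
  then have "(\<lambda>n::nat. \<integral>\<^sup>+w. ennreal ((norm (J 0 w))\<^sup>2) \<partial>M) \<longlonglongrightarrow> 0"
    using lim[rule_format, of 0] T by simp
  then have "(\<integral>\<^sup>+w. ennreal ((norm (J 0 w))\<^sup>2) \<partial>M) = 0"
    using LIMSEQ_unique[OF tendsto_const] by blast
  moreover have "J 0 \<in> borel_measurable M"
    using measurable_F_M[of 0] ito_adapted[OF ito, of 0] T by simp
  ultimately show ?thesis
    by (subst (asm) nn_integral_0_iff_AE) auto
qed

end

locale additive_noise = usual_filtered_prob_space M F T for M :: "'w measure" and F and T :: real +
  fixes W :: "'m::finite \<Rightarrow> real \<Rightarrow> 'w \<Rightarrow> real"
    and g :: "'m \<Rightarrow> real \<Rightarrow> 'a::euclidean_space" and I :: "'m \<Rightarrow> real \<Rightarrow> 'w \<Rightarrow> 'a" and B :: real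
  assumes bm: "brownian_motion M F T (W r)"
    and ito: "is_ito_integral M F T (W r) (\<lambda>s _. g r s) (I r)"
    and B_pos: "0 < B" and g_bound: "t \<in> {0..T} \<Longrightarrow> norm (g r t) \<le> B"
    and g_lipschitz: "s \<in> {0..T} \<Longrightarrow> t \<in> {0..T} \<Longrightarrow> norm (g r t - g r s) \<le> B * \<bar>t - s\<bar>"
    and g_continuous: "continuous_on {0..T} (g r)"
begin

definition noise :: "real \<Rightarrow> 'w \<Rightarrow> 'a" where
  "noise t w = (\<Sum>r\<in>UNIV. I r t w)"

text \<open>\<open>\<sigma>\<close> is the time at which the coefficients are frozen: the left end
  point for the projected method, the right one for the implicit method.\<close>

definition noise_approx :: "real \<Rightarrow> real \<Rightarrow> real \<Rightarrow> 'w \<Rightarrow> 'a" where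
  "noise_approx \<sigma> s t w = (\<Sum>r\<in>UNIV. (W r t w - W r s w) *\<^sub>R g r \<sigma>)"

lemma I_measurable: "t \<in> {0..T} \<Longrightarrow> I r t \<in> borel_measurable M"
  using measurable_F_M ito_adapted[OF ito] by blast

lemma noise_adapted: "t \<in> {0..T} \<Longrightarrow> noise t \<in> borel_measurable (F t)"
  unfolding noise_def[abs_def] by (intro borel_measurable_sum ito_adapted[OF ito])

lemma noise_approx_adapted:
  assumes "0 \<le> s" "s \<le> t" "t \<le> T"
  shows "noise_approx \<sigma> s t \<in> borel_measurable (F t)"
proof -
  have "W r s \<in> borel_measurable (F t)" "W r t \<in> borel_measurable (F t)" for r
    using measurable_F_mono[OF assms bm_adapted[OF bm]] bm_adapted[OF bm] assms by auto
  then show ?thesis unfolding noise_approx_def[abs_def] by auto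
qed

lemma nn_integral_norm_sum_powr_le:
  fixes Y :: "'m \<Rightarrow> 'w \<Rightarrow> 'a"
  assumes [measurable]: "\<And>r. Y r \<in> borel_measurable M" and p: "0 \<le> p"
    and le: "\<And>r. (\<integral>\<^sup>+w. ennreal (norm (Y r w) powr p) \<partial>M) \<le> ennreal C" and C: "0 \<le> C"
  shows "(\<integral>\<^sup>+w. ennreal (norm (\<Sum>r\<in>UNIV. Y r w) powr p) \<partial>M) \<le> ennreal (real CARD('m) powr p * real CARD('m) * C)"
proof -
  have "(\<integral>\<^sup>+w. ennreal (norm (\<Sum>r\<in>UNIV. Y r w) powr p) \<partial>M)
    \<le> (\<integral>\<^sup>+w. ennreal (real CARD('m) powr p) * (\<Sum>r\<in>UNIV. ennreal (norm (Y r w) powr p)) \<partial>M)"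
  proof (rule nn_integral_mono)
    fix w
    have "norm (\<Sum>r\<in>UNIV. Y r w) powr p \<le> (\<Sum>r\<in>UNIV. norm (Y r w)) powr p"
      using p by (intro powr_mono2 norm_sum) auto
    also have "\<dots> \<le> real CARD('m) powr p * (\<Sum>r\<in>UNIV. norm (Y r w) powr p)"
      using p by (intro sum_powr_le) auto
    finally show "ennreal (norm (\<Sum>r\<in>UNIV. Y r w) powr p)
        \<le> ennreal (real CARD('m) powr p) * (\<Sum>r\<in>UNIV. ennreal (norm (Y r w) powr p))"
      by (simp add: sum_ennreal ennreal_mult[symmetric] sum_nonneg ennreal_leI)
  qed
  also have "\<dots> = ennreal (real CARD('m) powr p) * (\<Sum>r\<in>UNIV. \<integral>\<^sup>+w. ennreal (norm (Y r w) powr p) \<partial>M)"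
    by (simp add: nn_integral_cmult nn_integral_sum del: sum_ennreal)
  also have "\<dots> \<le> ennreal (real CARD('m) powr p) * (\<Sum>r\<in>(UNIV :: 'm set). ennreal C)"
    by (intro mult_left_mono sum_mono le) auto
  also have "\<dots> = ennreal (real CARD('m) powr p * real CARD('m) * C)"
    using C by (simp add: ennreal_mult ennreal_of_nat_eq_real_of_nat mult.assoc)
  finally show ?thesis .
qed

lemma I_increment_measurable:
  assumes "0 \<le> s" "s \<le> t" "t \<le> T"
  shows "(\<lambda>w. I r t w - I r s w - (W r t w - W r s w) *\<^sub>R v) \<in> borel_measurable M"
proof -
  have [measurable]: "I r t \<in> borel_measurable M" "I r s \<in> borel_measurable M"
    "W r t \<in> borel_measurable M" "W r s \<in> borel_measurable M"
    using I_measurable bm_measurable[OF bm] assms by auto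
  show ?thesis by measurable
qed

lemma noise_increment_sum:
  "noise t w - noise s w - (\<Sum>r\<in>UNIV. (W r t w - W r s w) *\<^sub>R v r)
    = (\<Sum>r\<in>UNIV. I r t w - I r s w - (W r t w - W r s w) *\<^sub>R v r)"
  by (simp add: noise_def sum_subtractf)

lemma noise_increment_moment:
  assumes p: "0 \<le> p"
  obtains C where "0 \<le> C"
    "\<And>s t v b. 0 \<le> s \<Longrightarrow> s < t \<Longrightarrow> t \<le> T \<Longrightarrow> 0 < b \<Longrightarrow> \<forall>r. \<forall>u\<in>{s..t}. norm (g r u - v r) \<le> b \<Longrightarrow>
      (\<integral>\<^sup>+w. ennreal (norm (noise t w - noise s w - (\<Sum>r\<in>UNIV. (W r t w - W r s w) *\<^sub>R v r)) powr p) \<partial>M)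
        \<le> ennreal (C * (b * sqrt (t - s)) powr p)"
proof -
  obtain C where C: "0 < C"
    and le: "\<And>W G J s t v B. brownian_motion M F T W \<Longrightarrow> is_ito_integral M F T W (\<lambda>s _. G s :: 'a) J \<Longrightarrow>
      continuous_on {0..T} G \<Longrightarrow> 0 \<le> s \<Longrightarrow> s < t \<Longrightarrow> t \<le> T \<Longrightarrow> 0 < B \<Longrightarrow>
      \<forall>u\<in>{s..t}. norm (G u - v) \<le> B \<Longrightarrow>
      (\<integral>\<^sup>+w. ennreal (norm (J t w - J s w - (W t w - W s w) *\<^sub>R v) powr p) \<partial>M)
        \<le> ennreal (C * (B * sqrt (t - s)) powr p)"
    by (rule ito_increment_moment[OF p]) (rule that; assumption)
  show ?thesis
  proof (rule that)
    show "0 \<le> real CARD('m) powr p * real CARD('m) * C" using C by simp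
    fix s t v b
    assume st: "0 \<le> s" "s < t" "t \<le> T" and b: "0 < b" and v: "\<forall>r. \<forall>u\<in>{s..t}. norm (g r u - v r) \<le> b"
    have "(\<integral>\<^sup>+w. ennreal (norm (\<Sum>r\<in>UNIV. I r t w - I r s w - (W r t w - W r s w) *\<^sub>R v r) powr p) \<partial>M)
      \<le> ennreal (real CARD('m) powr p * real CARD('m) * (C * (b * sqrt (t - s)) powr p))"
    proof (rule nn_integral_norm_sum_powr_le[OF _ p])
      show "(\<integral>\<^sup>+w. ennreal (norm (I r t w - I r s w - (W r t w - W r s w) *\<^sub>R v r) powr p) \<partial>M)
        \<le> ennreal (C * (b * sqrt (t - s)) powr p)" for r
        by (rule le[OF bm ito g_continuous st b]) (use v in blast)
      show "(\<lambda>w. I r t w - I r s w - (W r t w - W r s w) *\<^sub>R v r) \<in> borel_measurable M" for r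
        by (rule I_increment_measurable) (use st in auto)
    qed (use C in simp)
    then show "(\<integral>\<^sup>+w. ennreal (norm (noise t w - noise s w - (\<Sum>r\<in>UNIV. (W r t w - W r s w) *\<^sub>R v r)) powr p) \<partial>M)
      \<le> ennreal (real CARD('m) powr p * real CARD('m) * C * (b * sqrt (t - s)) powr p)"
      unfolding noise_increment_sum by (simp add: mult.assoc)
  qed
qed

lemma noise_moment:
  assumes p: "0 \<le> p"
  shows "\<exists>C\<ge>0. \<forall>s t. 0 \<le> s \<and> s < t \<and> t \<le> T \<longrightarrow>
    (\<integral>\<^sup>+w. ennreal (norm (noise t w - noise s w) powr p) \<partial>M) \<le> ennreal (C * (t - s) powr (p / 2))"
proof -
  obtain C where C: "0 \<le> C"
    "\<And>s t v b. 0 \<le> s \<Longrightarrow> s < t \<Longrightarrow> t \<le> T \<Longrightarrow> 0 < b \<Longrightarrow> \<forall>r. \<forall>u\<in>{s..t}. norm (g r u - v r) \<le> b \<Longrightarrow>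
      (\<integral>\<^sup>+w. ennreal (norm (noise t w - noise s w - (\<Sum>r\<in>UNIV. (W r t w - W r s w) *\<^sub>R v r)) powr p) \<partial>M)
        \<le> ennreal (C * (b * sqrt (t - s)) powr p)"
    by (rule noise_increment_moment[OF p]) (rule that; assumption)
  have "(\<integral>\<^sup>+w. ennreal (norm (noise t w - noise s w) powr p) \<partial>M) \<le> ennreal (C * B powr p * (t - s) powr (p / 2))"
    if st: "0 \<le> s \<and> s < t \<and> t \<le> T" for s t
  proof -
    have "(B * sqrt (t - s)) powr p = B powr p * (t - s) powr (p / 2)"
      using st B_pos by (simp add: powr_mult powr_half_sqrt[symmetric] powr_powr)
    moreover have "\<forall>r. \<forall>u\<in>{s..t}. norm (g r u - 0) \<le> B" using st g_bound by auto
    ultimately show ?thesis using C(2)[of s t B "\<lambda>_. 0"] st B_pos by (simp add: mult.assoc)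
  qed
  then show ?thesis using C(1) by (intro exI[of _ "C * B powr p"]) simp
qed

text \<open>Freezing the coefficients anywhere within the step changes them by at most
  \<open>B * (t - s)\<close>. The square of this times the length of the step gives the
  cube.\<close>

lemma noise_approx_error:
  "\<exists>c\<ge>0. \<forall>s t \<sigma>. 0 \<le> s \<and> s < t \<and> t \<le> T \<and> \<sigma> \<in> {s..t} \<longrightarrow>
    (\<integral>\<^sup>+w. ennreal ((norm (noise t w - noise s w - noise_approx \<sigma> s t w))\<^sup>2) \<partial>M) \<le> ennreal (c * (t - s)^3)"
proof -
  obtain C where C: "0 \<le> C"
    "\<And>s t v b. 0 \<le> s \<Longrightarrow> s < t \<Longrightarrow> t \<le> T \<Longrightarrow> 0 < b \<Longrightarrow> \<forall>r. \<forall>u\<in>{s..t}. norm (g r u - v r) \<le> b \<Longrightarrow>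
      (\<integral>\<^sup>+w. ennreal (norm (noise t w - noise s w - (\<Sum>r\<in>UNIV. (W r t w - W r s w) *\<^sub>R v r)) powr 2) \<partial>M)
        \<le> ennreal (C * (b * sqrt (t - s)) powr 2)"
    by (rule noise_increment_moment[OF zero_le_numeral[of "num.Bit0 num.One"]]) (rule that; assumption)
  have "(\<integral>\<^sup>+w. ennreal ((norm (noise t w - noise s w - noise_approx \<sigma> s t w))\<^sup>2) \<partial>M) \<le> ennreal (C * B\<^sup>2 * (t - s)^3)"
    if st: "0 \<le> s \<and> s < t \<and> t \<le> T \<and> \<sigma> \<in> {s..t}" for s t \<sigma>
  proof -
    have "(B * (t - s) * sqrt (t - s)) powr 2 = B\<^sup>2 * (t - s)^3"
      using st B_pos by (simp add: power_mult_distrib power2_eq_square power3_eq_cube)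
    moreover have "norm (g r u - g r \<sigma>) \<le> B * (t - s)" if u: "u \<in> {s..t}" for r u
    proof -
      have "norm (g r u - g r \<sigma>) \<le> B * \<bar>u - \<sigma>\<bar>" using u st by (intro g_lipschitz) auto
      also have "\<dots> \<le> B * (t - s)" using u st B_pos by (intro mult_left_mono) auto
      finally show ?thesis .
    qed
    ultimately show ?thesis
      using C(2)[of s t "B * (t - s)" "\<lambda>r. g r \<sigma>"] st B_pos by (simp add: noise_approx_def mult.assoc)
  qed
  then show ?thesis using C(1) by (intro exI[of _ "C * B\<^sup>2"]) simp
qed

lemma noise_mean:
  assumes st: "0 \<le> s" "s \<le> t" "t \<le> T" and E: "E \<in> sets (F s)"
  shows "(\<integral>w. indicator E w *\<^sub>R (noise t w - noise s w) \<partial>M) = 0"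
    and "(\<integral>w. indicator E w *\<^sub>R (noise t w - noise s w - noise_approx \<sigma> s t w) \<partial>M) = 0"
proof -
  have EM: "E \<in> sets M" using sets_F_M[OF _ E] st by auto
  have eq: "indicator E w *\<^sub>R (noise t w - noise s w) = (\<Sum>r\<in>UNIV. indicator E w *\<^sub>R (I r t w - I r s w))" for w
    by (simp add: noise_def sum_subtractf scaleR_sum_right)
  have i: "integrable M (\<lambda>w. indicator E w *\<^sub>R (I r t w - I r s w))" for r
    by (rule integrable_mult_indicator[OF EM ito_increment_integrable[OF bm ito g_continuous st]])
  have iN: "integrable M (\<lambda>w. indicator E w *\<^sub>R (noise t w - noise s w))"
    unfolding eq by (rule Bochner_Integration.integrable_sum) (rule i)
  have z: "(\<integral>w. indicator E w *\<^sub>R (I r t w - I r s w) \<partial>M) = 0" for r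
    by (rule ito_increment_mean[OF bm ito g_continuous st E])
  show N0: "(\<integral>w. indicator E w *\<^sub>R (noise t w - noise s w) \<partial>M) = 0"
    unfolding eq by (subst Bochner_Integration.integral_sum[OF i]) (simp only: z sum.neutral_const)
  have U: "indicator E \<in> borel_measurable (F s)" "integrable M (indicator E :: _ \<Rightarrow> real)"
    using E EM by (auto simp: emeasure_eq_measure)
  have eqA: "indicator E w *\<^sub>R noise_approx \<sigma> s t w = (\<Sum>r\<in>UNIV. (indicator E w * (W r t w - W r s w)) *\<^sub>R g r \<sigma>)" for w
    by (simp add: noise_approx_def scaleR_sum_right)
  have a: "integrable M (\<lambda>w. (indicator E w * (W r t w - W r s w)) *\<^sub>R g r \<sigma>)"
    "(\<integral>w. (indicator E w * (W r t w - W r s w)) *\<^sub>R g r \<sigma> \<partial>M) = 0" for r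
    using bm_increment_mult(1,2)[OF bm st U] by simp_all
  have iA: "integrable M (\<lambda>w. indicator E w *\<^sub>R noise_approx \<sigma> s t w)"
    and A0: "(\<integral>w. indicator E w *\<^sub>R noise_approx \<sigma> s t w \<partial>M) = 0"
    unfolding eqA by (rule Bochner_Integration.integrable_sum, rule a(1))
      (subst Bochner_Integration.integral_sum[OF a(1)], simp only: a(2) sum.neutral_const)
  show "(\<integral>w. indicator E w *\<^sub>R (noise t w - noise s w - noise_approx \<sigma> s t w) \<partial>M) = 0"
    unfolding scaleR_diff_right[of _ "noise t _ - noise s _"] using iN iA N0 A0 by simp
qed

lemma noise_0: "0 \<le> T \<Longrightarrow> AE w in M. noise 0 w = 0"
proof -
  assume T: "0 \<le> T"
  have "AE w in M. \<forall>r\<in>UNIV. I r 0 w = 0"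
    by (rule AE_finite_allI) (auto intro: ito_integral_0[OF ito T])
  then show ?thesis by eventually_elim (simp add: noise_def)
qed

lemma noise_ae_continuous: "AE w in M. continuous_on {0..T} (\<lambda>t. noise t w)"
proof -
  have "AE w in M. \<forall>r\<in>UNIV. continuous_on {0..T} (\<lambda>t. I r t w)"
    by (rule AE_finite_allI) (use ito in \<open>auto simp: is_ito_integral_def ae_continuous_def\<close>)
  then show ?thesis
    by eventually_elim (auto simp: noise_def intro!: continuous_on_sum)
qed

end

section \<open>Continuous modifications and the criterion for strong convergence\<close>

context usual_filtered_prob_space
begin

text \<open>The process is set to 0 on a null set outside which the paths are continuous; by the
  usual conditions this set belongs to \<open>F 0\<close>, so adaptedness survives. Clamping time to
  \<open>{0..T}\<close> extends the paths continuously to the line, as the joint measurability lemma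
  requires.\<close>

lemma continuous_modification:
  fixes Y :: "real \<Rightarrow> 'w \<Rightarrow> 'a::{real_normed_vector, second_countable_topology}"
  assumes T: "0 \<le> T" and Y: "\<And>t. t \<in> {0..T} \<Longrightarrow> Y t \<in> borel_measurable (F t)"
    and c: "AE w in M. continuous_on {0..T} (\<lambda>t. Y t w)"
  obtains Y' where "\<And>t. t \<in> {0..T} \<Longrightarrow> Y' t \<in> borel_measurable (F t)"
    "(\<lambda>(t, w). Y' t w) \<in> borel_measurable (borel \<Otimes>\<^sub>M M)"
    "\<And>w. w \<in> space M \<Longrightarrow> continuous_on {0..T} (\<lambda>t. Y' t w)"
    "AE w in M. \<forall>t\<in>{0..T}. Y' t w = Y t w"
proof -
  from c obtain N where N: "{w \<in> space M. \<not> continuous_on {0..T} (\<lambda>t. Y t w)} \<subseteq> N"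
    "emeasure M N = 0" "N \<in> sets M"
    by (rule AE_E)
  have Nn: "N \<in> null_sets M" using N by auto
  then have N0: "N \<in> sets (F 0)" using null_sets_F0 by blast
  define clip where "clip t = max 0 (min T t)" for t
  have clip: "clip t \<in> {0..T}" for t using T by (simp add: clip_def)
  have clip_id: "clip t = t" if "t \<in> {0..T}" for t using that by (simp add: clip_def)
  define Y' where "Y' t w = (if w \<in> N then 0 else Y (clip t) w)" for t w
  have YF: "Y' t \<in> borel_measurable (F (clip t))" for t
  proof -
    have "N \<in> sets (F (clip t))" using F_mono[of 0 "clip t"] clip[of t] N0 by auto
    then show ?thesis unfolding Y'_def[abs_def] using Y[OF clip[of t]] by (intro measurable_If_set) auto
  qed
  have cont: "continuous_on UNIV (\<lambda>t. Y' t w)" if w: "w \<in> space M" for w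
  proof (cases "w \<in> N")
    case False
    then have "continuous_on {0..T} (\<lambda>t. Y t w)" using N(1) w by blast
    moreover have "continuous_on UNIV clip" unfolding clip_def by (intro continuous_intros)
    ultimately have "continuous_on UNIV (\<lambda>t. Y (clip t) w)"
      by (rule continuous_on_compose2) (use clip in auto)
    then show ?thesis using False by (simp add: Y'_def)
  qed (simp add: Y'_def)
  show ?thesis
  proof (rule that)
    show "Y' t \<in> borel_measurable (F t)" if "t \<in> {0..T}" for t using YF[of t] clip_id[OF that] by simp
    show "(\<lambda>(t, w). Y' t w) \<in> borel_measurable (borel \<Otimes>\<^sub>M M)"
      by (rule borel_measurable_continuous_process) (use measurable_F_M[OF clip YF] cont in auto)
    show "continuous_on {0..T} (\<lambda>t. Y' t w)" if "w \<in> space M" for w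
      using continuous_on_subset[OF cont[OF that]] by simp
    show "AE w in M. \<forall>t\<in>{0..T}. Y' t w = Y t w"
      using AE_not_in[OF Nn] by eventually_elim (simp add: Y'_def clip_id)
  qed
qed

lemma in_Lp_nn_integral_finite:
  fixes Y :: "'w \<Rightarrow> 'a::euclidean_space"
  assumes "in_Lp M p Y" "0 \<le> r" "r \<le> p"
  shows "(\<integral>\<^sup>+w. ennreal (norm (Y w) powr r) \<partial>M) < \<infinity>"
proof -
  have [measurable]: "Y \<in> borel_measurable M" and i: "integrable M (\<lambda>w. norm (Y w) powr p)"
    using assms by (auto simp: in_Lp_def)
  have "norm (Y w) powr r \<le> 1 + norm (Y w) powr p" for w
  proof (cases "norm (Y w) \<le> 1")
    case True
    then have "norm (Y w) powr r \<le> 1" using assms(2) by (intro powr_le1) auto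
    then show ?thesis by (rule order_trans) simp
  next
    case False
    then have "norm (Y w) powr r \<le> norm (Y w) powr p" using assms(3) by (intro powr_mono) auto
    then show ?thesis by (rule order_trans) simp
  qed
  then have "(\<integral>\<^sup>+w. ennreal (norm (Y w) powr r) \<partial>M) \<le> (\<integral>\<^sup>+w. ennreal (1 + norm (Y w) powr p) \<partial>M)"
    by (intro nn_integral_mono ennreal_leI)
  also have "\<dots> = ennreal (\<integral>w. 1 + norm (Y w) powr p \<partial>M)"
    by (rule nn_integral_eq_integral) (use i in auto)
  also have "\<dots> < \<infinity>" by simp
  finally show ?thesis .
qed

lemma strongly_convergentI:
  fixes X :: "real \<Rightarrow> 'w \<Rightarrow> 'a::euclidean_space"
  assumes C: "0 \<le> C"
    and meas: "\<And>N h n. step_sizes T hbar N h \<Longrightarrow> n \<le> N \<Longrightarrow> (\<lambda>w. Xh h n w - X (grid h n) w) \<in> borel_measurable M"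
    and le: "\<And>N h n. step_sizes T hbar N h \<Longrightarrow> n \<le> N \<Longrightarrow>
      (\<integral>\<^sup>+w. ennreal ((norm (Xh h n w - X (grid h n) w))\<^sup>2) \<partial>M) \<le> ennreal (C * (max_step N h)\<^sup>2)"
  shows "strongly_convergent M T X Xh hbar 1"
  unfolding strongly_convergent_def
proof (intro exI[of _ "sqrt C"] allI impI conjI ballI)
  fix N h assume step: "step_sizes T hbar N h"
  have H: "0 < max_step N h" by (rule max_step_pos[OF step])
  have sq: "norm x powr 2 = (norm x)\<^sup>2" for x :: 'a by simp
  have int: "integrable M (\<lambda>w. (norm (Xh h n w - X (grid h n) w))\<^sup>2)" if "n \<le> N" for n
    by (rule integrable_norm_sq[OF meas[OF step that] le[OF step that]])
  have E: "expectation (\<lambda>w. (norm (Xh h n w - X (grid h n) w))\<^sup>2) \<le> C * (max_step N h)\<^sup>2" if "n \<le> N" for n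
    by (rule expectation_norm_sq_le[OF meas[OF step that] le[OF step that]]) (simp add: C)
  show "in_Lp M 2 (\<lambda>w. Xh h n w - X (grid h n) w)" if "n \<in> {0..N}" for n
  proof -
    have n: "n \<le> N" using that by simp
    show ?thesis unfolding in_Lp_def sq using int[OF n] meas[OF step n] by (rule conjI[rotated])
  qed
  have "Lp_norm M 2 (\<lambda>w. Xh h n w - X (grid h n) w) \<le> sqrt C * max_step N h powr 1" if "n \<le> N" for n
  proof -
    have "Lp_norm M 2 (\<lambda>w. Xh h n w - X (grid h n) w) = sqrt (expectation (\<lambda>w. (norm (Xh h n w - X (grid h n) w))\<^sup>2))"
      unfolding Lp_norm_def sq by (rule powr_half_sqrt) simp
    also have "\<dots> \<le> sqrt (C * (max_step N h)\<^sup>2)" by (rule real_sqrt_le_mono[OF E[OF that]])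
    also have "\<dots> = sqrt C * max_step N h powr 1" using H by (simp add: real_sqrt_mult)
    finally show ?thesis .
  qed
  then show "(MAX n\<in>{0..N}. Lp_norm M 2 (\<lambda>w. Xh h n w - X (grid h n) w)) \<le> sqrt C * max_step N h powr 1"
    by (intro Max.boundedI) (auto simp del: powr_one)
qed

end

theorem corollary2p5:
  fixes M :: "'w measure" and F :: "real \<Rightarrow> 'w measure" and T :: real
    and W :: "'m::finite \<Rightarrow> real \<Rightarrow> 'w \<Rightarrow> real"
    and f :: "real \<Rightarrow> real^'d \<Rightarrow> real^'d"
    and g :: "'m \<Rightarrow> real \<Rightarrow> real^'d"
    and L q :: real
    and X\<^sub>0 :: "'w \<Rightarrow> real^'d" and X :: "real \<Rightarrow> 'w \<Rightarrow> real^'d"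
  assumes "0 < T"
    and "usual_filtered_prob_space M F T"
    and "\<And>r. brownian_motion M F T (W r)"
    and "independent_processes M T W"
    and "C1_on ({0..T} \<times> UNIV) (\<lambda>(t, x). f t x)"
    and "\<And>r. C1_on {0..T} (g r)"
    and "0 < L" and "2 \<le> q"
    and "\<And>t x\<^sub>1 x\<^sub>2. t \<in> {0..T} \<Longrightarrow>
           (f t x\<^sub>1 - f t x\<^sub>2) \<bullet> (x\<^sub>1 - x\<^sub>2) \<le> L * (norm (x\<^sub>1 - x\<^sub>2))\<^sup>2"
    and "\<And>t x. t \<in> {0..T} \<Longrightarrow>
           norm (vector_derivative (\<lambda>s. f s x) (at t within {0..T})) \<le> L * (1 + norm x) powr q"
    and "\<And>t x\<^sub>1 x\<^sub>2. t \<in> {0..T} \<Longrightarrow>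
           onorm ((*v) (jacobian (f t) (at x\<^sub>1) - jacobian (f t) (at x\<^sub>2)))
             \<le> L * (1 + norm x\<^sub>1 + norm x\<^sub>2) powr (q - 2) * norm (x\<^sub>1 - x\<^sub>2)"
    and "X\<^sub>0 \<in> borel_measurable (F 0)"
    and "is_sode_solution M F T W f g X\<^sub>0 X"
  shows "(in_Lp M (8 * q - 6) X\<^sub>0 \<longrightarrow>
            (\<forall>hbar\<in>{0<..1}. strongly_convergent M T X
               (projected_euler_maruyama (1 / (2 * (q - 1))) f g W X\<^sub>0) hbar 1))
       \<and> (in_Lp M (6 * q - 4) X\<^sub>0 \<longrightarrow>
            (\<forall>hbar\<in>{0<..<1 / L}. strongly_convergent M T X
               (split_step_backward_euler f g W X\<^sub>0) hbar 1))"
proof -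
  interpret usual_filtered_prob_space M F T by (rule assms(2))
  have T: "0 < T" "0 \<le> T" using assms(1) by auto
  obtain K where "drift f (\<lambda>t x v. jacobian (f t) (at x) *v v) T L q K"
    by (rule drift_jacobian[OF assms(1,5,7-11)])
  then interpret drift f "\<lambda>t x v. jacobian (f t) (at x) *v v" T L q K .
  obtain I where X_adapt: "adapted F T X" and X_cont: "ae_continuous M T X"
    and ito: "\<And>r. is_ito_integral M F T (W r) (\<lambda>s _. g r s) (I r)"
    and X_eq: "AE w in M. \<forall>t\<in>{0..T}.
             X t w = X\<^sub>0 w + (LBINT s:{0..t}. f s (X s w)) + (\<Sum>r\<in>UNIV. I r t w)"
    using assms(13) unfolding is_sode_solution_def by blast
  have "\<forall>r. \<exists>B. 0 < B \<and> (\<forall>t\<in>{0..T}. norm (g r t) \<le> B)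
      \<and> (\<forall>s\<in>{0..T}. \<forall>t\<in>{0..T}. norm (g r t - g r s) \<le> B * \<bar>t - s\<bar>)"
    using C1_on_interval_bounds[OF assms(6)] by metis
  then obtain B0 where B0: "\<And>r. 0 < B0 r" "\<And>r t. t \<in> {0..T} \<Longrightarrow> norm (g r t) \<le> B0 r"
    "\<And>r s t. s \<in> {0..T} \<Longrightarrow> t \<in> {0..T} \<Longrightarrow> norm (g r t - g r s) \<le> B0 r * \<bar>t - s\<bar>"
    by metis
  define B where "B = (\<Sum>r\<in>UNIV. B0 r)"
  have B: "B0 r \<le> B" for r unfolding B_def using B0(1) by (intro member_le_sum) (auto intro: less_imp_le)
  interpret additive_noise M F T W g I B
  proof
    fix r
    show "brownian_motion M F T (W r)" by (rule assms(3))
    show "is_ito_integral M F T (W r) (\<lambda>s _. g r s) (I r)" by (rule ito)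
    show "0 < B" using B0(1)[of r] B[of r] by simp
    show "norm (g r t) \<le> B" if "t \<in> {0..T}" for t using B0(2)[OF that, of r] B[of r] by simp
    show "norm (g r t - g r s) \<le> B * \<bar>t - s\<bar>" if "s \<in> {0..T}" "t \<in> {0..T}" for s t
      using B0(3)[OF that, of r] mult_right_mono[OF B[of r] abs_ge_zero[of "t - s"]] by simp
    obtain D where "\<And>z. z \<in> {0..T} \<Longrightarrow> (g r has_derivative blinfun_apply (D z)) (at z within {0..T})"
      using assms(6)[of r] unfolding C1_on_def by blast
    then show "continuous_on {0..T} (g r)" by (rule has_derivative_continuous_on)
  qed
  \<comment> \<open>The estimates need continuity for every \<open>w\<close>. \<open>X'\<close> and,
    below, \<open>J\<close> agree with \<open>X\<close> and \<open>noise\<close> at all times almost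
    surely, so moments and errors are unchanged.\<close>
  obtain X' where X': "\<And>t. t \<in> {0..T} \<Longrightarrow> X' t \<in> borel_measurable (F t)"
    "(\<lambda>(t, w). X' t w) \<in> borel_measurable (borel \<Otimes>\<^sub>M M)"
    "\<And>w. w \<in> space M \<Longrightarrow> continuous_on {0..T} (\<lambda>t. X' t w)"
    "AE w in M. \<forall>t\<in>{0..T}. X' t w = X t w"
    by (rule continuous_modification[of X])
      (use T X_adapt X_cont in \<open>auto simp: adapted_def ae_continuous_def\<close>)
  obtain J where J: "\<And>t. t \<in> {0..T} \<Longrightarrow> J t \<in> borel_measurable (F t)"
    "(\<lambda>(t, w). J t w) \<in> borel_measurable (borel \<Otimes>\<^sub>M M)"
    "\<And>w. w \<in> space M \<Longrightarrow> continuous_on {0..T} (\<lambda>t. J t w)"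
    "AE w in M. \<forall>t\<in>{0..T}. J t w = noise t w"
    by (rule continuous_modification[of noise])
      (use T noise_adapted noise_ae_continuous in auto)
  \<comment> \<open>At time 0 the drift integral runs over a single point and the noise vanishes
    almost surely, so the equation itself yields the initial condition.\<close>
  have X0_AE: "AE w in M. X\<^sub>0 w = X' 0 w"
    using X_eq X'(4) noise_0[OF T(2)]
  proof eventually_elim
    case (elim w)
    have "X 0 w = X\<^sub>0 w + (LBINT s:{0..0}. f s (X s w)) + (\<Sum>r\<in>UNIV. I r 0 w)"
      using elim(1) T by auto
    moreover have "(LBINT s:{0..0}. f s (X s w)) = 0"
      unfolding set_lebesgue_integral_def
      by (rule integral_eq_zero_AE, use AE_lborel_singleton[of 0] in eventually_elim) simp
    ultimately show ?case using elim(2,3) T by (simp add: noise_def)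
  qed
  have J_diff: "AE w in M. J t w - J s w = noise t w - noise s w" if "s \<in> {0..T}" "t \<in> {0..T}" for s t
    using J(4) by eventually_elim (use that in simp)
  have J_meas: "J t \<in> borel_measurable M" "noise t \<in> borel_measurable M" if "t \<in> {0..T}" for t
    using measurable_F_M[OF that] J(1)[OF that] noise_adapted[OF that] by auto
  interpret S: additive_noise_sode M F T f "\<lambda>t x v. jacobian (f t) (at x) *v v" L q K X' J
  proof
    show "AE w in M. J 0 w = 0 \<and> (\<forall>t\<in>{0..T}. X' t w = X' 0 w + integral {0..t} (\<lambda>s. f s (X' s w)) + J t w)"
      using X_eq X'(4) J(4) X0_AE noise_0[OF T(2)] AE_space
    proof eventually_elim
      case (elim w)
      have "X' t w = X' 0 w + integral {0..t} (\<lambda>s. f s (X' s w)) + J t w" if t: "t \<in> {0..T}" for t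
      proof -
        have "continuous_on {0..t} (\<lambda>s. f s (X' s w))"
          by (rule continuous_on_drift, rule continuous_on_subset[OF X'(3)[OF elim(6)]]) (use t in auto)
        then have "(LBINT s:{0..t}. f s (X' s w)) = integral {0..t} (\<lambda>s. f s (X' s w))"
          by (intro set_borel_integral_eq_integral(2) borel_integrable_atLeastAtMost')
        moreover have "(LBINT s:{0..t}. f s (X s w)) = (LBINT s:{0..t}. f s (X' s w))"
          using elim(2) t unfolding set_lebesgue_integral_def
          by (intro Bochner_Integration.integral_cong) (auto simp: indicator_def)
        moreover have "X t w = X\<^sub>0 w + (LBINT s:{0..t}. f s (X s w)) + noise t w"
          using bspec[OF elim(1) t] by (simp only: noise_def)
        moreover have "X' t w = X t w" "J t w = noise t w" using elim(2,3) t by auto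
        ultimately show ?thesis using elim(4) by (simp only:)
      qed
      moreover have "J 0 w = 0" using bspec[OF elim(3), of 0] elim(5) T by simp
      ultimately show ?case by blast
    qed
    show "\<exists>C\<ge>0. \<forall>s t. 0 \<le> s \<and> s < t \<and> t \<le> T \<longrightarrow>
          (\<integral>\<^sup>+w. ennreal (norm (J t w - J s w) powr r) \<partial>M) \<le> ennreal (C * (t - s) powr (r / 2))"
      if r: "0 \<le> r" for r
    proof -
      obtain C where C: "0 \<le> C" "\<And>s t. 0 \<le> s \<and> s < t \<and> t \<le> T \<Longrightarrow>
          (\<integral>\<^sup>+w. ennreal (norm (noise t w - noise s w) powr r) \<partial>M) \<le> ennreal (C * (t - s) powr (r / 2))"
        using noise_moment[OF r] by blast
      have "(\<integral>\<^sup>+w. ennreal (norm (J t w - J s w) powr r) \<partial>M) = (\<integral>\<^sup>+w. ennreal (norm (noise t w - noise s w) powr r) \<partial>M)"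
        if "0 \<le> s \<and> s < t \<and> t \<le> T" for s t
        by (rule nn_integral_cong_AE) (use J_diff[of s t] that in auto)
      then show ?thesis using C by auto
    qed
    show "(\<integral>w. indicator E w *\<^sub>R (J t w - J s w) \<partial>M) = 0"
      if st: "0 \<le> s" "s \<le> t" "t \<le> T" and E: "E \<in> sets (F s)" for s t E
    proof -
      have sT: "s \<in> {0..T}" "t \<in> {0..T}" using st by auto
      have [measurable]: "E \<in> sets M" by (rule sets_F_M[OF sT(1) E])
      note [measurable] = J_meas[OF sT(1)] J_meas[OF sT(2)]
      have "(\<integral>w. indicator E w *\<^sub>R (J t w - J s w) \<partial>M) = (\<integral>w. indicator E w *\<^sub>R (noise t w - noise s w) \<partial>M)"
        by (rule integral_cong_AE) (use J_diff[OF sT] in auto)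
      then show ?thesis using noise_mean(1)[OF st E] by simp
    qed
  qed (use X'(1-3) J(1-3) in auto)
  obtain c where c: "0 \<le> c" "\<And>s t \<sigma>. 0 \<le> s \<and> s < t \<and> t \<le> T \<and> \<sigma> \<in> {s..t} \<Longrightarrow>
    (\<integral>\<^sup>+w. ennreal ((norm (noise t w - noise s w - noise_approx \<sigma> s t w))\<^sup>2) \<partial>M) \<le> ennreal (c * (t - s)^3)"
    using noise_approx_error by blast
  have moment: "(\<integral>\<^sup>+w. ennreal (norm (X' 0 w) powr r) \<partial>M) < \<infinity>" if "in_Lp M p X\<^sub>0" "0 \<le> r" "r \<le> p" for p r
  proof -
    have "(\<integral>\<^sup>+w. ennreal (norm (X' 0 w) powr r) \<partial>M) = (\<integral>\<^sup>+w. ennreal (norm (X\<^sub>0 w) powr r) \<partial>M)"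
      by (rule nn_integral_cong_AE) (use X0_AE in auto)
    then show ?thesis using in_Lp_nn_integral_finite[OF that] by simp
  qed
  \<comment> \<open>Both methods at once: \<open>\<Phi>\<close> is the deterministic part of a step,
    \<open>\<sigma>\<close> the time at which the noise coefficients are evaluated, and
    \<open>\<kappa>\<close> the weight of the consistency error. The order \<open>p\<close> must
    cover the local error and \<open>2 * \<kappa>\<close>.\<close>
  have convergent: "strongly_convergent M T X Y hbar 1"
    if p: "in_Lp M p X\<^sub>0" "6 * q - 4 \<le> p" "2 * \<kappa> \<le> p" and \<kappa>: "1 \<le> \<kappa>" and pos: "0 \<le> Cs" "0 \<le> Cc"
      and Y0: "\<And>h. Y h 0 = X\<^sub>0"
      and YS: "\<And>h n w. Y h (Suc n) w = \<Phi> h n (Y h n w)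
          + noise_approx (\<sigma> h n) (grid h n) (grid h (Suc n)) w"
      and \<sigma>: "\<And>h n. \<sigma> h n = grid h n \<or> \<sigma> h n = grid h (Suc n)"
      and stable: "\<And>h n x y. 0 < h (Suc n) \<Longrightarrow> h (Suc n) \<le> hbar \<Longrightarrow> grid h n \<in> {0..T} \<Longrightarrow> grid h (Suc n) \<in> {0..T} \<Longrightarrow>
          (norm (\<Phi> h n x - \<Phi> h n y))\<^sup>2 \<le> (1 + Cs * h (Suc n)) * (norm (x - y))\<^sup>2"
      and cons: "\<And>h n x. 0 < h (Suc n) \<Longrightarrow> h (Suc n) \<le> hbar \<Longrightarrow> grid h n \<in> {0..T} \<Longrightarrow> grid h (Suc n) \<in> {0..T} \<Longrightarrow>
          norm (\<Phi> h n x - x - h (Suc n) *\<^sub>R f (grid h n) x) \<le> Cc * (h (Suc n))\<^sup>2 * (1 + norm x) powr \<kappa>"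
    for Y \<Phi> \<sigma> hbar \<kappa> Cs Cc p
  proof -
    have m1: "(\<integral>\<^sup>+w. ennreal (norm (X' 0 w) powr (6 * q - 4)) \<partial>M) < \<infinity>"
      by (rule moment[OF p(1) _ p(2)]) (use assms(8) in simp)
    have m2: "(\<integral>\<^sup>+w. ennreal (norm (X' 0 w) powr (2 * \<kappa>)) \<partial>M) < \<infinity>"
      by (rule moment[OF p(1) _ p(3)]) (use \<kappa> in simp)
    obtain C where C: "0 \<le> C" and conv: "\<And>hbar N h Y \<Phi> \<eta>. step_sizes T hbar N h \<Longrightarrow>
        S.one_step_method Cs Cc \<kappa> c N h Y \<Phi> \<eta> \<Longrightarrow>
        \<forall>n\<le>N. Y n \<in> borel_measurable M \<and>
          (\<integral>\<^sup>+w. ennreal ((norm (Y n w - X' (grid h n) w))\<^sup>2) \<partial>M) \<le> ennreal (C * (max_step N h)\<^sup>2)"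
      by (rule S.one_step_method_convergence[OF m1 m2 \<kappa> pos c(1)]) (rule that; assumption)
    have bound: "Y h n \<in> borel_measurable M \<and>
        (\<integral>\<^sup>+w. ennreal ((norm (Y h n w - X' (grid h n) w))\<^sup>2) \<partial>M) \<le> ennreal (C * (max_step N h)\<^sup>2)"
      if step: "step_sizes T hbar N h" and n: "n \<le> N" for N h n
    proof -
      have g1: "0 < h (Suc n)" "h (Suc n) \<le> hbar" "grid h n \<in> {0..T}" "grid h (Suc n) \<in> {0..T}"
        "0 \<le> grid h n" "grid h n < grid h (Suc n)" "grid h (Suc n) \<le> T" "grid h (Suc n) - grid h n = h (Suc n)"
        if "n < N" for n
        using step that grid_bounds[OF step, of n] grid_bounds[OF step, of "Suc n"]
        by (auto simp: step_sizes_def grid_simps)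
      let ?\<eta> = "\<lambda>n. noise_approx (\<sigma> h n) (grid h n) (grid h (Suc n))"
      have "S.one_step_method Cs Cc \<kappa> c N h (Y h) (\<Phi> h) ?\<eta>"
        unfolding S.one_step_method_def Y0
      proof (intro conjI allI impI)
        show "X\<^sub>0 \<in> borel_measurable (F 0)" by (rule assms(12))
        show "AE w in M. X\<^sub>0 w = X' 0 w" by (rule X0_AE)
        fix n assume n: "n < N"
        let ?s = "grid h n" and ?t = "grid h (Suc n)"
        show "Y h (Suc n) w = \<Phi> h n (Y h n w) + ?\<eta> n w" for w by (rule YS)
        show "(norm (\<Phi> h n x - \<Phi> h n y))\<^sup>2 \<le> (1 + Cs * h (Suc n)) * (norm (x - y))\<^sup>2" for x y
          by (rule stable) (rule g1[OF n])+
        show "norm (\<Phi> h n x - x - h (Suc n) *\<^sub>R f ?s x) \<le> Cc * (h (Suc n))\<^sup>2 * (1 + norm x) powr \<kappa>" for x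
          by (rule cons) (rule g1[OF n])+
        have st: "0 \<le> ?s" "?s < ?t" "?s \<le> ?t" "?t \<le> T" using g1[OF n] by auto
        have \<eta>F: "?\<eta> n \<in> borel_measurable (F ?t)" by (rule noise_approx_adapted[OF st(1,3,4)])
        have AE_eq: "AE w in M. J ?t w - J ?s w - ?\<eta> n w = noise ?t w - noise ?s w - ?\<eta> n w"
          using J_diff[OF g1(3,4)[OF n]] by eventually_elim simp
        show "S.noise_approximation c ?s ?t (?\<eta> n)"
          unfolding S.noise_approximation_def
        proof (intro conjI ballI \<eta>F)
          have "(\<integral>\<^sup>+w. ennreal ((norm (J ?t w - J ?s w - ?\<eta> n w))\<^sup>2) \<partial>M)
            = (\<integral>\<^sup>+w. ennreal ((norm (noise ?t w - noise ?s w - ?\<eta> n w))\<^sup>2) \<partial>M)"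
            by (rule nn_integral_cong_AE) (use AE_eq in auto)
          then show "(\<integral>\<^sup>+w. ennreal ((norm (J ?t w - J ?s w - ?\<eta> n w))\<^sup>2) \<partial>M) \<le> ennreal (c * (?t - ?s)^3)"
            using c(2)[of ?s ?t "\<sigma> h n"] st \<sigma>[of h n] by auto
          fix E assume E: "E \<in> sets (F ?s)"
          note [measurable] = J_meas[OF g1(3)[OF n]] J_meas[OF g1(4)[OF n]] sets_F_M[OF g1(3)[OF n] E]
            measurable_F_M[OF g1(4)[OF n] \<eta>F]
          have "(\<integral>w. indicator E w *\<^sub>R (J ?t w - J ?s w - ?\<eta> n w) \<partial>M)
            = (\<integral>w. indicator E w *\<^sub>R (noise ?t w - noise ?s w - ?\<eta> n w) \<partial>M)"
            by (rule integral_cong_AE) (use AE_eq in auto)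
          then show "(\<integral>w. indicator E w *\<^sub>R (J ?t w - J ?s w - ?\<eta> n w) \<partial>M) = 0"
            using noise_mean(2)[OF st(1,3,4) E] by simp
        qed
      qed
      from conv[OF step this]
      show ?thesis using n by blast
    qed
    show ?thesis
    proof (rule strongly_convergentI[OF C])
      fix N h n assume step: "step_sizes T hbar N h" and n: "n \<le> N"
      have gT: "grid h n \<in> {0..T}" using grid_bounds[OF step n] by simp
      have "X (grid h n) \<in> borel_measurable M"
        by (rule measurable_F_M[OF gT]) (use X_adapt gT in \<open>simp add: adapted_def\<close>)
      then show "(\<lambda>w. Y h n w - X (grid h n) w) \<in> borel_measurable M" using bound[OF step n] by auto
      have "(\<integral>\<^sup>+w. ennreal ((norm (Y h n w - X (grid h n) w))\<^sup>2) \<partial>M) = (\<integral>\<^sup>+w. ennreal ((norm (Y h n w - X' (grid h n) w))\<^sup>2) \<partial>M)"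
        by (rule nn_integral_cong_AE) (use X'(4) gT in auto)
      then show "(\<integral>\<^sup>+w. ennreal ((norm (Y h n w - X (grid h n) w))\<^sup>2) \<partial>M) \<le> ennreal (C * (max_step N h)\<^sup>2)"
        using bound[OF step n] by simp
    qed
  qed
  show ?thesis
  proof (intro conjI impI ballI)
    fix hbar :: real assume Lp: "in_Lp M (8 * q - 6) X\<^sub>0" and hbar: "hbar \<in> {0<..1}"
    let ?\<pi> = "pem_projection (1 / (2 * (q - 1)))"
    \<comment> \<open>Here \<open>\<kappa> = 4 * q - 3\<close>, and the consistency error is what
      demands moments of order \<open>8 * q - 6\<close>.\<close>
    show "strongly_convergent M T X (projected_euler_maruyama (1 / (2 * (q - 1))) f g W X\<^sub>0) hbar 1"
    proof (rule convergent[of "8 * q - 6" "4 * q - 3" "2 * L + K\<^sup>2 * 3 powr (2 * (q - 1))" "1 + K * 2 powr (q - 1)"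
          "projected_euler_maruyama (1 / (2 * (q - 1))) f g W X\<^sub>0"
          "\<lambda>h n x. ?\<pi> (h (Suc n)) x + h (Suc n) *\<^sub>R f (grid h n) (?\<pi> (h (Suc n)) x)"
          "\<lambda>h n. grid h n" hbar, OF Lp])
      show "6 * q - 4 \<le> 8 * q - 6" "2 * (4 * q - 3) \<le> 8 * q - 6" "1 \<le> 4 * q - 3" using assms(8) by auto
      show "0 \<le> 2 * L + K\<^sup>2 * 3 powr (2 * (q - 1))" "0 \<le> 1 + K * 2 powr (q - 1)" using L_pos K_ge by auto
      fix h n
      show "projected_euler_maruyama (1 / (2 * (q - 1))) f g W X\<^sub>0 h 0 = X\<^sub>0"
        "grid h n = grid h n \<or> grid h n = grid h (Suc n)" by simp_all
      show "projected_euler_maruyama (1 / (2 * (q - 1))) f g W X\<^sub>0 h (Suc n) w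
        = ?\<pi> (h (Suc n)) (projected_euler_maruyama (1 / (2 * (q - 1))) f g W X\<^sub>0 h n w)
          + h (Suc n) *\<^sub>R f (grid h n) (?\<pi> (h (Suc n)) (projected_euler_maruyama (1 / (2 * (q - 1))) f g W X\<^sub>0 h n w))
          + noise_approx (grid h n) (grid h n) (grid h (Suc n)) w" for w
        by (simp add: Let_def noise_approx_def)
      assume h: "0 < h (Suc n)" "h (Suc n) \<le> hbar" "grid h n \<in> {0..T}"
      then have "h (Suc n) \<le> 1" using hbar by simp
      from pem_step_stable[OF h(1) this h(3)] pem_step_consistent[OF h(1,3)]
      show "(norm (?\<pi> (h (Suc n)) x + h (Suc n) *\<^sub>R f (grid h n) (?\<pi> (h (Suc n)) x)
            - (?\<pi> (h (Suc n)) y + h (Suc n) *\<^sub>R f (grid h n) (?\<pi> (h (Suc n)) y))))\<^sup>2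
          \<le> (1 + (2 * L + K\<^sup>2 * 3 powr (2 * (q - 1))) * h (Suc n)) * (norm (x - y))\<^sup>2"
        "norm (?\<pi> (h (Suc n)) x + h (Suc n) *\<^sub>R f (grid h n) (?\<pi> (h (Suc n)) x) - x - h (Suc n) *\<^sub>R f (grid h n) x)
          \<le> (1 + K * 2 powr (q - 1)) * (h (Suc n))\<^sup>2 * (1 + norm x) powr (4 * q - 3)" for x y
        by blast+
    qed
  next
    fix hbar assume Lp: "in_Lp M (6 * q - 4) X\<^sub>0" and hbar: "hbar \<in> {0<..<1 / L}"
    have hL: "hbar * L < 1" using hbar L_pos by (simp add: field_simps)
    define a where "a = 1 / (1 - hbar * L)"
    have a: "0 < a" using hL by (simp add: a_def)
    \<comment> \<open>Here \<open>\<kappa> = 2 * q - 1\<close>, so \<open>2 * \<kappa>\<close> stays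
      below \<open>6 * q - 4\<close> and the local error of the exact solution determines the order
      of integrability.\<close>
    show "strongly_convergent M T X (split_step_backward_euler f g W X\<^sub>0) hbar 1"
    proof (rule convergent[of "6 * q - 4" "2 * q - 1" "2 * (a * L) + (a * L)\<^sup>2 * hbar"
          "K\<^sup>2 * a * (2 + a + a * hbar * K) powr (q - 1) + K" "split_step_backward_euler f g W X\<^sub>0"
          "\<lambda>h n. resolvent (h (Suc n)) (grid h (Suc n))" "\<lambda>h n. grid h (Suc n)" hbar, OF Lp])
      show "6 * q - 4 \<le> 6 * q - 4" "2 * (2 * q - 1) \<le> 6 * q - 4" "1 \<le> 2 * q - 1" using assms(8) by auto
      show "0 \<le> 2 * (a * L) + (a * L)\<^sup>2 * hbar" "0 \<le> K\<^sup>2 * a * (2 + a + a * hbar * K) powr (q - 1) + K"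
        using a L_pos K_ge hbar by auto
      show "(norm (resolvent (h (Suc n)) (grid h (Suc n)) x - resolvent (h (Suc n)) (grid h (Suc n)) y))\<^sup>2
          \<le> (1 + (2 * (a * L) + (a * L)\<^sup>2 * hbar) * h (Suc n)) * (norm (x - y))\<^sup>2"
        if "0 < h (Suc n)" "h (Suc n) \<le> hbar" "grid h n \<in> {0..T}" "grid h (Suc n) \<in> {0..T}" for h n x y
        unfolding a_def by (rule resolvent_stable[OF that(1,2) hL that(3,4)]) (simp add: grid_simps)
      show "norm (resolvent (h (Suc n)) (grid h (Suc n)) x - x - h (Suc n) *\<^sub>R f (grid h n) x)
          \<le> (K\<^sup>2 * a * (2 + a + a * hbar * K) powr (q - 1) + K) * (h (Suc n))\<^sup>2 * (1 + norm x) powr (2 * q - 1)"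
        if "0 < h (Suc n)" "h (Suc n) \<le> hbar" "grid h n \<in> {0..T}" "grid h (Suc n) \<in> {0..T}" for h n x
        unfolding a_def by (rule resolvent_consistent[OF that(1,2) hL that(3,4)]) (simp add: grid_simps)
    qed (auto simp: Let_def noise_approx_def resolvent_def)
  qed
qed

end
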